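(* Let $\mathsf G^{\mathrm{met}}$ be a metric graph with a finite number of edges and let $\tau>0$. The optimal (smallest) constant $C$ in the inequality $$\sqrt{\Gamma(P_tf)}\le C\,P_t\sqrt{\Gamma(f)}\quad\mu\text{-a.e.},\qquad f\in\operatorname{Dom}\mathcal E,\ 0\le t\le\tau,$$ satisfies $$C\ge\max_{v}(\deg v-1),$$ where the maximum is taken over the set of vertices of the graph.
   Context: Metric graphs. A graph consists of a set $V$ of vertices, a finite set $\mathsf E$ of (internal) edges, each $e\in\mathsf E$ having endpoints $e^-,e^+\in V$ and a length $r(e)\in(0,\infty)$, and a finite set $\mathsf R$ of rays, each having one endpoint $e^-\in V$ and infinite length. It has no tadpoles, i.e. $e^-\neq e^+$ for every $e\in\mathsf E$ (tadpoles may be removed by inserting a vertex at the midpoint). The degree $\deg v$ is the number of edges and rays having $v$ as an endpoint. Put $I_e=[0,r(e)]$ for $e\in\mathsf E$ and $I_e=[0,\infty)$ for $e\in\mathsf R$. The metric graph $\mathsf G^{\mathrm{met}}$ is the disjoint union of the $I_e$ with endpoints identified whenever they correspond to the same vertex ($0\in I_e$ corresponds to $e^-$, $r(e)\in I_e$ to $e^+$). The measure $\mu$ is Lebesgue measure on each $I_e$, and $L^2(\mathsf G^{\mathrm{met}},\mu)=\bigoplus_eL^2(I_e)$, $f=(f_e)_e$. Dirichlet form. $\operatorname{Dom}\mathcal E=H^1_0(\mathsf G^{\mathrm{met}})$ is the set of $f\in L^2(\mathsf G^{\mathrm{met}})$ with $f_e\in H^1(I_e)$ for all $e$ and $f$ continuous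 at every vertex; $\mathcal E(f,g)=\int f'g'\,d\mu$, $\Gamma(f,g)=f'g'$, $\Gamma(f)=\Gamma(f,f)$. $\Delta$ is the nonpositive self-adjoint generator of $\mathcal E$ ($\mathcal E(u,v)=-\int v\Delta u\,d\mu$), i.e. $\Delta f=f''$ with standard (Kirchhoff) conditions at the vertices, and $P_t=e^{t\Delta}$. *)

theory Defs
  imports "HOL-Analysis.Analysis"
begin

text \<open>The endpoints of an edge \<open>e\<close> are \<open>tail G e\<close> (written \<open>e\<close>-minus) and \<open>head G e\<close>
  (\<open>e\<close>-plus). The fields \<open>head\<close> and \<open>len\<close> are only meaningful on \<open>edges G\<close>, since rays have
  a single endpoint and infinite length.\<close>

record ('v, 'e) mgraph =
  verts :: "'v set"
  edges :: "'e set"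
  rays :: "'e set"
  tail :: "'e \<Rightarrow> 'v"
  head :: "'e \<Rightarrow> 'v"
  len :: "'e \<Rightarrow> real"

locale metric_graph =
  fixes G :: "('v, 'e) mgraph"
  assumes finite_edges: "finite (edges G)"
    and finite_rays: "finite (rays G)"
    and edges_rays_disjoint: "edges G \<inter> rays G = {}"
    and tail_in_verts: "e \<in> edges G \<union> rays G \<Longrightarrow> tail G e \<in> verts G"
    and head_in_verts: "e \<in> edges G \<Longrightarrow> head G e \<in> verts G"
    and len_pos: "e \<in> edges G \<Longrightarrow> 0 < len G e"
    and no_tadpoles: "e \<in> edges G \<Longrightarrow> tail G e \<noteq> head G e"

definition degree :: "('v, 'e) mgraph \<Rightarrow> 'v \<Rightarrow> nat" where
  "degree G v = card {e \<in> edges G. tail G e = v \<or> head G e = v} + card {e \<in> rays G. tail G e = v}"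

definition edge_interval :: "('v, 'e) mgraph \<Rightarrow> 'e \<Rightarrow> real set" where
  "edge_interval G e = (if e \<in> edges G then {0..len G e} else {0..})"

text \<open>A function \<open>f = (f\<^sub>e)\<^sub>e\<close> on the metric graph is a function of pairs \<open>(e, x)\<close> with \<open>x\<close> in
  the interval of \<open>e\<close>. The points of the disjoint union that are identified at the vertices form
  a null set, so the identification does not affect the measure; it enters through the continuity
  condition in the domain of the Dirichlet form.\<close>

definition graph_measure :: "('v, 'e) mgraph \<Rightarrow> ('e \<times> real) measure" where
  "graph_measure G =
     restrict_space (count_space (edges G \<union> rays G) \<Otimes>\<^sub>M lborel)
       (Sigma (edges G \<union> rays G) (edge_interval G))"

text \<open>Square-integrable functions, as representatives of almost everywhere classes.\<close>

definition L2 :: "'a measure \<Rightarrow> ('a \<Rightarrow> real) set" where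
  "L2 M = {f \<in> borel_measurable M. integrable M (\<lambda>x. (f x)\<^sup>2)}"

definition L2_norm :: "'a measure \<Rightarrow> ('a \<Rightarrow> real) \<Rightarrow> real" where
  "L2_norm M f = sqrt (\<integral>x. (f x)\<^sup>2 \<partial>M)"

text \<open>Weak derivatives and \<open>H\<^sup>1\<close> on an interval, with continuously differentiable test functions
  of compact support in the interior.\<close>

definition test_functions :: "real set \<Rightarrow> (real \<Rightarrow> real) set" where
  "test_functions I = {\<phi>. \<phi> C1_differentiable_on UNIV \<and>
     (\<exists>K. compact K \<and> K \<subseteq> interior I \<and> (\<forall>x. x \<notin> K \<longrightarrow> \<phi> x = 0))}"

definition weak_derivative :: "real set \<Rightarrow> (real \<Rightarrow> real) \<Rightarrow> (real \<Rightarrow> real) \<Rightarrow> bool" where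
  "weak_derivative I f g \<longleftrightarrow>
     (\<forall>\<phi>\<in>test_functions I.
        (\<integral>x. f x * deriv \<phi> x \<partial>restrict_space lborel I)
          = - (\<integral>x. g x * \<phi> x \<partial>restrict_space lborel I))"

definition H1 :: "real set \<Rightarrow> (real \<Rightarrow> real) set" where
  "H1 I = {f \<in> L2 (restrict_space lborel I).
     \<exists>g\<in>L2 (restrict_space lborel I). weak_derivative I f g}"

text \<open>Continuity at the vertices refers to the continuous representatives \<open>F e\<close> of the functions
  \<open>f\<^sub>e\<close>: their boundary values at a vertex \<open>v\<close> all equal a common value \<open>c v\<close>.\<close>

definition continuous_at_vertices :: "('v, 'e) mgraph \<Rightarrow> ('e \<times> real \<Rightarrow> real) \<Rightarrow> bool" where
  "continuous_at_vertices G f \<longleftrightarrow>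
     (\<exists>(F :: 'e \<Rightarrow> real \<Rightarrow> real) (c :: 'v \<Rightarrow> real).
        (\<forall>e\<in>edges G \<union> rays G.
           continuous_on (edge_interval G e) (F e) \<and>
           (AE x in restrict_space lborel (edge_interval G e). f (e, x) = F e x) \<and>
           F e 0 = c (tail G e)) \<and>
        (\<forall>e\<in>edges G. F e (len G e) = c (head G e)))"

definition form_domain :: "('v, 'e) mgraph \<Rightarrow> ('e \<times> real \<Rightarrow> real) set" where
  "form_domain G = {f \<in> L2 (graph_measure G).
     (\<forall>e\<in>edges G \<union> rays G. (\<lambda>x. f (e, x)) \<in> H1 (edge_interval G e)) \<and>
     continuous_at_vertices G f}"

text \<open>The derivative \<open>f'\<close> is determined almost everywhere, whenever every \<open>f\<^sub>e\<close> is in \<open>H\<^sup>1\<close>.\<close>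

definition graph_deriv :: "('v, 'e) mgraph \<Rightarrow> ('e \<times> real \<Rightarrow> real) \<Rightarrow> 'e \<times> real \<Rightarrow> real" where
  "graph_deriv G f = (\<lambda>(e, x).
     (SOME g. g \<in> L2 (restrict_space lborel (edge_interval G e)) \<and>
        weak_derivative (edge_interval G e) (\<lambda>y. f (e, y)) g) x)"

definition carre_du_champ ::
    "('v, 'e) mgraph \<Rightarrow> ('e \<times> real \<Rightarrow> real) \<Rightarrow> ('e \<times> real \<Rightarrow> real) \<Rightarrow> 'e \<times> real \<Rightarrow> real" where
  "carre_du_champ G f g = (\<lambda>p. graph_deriv G f p * graph_deriv G g p)"

abbreviation Gamma :: "('v, 'e) mgraph \<Rightarrow> ('e \<times> real \<Rightarrow> real) \<Rightarrow> 'e \<times> real \<Rightarrow> real" where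
  "Gamma G f \<equiv> carre_du_champ G f f"

definition dirichlet_form ::
    "('v, 'e) mgraph \<Rightarrow> ('e \<times> real \<Rightarrow> real) \<Rightarrow> ('e \<times> real \<Rightarrow> real) \<Rightarrow> real" where
  "dirichlet_form G f g = (\<integral>p. carre_du_champ G f g p \<partial>graph_measure G)"

text \<open>\<open>is_laplacian G u h\<close> states that \<open>u\<close> is in the domain of the generator of the Dirichlet form
  and that \<open>\<Delta> u = h\<close> almost everywhere.\<close>

definition is_laplacian ::
    "('v, 'e) mgraph \<Rightarrow> ('e \<times> real \<Rightarrow> real) \<Rightarrow> ('e \<times> real \<Rightarrow> real) \<Rightarrow> bool" where
  "is_laplacian G u h \<longleftrightarrow>
     u \<in> form_domain G \<and> h \<in> L2 (graph_measure G) \<and>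
     (\<forall>v\<in>form_domain G. dirichlet_form G u v = - (\<integral>p. v p * h p \<partial>graph_measure G))"

text \<open>Strongly continuous semigroups of bounded operators on \<open>L\<^sup>2\<close>. Linearity and boundedness
  imply that \<open>P t\<close> respects almost everywhere equality.\<close>

definition C0_semigroup :: "'a measure \<Rightarrow> (real \<Rightarrow> ('a \<Rightarrow> real) \<Rightarrow> 'a \<Rightarrow> real) \<Rightarrow> bool" where
  "C0_semigroup M P \<longleftrightarrow>
     (\<forall>t\<ge>0. \<forall>f\<in>L2 M. P t f \<in> L2 M) \<and>
     (\<forall>t\<ge>0. \<forall>f\<in>L2 M. \<forall>g\<in>L2 M. \<forall>a b.
        AE x in M. P t (\<lambda>y. a * f y + b * g y) x = a * P t f x + b * P t g x) \<and>
     (\<forall>t\<ge>0. \<exists>B. \<forall>f\<in>L2 M. L2_norm M (P t f) \<le> B * L2_norm M f) \<and>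
     (\<forall>f\<in>L2 M. AE x in M. P 0 f x = f x) \<and>
     (\<forall>s\<ge>0. \<forall>t\<ge>0. \<forall>f\<in>L2 M. AE x in M. P (s + t) f x = P s (P t f) x) \<and>
     (\<forall>f\<in>L2 M. ((\<lambda>t. L2_norm M (\<lambda>x. P t f x - f x)) \<longlongrightarrow> 0) (at_right 0))"

definition infinitesimal_generator ::
    "'a measure \<Rightarrow> (real \<Rightarrow> ('a \<Rightarrow> real) \<Rightarrow> 'a \<Rightarrow> real) \<Rightarrow> ('a \<Rightarrow> real) \<Rightarrow> ('a \<Rightarrow> real) \<Rightarrow> bool" where
  "infinitesimal_generator M P u h \<longleftrightarrow>
     u \<in> L2 M \<and> h \<in> L2 M \<and>
     ((\<lambda>t. L2_norm M (\<lambda>x. (P t u x - u x) / t - h x)) \<longlongrightarrow> 0) (at_right 0)"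

text \<open>\<open>P t = e\<^sup>t\<^sup>\<Delta>\<close> is the strongly continuous semigroup generated by the Laplacian: the two
  operators agree including their domains, which determines \<open>P t f\<close> up to null sets.\<close>

definition heat_semigroup ::
    "('v, 'e) mgraph \<Rightarrow> (real \<Rightarrow> ('e \<times> real \<Rightarrow> real) \<Rightarrow> 'e \<times> real \<Rightarrow> real) \<Rightarrow> bool" where
  "heat_semigroup G P \<longleftrightarrow>
     C0_semigroup (graph_measure G) P \<and>
     (\<forall>u h. infinitesimal_generator (graph_measure G) P u h \<longleftrightarrow> is_laplacian G u h)"

definition gradient_estimate ::
    "('v, 'e) mgraph \<Rightarrow> (real \<Rightarrow> ('e \<times> real \<Rightarrow> real) \<Rightarrow> 'e \<times> real \<Rightarrow> real) \<Rightarrow> real \<Rightarrow> real \<Rightarrow> bool" where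
  "gradient_estimate G P \<tau> C \<longleftrightarrow>
     (\<forall>f\<in>form_domain G. \<forall>t\<in>{0..\<tau>}. AE p in graph_measure G.
        sqrt (Gamma G (P t f) p) \<le> C * P t (\<lambda>q. sqrt (Gamma G f q)) p)"

text \<open>The infimum is a minimum if some finite constant is admissible, and \<open>\<infinity>\<close> otherwise. The
  restriction to \<open>C \<ge> 0\<close> only matters for a graph without edges and rays, where every real
  constant is admissible.\<close>

definition optimal_constant ::
    "('v, 'e) mgraph \<Rightarrow> (real \<Rightarrow> ('e \<times> real \<Rightarrow> real) \<Rightarrow> 'e \<times> real \<Rightarrow> real) \<Rightarrow> real \<Rightarrow> ereal" where
  "optimal_constant G P \<tau> = Inf {ereal C | C. 0 \<le> C \<and> gradient_estimate G P \<tau> C}"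

end

theory Submission
  imports Defs "HOL-Real_Asymp.Real_Asymp"
begin

text \<open>
  The lower bound comes from the behaviour of the heat flow close to a vertex \<open>v\<close> of degree
  \<open>d \<ge> 2\<close>. Let \<open>f'\<close> be a unit mass on one leg \<open>e0\<close>, very close to \<open>v\<close>. On the infinite star with
  \<open>d\<close> legs the flow is explicit: a Gaussian wave arriving at \<open>v\<close> is reflected into \<open>e0\<close> with
  coefficient \<open>2/d - 1\<close> and transmitted with coefficient \<open>2/d\<close>, while the derivative of a solution
  is reflected with the opposite coefficient \<open>1 - 2/d\<close>. On \<open>e0\<close> the direct
  and the reflected wave nearly coincide, so that the derivative of \<open>P t f\<close> is proportional to
  \<open>1 + (1 - 2/d) = 2 - 2/d\<close>, but \<open>P t \<bar>f'\<bar>\<close> to \<open>1 + (2/d - 1) = 2/d\<close>. The quotient of the two is \<open>d - 1\<close>.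

  The proof replaces the heat kernel by the resolvent at \<open>k\<^sup>2\<close>, with \<open>k \<rightarrow> \<infinity>\<close>, where waves are
  exponentials; the mass of \<open>f'\<close> is put within distance \<open>2/k\<^sup>2\<close> of the vertex. The gradient estimate
  is tested against a fixed bump \<open>\<psi> \<ge> 0\<close> on \<open>e0\<close>, which only involves \<open>\<integral> \<psi>' P t f\<close> and
  \<open>\<integral> \<psi> P t \<bar>f'\<bar>\<close> (\<open>tested_gradient_estimate\<close>), and then integrated against \<open>exp (- k\<^sup>2 t)\<close> over
  \<open>0 \<le> t \<le> \<tau>\<close> (\<open>truncated_resolvent\<close>, \<open>laplace_transformed_estimate\<close>). Since the Laplacian is
  symmetric, it is enough to know approximate solutions \<open>u\<close>, \<open>w\<close> of \<open>(k\<^sup>2 - \<Delta>) u = 2 k \<psi>\<close> and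
  \<open>(k\<^sup>2 - \<Delta>) w = 2 k \<psi>'\<close> in the domain of \<open>\<Delta>\<close>. They are solutions on the infinite star,
  cut off at a fixed distance from \<open>v\<close>. All the errors, from the cutoff, from \<open>t > \<tau>\<close> and from
  the fact that \<open>f\<close> has to return to zero, are exponentially smaller than the main terms, which
  are \<open>dwave_pairing\<close> and \<open>wave_pairing\<close>. The limit is \<open>2 - 2/d \<le> C * (2/d)\<close> (\<open>degree_bound\<close>).

  Three general facts are needed. The semigroup is bounded uniformly in \<open>0 \<le> t \<le> \<tau>\<close>
  (\<open>P_bounded_on\<close>); this is the uniform boundedness principle, by a gliding hump and the
  completeness of \<open>L\<^sup>2\<close>. Weak derivatives admit integration by parts up to the boundary
  (\<open>weak_derivative_by_parts\<close>), which yields their uniqueness for \<open>C\<^sup>1\<close> functions as well. Hence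
  \<open>C\<^sup>2\<close> functions near \<open>v\<close> that are continuous and satisfy the Kirchhoff condition belong to the
  domain of the Laplacian (\<open>star_laplacian\<close>).
\<close>

section \<open>Square-integrable functions\<close>

lemma L2_D:
  assumes "f \<in> L2 M"
  shows "f \<in> borel_measurable M" "integrable M (\<lambda>x. (f x)\<^sup>2)"
  using assms by (auto simp: L2_def)

lemma L2_integrable_mult:
  assumes "f \<in> L2 M" "g \<in> L2 M"
  shows "integrable M (\<lambda>x. f x * g x)"
proof (rule Bochner_Integration.integrable_bound)
  show "integrable M (\<lambda>x. (f x)\<^sup>2 + (g x)\<^sup>2)"
    using assms by (auto simp: L2_def)
  show "(\<lambda>x. f x * g x) \<in> borel_measurable M"
    using assms by (auto simp: L2_def)
  have "\<bar>f x * g x\<bar> \<le> (f x)\<^sup>2 + (g x)\<^sup>2" for x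
  proof -
    have "2 * (\<bar>f x\<bar> * \<bar>g x\<bar>) \<le> (f x)\<^sup>2 + (g x)\<^sup>2"
      using sum_squares_bound[of "\<bar>f x\<bar>" "\<bar>g x\<bar>"] by simp
    moreover have "0 \<le> \<bar>f x\<bar> * \<bar>g x\<bar>" by simp
    ultimately show ?thesis unfolding abs_mult by linarith
  qed
  then show "AE x in M. norm (f x * g x) \<le> norm ((f x)\<^sup>2 + (g x)\<^sup>2)"
    by (intro AE_I2) (simp add: abs_of_nonneg)
qed

lemma L2_lincomb:
  assumes "f \<in> L2 M" "g \<in> L2 M"
  shows "(\<lambda>x. a * f x + b * g x) \<in> L2 M"
proof -
  have "integrable M (\<lambda>x. a\<^sup>2 * (f x)\<^sup>2 + 2 * a * b * (f x * g x) + b\<^sup>2 * (g x)\<^sup>2)"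
    using assms L2_integrable_mult[OF assms] by (auto simp: L2_def)
  also have "(\<lambda>x. a\<^sup>2 * (f x)\<^sup>2 + 2 * a * b * (f x * g x) + b\<^sup>2 * (g x)\<^sup>2) =
      (\<lambda>x. (a * f x + b * g x)\<^sup>2)"
    by (auto simp: power2_eq_square algebra_simps)
  finally show ?thesis using assms by (auto simp: L2_def)
qed

lemma L2_add: "f \<in> L2 M \<Longrightarrow> g \<in> L2 M \<Longrightarrow> (\<lambda>x. f x + g x) \<in> L2 M"
  using L2_lincomb[of f M g 1 1] by simp

lemma L2_diff: "f \<in> L2 M \<Longrightarrow> g \<in> L2 M \<Longrightarrow> (\<lambda>x. f x - g x) \<in> L2 M"
  using L2_lincomb[of f M g 1 "-1"] by simp

lemma L2_scale: "f \<in> L2 M \<Longrightarrow> (\<lambda>x. c * f x) \<in> L2 M"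
  using L2_lincomb[of f M f c 0] by simp

lemma L2_norm_nonneg [simp]: "0 \<le> L2_norm M f"
  by (simp add: L2_norm_def)

lemma L2_norm_square: "(L2_norm M f)\<^sup>2 = (\<integral>x. (f x)\<^sup>2 \<partial>M)"
  by (simp add: L2_norm_def)

lemma L2_norm_cong_AE:
  assumes "f \<in> borel_measurable M" "g \<in> borel_measurable M" "AE x in M. f x = g x"
  shows "L2_norm M f = L2_norm M g"
  unfolding L2_norm_def using assms by (intro arg_cong[of _ _ sqrt] integral_cong_AE) auto

lemma L2_norm_scale: "L2_norm M (\<lambda>x. c * f x) = \<bar>c\<bar> * L2_norm M f"
  by (simp add: L2_norm_def power_mult_distrib real_sqrt_mult)

lemma L2_norm_minus_commute: "L2_norm M (\<lambda>x. f x - g x) = L2_norm M (\<lambda>x. g x - f x)"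
  by (simp add: L2_norm_def power2_commute)

lemma L2_Cauchy_Schwarz:
  assumes "f \<in> L2 M" "g \<in> L2 M"
  shows "\<bar>\<integral>x. f x * g x \<partial>M\<bar> \<le> L2_norm M f * L2_norm M g"
proof -
  let ?A = "\<integral>x. (f x)\<^sup>2 \<partial>M" and ?B = "\<integral>x. f x * g x \<partial>M" and ?C = "\<integral>x. (g x)\<^sup>2 \<partial>M"
  note [simp] = L2_D(2)[OF assms(1)] L2_D(2)[OF assms(2)] L2_integrable_mult[OF assms]
  have quad: "0 \<le> s\<^sup>2 * ?A + 2 * s * t * ?B + t\<^sup>2 * ?C" for s t
  proof -
    have "0 \<le> (\<integral>x. (s * f x + t * g x)\<^sup>2 \<partial>M)" by simp
    also have "(\<lambda>x. (s * f x + t * g x)\<^sup>2) =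
        (\<lambda>x. s\<^sup>2 * (f x)\<^sup>2 + 2 * s * t * (f x * g x) + t\<^sup>2 * (g x)\<^sup>2)"
      by (auto simp: power2_eq_square algebra_simps)
    finally show ?thesis by simp
  qed
  have A: "0 \<le> ?A" and C: "0 \<le> ?C" by simp_all
  have "?B\<^sup>2 \<le> ?A * ?C"
  proof (cases "?A = 0")
    case True
    have "?B = 0"
    proof (rule ccontr)
      assume B: "?B \<noteq> 0"
      have "0 \<le> 2 * (- (?C + 1) / (2 * ?B)) * ?B + ?C"
        using quad[of "- (?C + 1) / (2 * ?B)" 1] True by simp
      then show False using B by (simp add: field_simps)
    qed
    then show ?thesis using True by simp
  next
    case False
    have "0 \<le> ?B\<^sup>2 * ?A + 2 * (- ?B) * ?A * ?B + ?A\<^sup>2 * ?C"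
      using quad[of "- ?B" ?A] by simp
    then have "0 \<le> ?A * (?A * ?C - ?B\<^sup>2)"
      by (simp add: power2_eq_square algebra_simps)
    then show ?thesis using A False by (simp add: zero_le_mult_iff)
  qed
  then have "sqrt (?B\<^sup>2) \<le> sqrt (?A * ?C)" by (rule real_sqrt_le_mono)
  then show ?thesis by (simp add: L2_norm_def real_sqrt_mult)
qed

lemma L2_norm_triangle:
  assumes "f \<in> L2 M" "g \<in> L2 M"
  shows "L2_norm M (\<lambda>x. f x + g x) \<le> L2_norm M f + L2_norm M g"
proof (rule power2_le_imp_le)
  note [simp] = L2_D(2)[OF assms(1)] L2_D(2)[OF assms(2)] L2_integrable_mult[OF assms]
  have "(L2_norm M (\<lambda>x. f x + g x))\<^sup>2 = (\<integral>x. (f x)\<^sup>2 + 2 * (f x * g x) + (g x)\<^sup>2 \<partial>M)"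
    unfolding L2_norm_square
        by (intro Bochner_Integration.integral_cong) (auto simp: power2_eq_square algebra_simps)
  also have "\<dots> = (L2_norm M f)\<^sup>2 + 2 * (\<integral>x. f x * g x \<partial>M) + (L2_norm M g)\<^sup>2"
    by (simp add: L2_norm_square)
  also have "\<dots> \<le> (L2_norm M f + L2_norm M g)\<^sup>2"
    using L2_Cauchy_Schwarz[OF assms] by (simp add: power2_eq_square algebra_simps)
  finally show "(L2_norm M (\<lambda>x. f x + g x))\<^sup>2 \<le> (L2_norm M f + L2_norm M g)\<^sup>2" .
qed simp

lemma L2_norm_triangle_diff:
  assumes "f \<in> L2 M" "g \<in> L2 M" "h \<in> L2 M"
  shows "L2_norm M (\<lambda>x. f x - h x) \<le> L2_norm M (\<lambda>x. f x - g x) + L2_norm M (\<lambda>x. g x - h x)"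
  using L2_norm_triangle[OF L2_diff[OF assms(1,2)] L2_diff[OF assms(2,3)]] by simp

text \<open>The space \<open>L\<^sup>2\<close> is complete, in the form needed for a gliding hump argument: a sequence
  whose increments decay like \<open>3\<^sup>-\<^sup>n\<close> has a limit, with the geometric bound on the remainder.
  The increments are summed almost everywhere by means of
  \<open>2 \<bar>d\<^sub>n\<bar> \<le> 2\<^sup>-\<^sup>n + 2\<^sup>n d\<^sub>n\<^sup>2\<close>.\<close>

lemma L2_complete_geometric:
  fixes X :: "nat \<Rightarrow> 'a \<Rightarrow> real"
  assumes X: "\<And>n. X n \<in> L2 M"
    and inc: "\<And>n. L2_norm M (\<lambda>x. X (Suc n) x - X n x) \<le> (1/3) ^ n"
  obtains Y where "Y \<in> L2 M" "\<And>n. L2_norm M (\<lambda>x. Y x - X n x) \<le> 3/2 * (1/3) ^ n"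
proof -
  note [measurable] = L2_D(1)[OF X]
  define d where "d n x = X (Suc n) x - X n x" for n x
  have dL2: "d n \<in> L2 M" for n
    unfolding d_def using L2_diff[OF X X] .
  note [measurable] = L2_D(1)[OF dL2]
  have dint: "(\<integral>\<^sup>+x. ennreal (2 ^ n * (d n x)\<^sup>2) \<partial>M) \<le> ennreal ((2/9) ^ n)" for n
  proof -
    have "(\<integral>\<^sup>+x. ennreal (2 ^ n * (d n x)\<^sup>2) \<partial>M) = ennreal (\<integral>x. 2 ^ n * (d n x)\<^sup>2 \<partial>M)"
      using L2_D(2)[OF dL2] by (intro nn_integral_eq_integral) auto
    also have "(\<integral>x. 2 ^ n * (d n x)\<^sup>2 \<partial>M) = 2 ^ n * (L2_norm M (d n))\<^sup>2"
      by (simp add: L2_norm_square)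
    also have "\<dots> \<le> 2 ^ n * ((1/3) ^ n)\<^sup>2"
      using inc[of n] by (intro mult_left_mono power_mono) (auto simp: d_def[abs_def])
    also have "\<dots> = (2/9) ^ n"
      by (simp add: power_mult_distrib[symmetric] power2_eq_square)
    finally show ?thesis by (simp add: ennreal_leI)
  qed
  have "(\<integral>\<^sup>+x. (\<Sum>n. ennreal (2 ^ n * (d n x)\<^sup>2)) \<partial>M) = (\<Sum>n. \<integral>\<^sup>+x. ennreal (2 ^ n * (d n x)\<^sup>2) \<partial>M)"
    by (intro nn_integral_suminf) simp
  also have "\<dots> \<le> (\<Sum>n. ennreal ((2/9) ^ n))"
    by (intro suminf_le dint) auto
  also have "\<dots> = ennreal (\<Sum>n. (2/9) ^ n)"
    by (intro suminf_ennreal2) (auto intro: summable_geometric)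
  finally have "(\<integral>\<^sup>+x. (\<Sum>n. ennreal (2 ^ n * (d n x)\<^sup>2)) \<partial>M) \<noteq> \<infinity>"
    by (auto simp: top_unique)
  then have "AE x in M. (\<Sum>n. ennreal (2 ^ n * (d n x)\<^sup>2)) \<noteq> \<infinity>"
    by (intro nn_integral_PInf_AE) auto
  then have conv: "AE x in M. convergent (\<lambda>n. X n x)"
  proof (eventually_elim)
    case (elim x)
    then have s1: "summable (\<lambda>n. 2 ^ n * (d n x)\<^sup>2)"
      by (intro summable_suminf_not_top) auto
    have "summable (\<lambda>n. (1/2) ^ n + 2 ^ n * (d n x)\<^sup>2)"
      by (intro summable_add s1 summable_geometric) auto
    then have "summable (\<lambda>n. d n x)"
    proof (rule summable_comparison_test')
      fix n :: nat
      have "0 \<le> (1/2) ^ n * (2 ^ n * \<bar>d n x\<bar> - 1)\<^sup>2" by simp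
      also have "\<dots> = (2 ^ n * (1/2) ^ n) * (2 ^ n * \<bar>d n x\<bar>\<^sup>2 - 2 * \<bar>d n x\<bar>) + (1/2) ^ n"
        by (simp add: power2_eq_square algebra_simps)
      also have "2 ^ n * (1/2::real) ^ n = 1" by (simp add: power_mult_distrib[symmetric])
      finally have "2 * \<bar>d n x\<bar> \<le> (1/2) ^ n + 2 ^ n * (d n x)\<^sup>2" by simp
      then show "norm (d n x) \<le> (1/2) ^ n + 2 ^ n * (d n x)\<^sup>2" by simp
    qed
    then have "convergent (\<lambda>n. \<Sum>i<n. d i x)" by (simp add: summable_iff_convergent)
    then have "convergent (\<lambda>n. X 0 x + (\<Sum>i<n. d i x))" by (rule convergent_add_const_iff[THEN iffD2])
    moreover have "X 0 x + (\<Sum>i<n. d i x) = X n x" for n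
      unfolding d_def by (subst sum_lessThan_telescope) simp
    ultimately show ?case by simp
  qed
  define Y where "Y x = lim (\<lambda>n. X n x)" for x
  have Ym [measurable]: "Y \<in> borel_measurable M"
    unfolding Y_def by (intro borel_measurable_lim_metric) simp
  have lim: "AE x in M. (\<lambda>n. X n x) \<longlonglongrightarrow> Y x"
    using conv by eventually_elim (simp add: Y_def convergent_LIMSEQ_iff)
  have near: "L2_norm M (\<lambda>x. X (n + m) x - X n x) \<le> 3/2 * (1/3) ^ n" for n m
  proof -
    have "L2_norm M (\<lambda>x. X (n + m) x - X n x) \<le> (\<Sum>i<m. (1/3) ^ (n + i))"
    proof (induction m)
      case 0
      then show ?case by (simp add: L2_norm_def)
    next
      case (Suc m)
      show ?case
        using L2_norm_triangle_diff[OF X[of "n + Suc m"] X[of "n + m"] X[of n]] Suc inc[of "n + m"]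
        by simp
    qed
    also have "\<dots> = (1/3) ^ n * (\<Sum>i<m. (1/3) ^ i)" by (simp add: power_add sum_distrib_left)
    also have "\<dots> \<le> (1/3) ^ n * (3/2)"
    proof (intro mult_left_mono)
      show "(\<Sum>i<m. (1/3) ^ i) \<le> (3/2::real)"
        by (subst sum_gp_strict) (auto simp: field_simps)
    qed simp
    finally show ?thesis by simp
  qed
  have fatou: "(\<integral>\<^sup>+x. ennreal ((Y x - X n x)\<^sup>2) \<partial>M) \<le> ennreal ((3/2 * (1/3) ^ n)\<^sup>2)" for n
  proof -
    have "(\<integral>\<^sup>+x. ennreal ((Y x - X n x)\<^sup>2) \<partial>M) =
        (\<integral>\<^sup>+x. liminf (\<lambda>m. ennreal ((X (n + m) x - X n x)\<^sup>2)) \<partial>M)"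
    proof (intro nn_integral_cong_AE)
      show "AE x in M. ennreal ((Y x - X n x)\<^sup>2) = liminf (\<lambda>m. ennreal ((X (n + m) x - X n x)\<^sup>2))"
        using lim
      proof eventually_elim
        case (elim x)
        then have "(\<lambda>m. X (m + n) x) \<longlonglongrightarrow> Y x" by (rule LIMSEQ_ignore_initial_segment)
        then have "(\<lambda>m. ennreal ((X (n + m) x - X n x)\<^sup>2)) \<longlonglongrightarrow> ennreal ((Y x - X n x)\<^sup>2)"
          by (intro tendsto_ennrealI tendsto_intros) (simp add: add.commute)
        then show ?case by (rule lim_imp_Liminf[OF sequentially_bot, symmetric])
      qed
    qed
    also have "\<dots> \<le> liminf (\<lambda>m. \<integral>\<^sup>+x. ennreal ((X (n + m) x - X n x)\<^sup>2) \<partial>M)"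
      by (intro nn_integral_liminf) simp
    also have "\<dots> \<le> liminf (\<lambda>m::nat. ennreal ((3/2 * (1/3) ^ n)\<^sup>2))"
    proof (intro Liminf_mono always_eventually allI)
      fix m
      have "(\<integral>\<^sup>+x. ennreal ((X (n + m) x - X n x)\<^sup>2) \<partial>M) = ennreal ((L2_norm M (\<lambda>x. X (n +
          m) x - X n x))\<^sup>2)"
        unfolding L2_norm_square using L2_D(2)[OF L2_diff[OF X X]]
        by (intro nn_integral_eq_integral) auto
      also have "\<dots> \<le> ennreal ((3/2 * (1/3) ^ n)\<^sup>2)"
        by (intro ennreal_leI power_mono near) simp
      finally show "(\<integral>\<^sup>+x. ennreal ((X (n + m) x - X n x)\<^sup>2) \<partial>M) \<le> ennreal ((3/2 * (1/3) ^ n)\<^sup>2)" .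
    qed
    also have "\<dots> = ennreal ((3/2 * (1/3) ^ n)\<^sup>2)"
      by (rule lim_imp_Liminf[OF sequentially_bot tendsto_const])
    finally show ?thesis .
  qed
  have diffL2: "(\<lambda>x. Y x - X n x) \<in> L2 M" for n
    unfolding L2_def using fatou[of n]
    by (auto intro!: integrableI_bounded intro: le_less_trans)
  show ?thesis
  proof (rule that)
    show "Y \<in> L2 M" using L2_add[OF diffL2 X, of 0 0] by simp
    fix n
    have "ennreal ((L2_norm M (\<lambda>x. Y x - X n x))\<^sup>2) = (\<integral>\<^sup>+x. ennreal ((Y x - X n x)\<^sup>2) \<partial>M)"
      unfolding L2_norm_square using nn_integral_eq_integral[OF L2_D(2)[OF diffL2]] by simp
    then have "ennreal ((L2_norm M (\<lambda>x. Y x - X n x))\<^sup>2) \<le> ennreal ((3/2 * (1/3) ^ n)\<^sup>2)"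
      using fatou[of n] by (simp only:)
    then have "(L2_norm M (\<lambda>x. Y x - X n x))\<^sup>2 \<le> (3/2 * (1/3) ^ n)\<^sup>2"
      by (subst (asm) ennreal_le_iff) simp_all
    then show "L2_norm M (\<lambda>x. Y x - X n x) \<le> 3/2 * (1/3) ^ n"
      by (rule power2_le_imp_le) simp
  qed
qed

section \<open>Strongly continuous semigroups: local boundedness\<close>

text \<open>In the following locale, the boundedness of each \<open>P t\<close> holds with a constant that may depend on
  \<open>t\<close>; local uniformity is derived below.\<close>

locale L2_semigroup =
  fixes M :: "'a measure" and P :: "real \<Rightarrow> ('a \<Rightarrow> real) \<Rightarrow> 'a \<Rightarrow> real"
  assumes C0: "C0_semigroup M P"
begin

lemma P_L2: "0 \<le> t \<Longrightarrow> f \<in> L2 M \<Longrightarrow> P t f \<in> L2 M"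
  using C0 by (auto simp: C0_semigroup_def)

lemma P_lincomb:
  "0 \<le> t \<Longrightarrow> f \<in> L2 M \<Longrightarrow> g \<in> L2 M \<Longrightarrow>
    AE x in M. P t (\<lambda>y. a * f y + b * g y) x = a * P t f x + b * P t g x"
  using C0 by (auto simp: C0_semigroup_def)

lemma P_bounded: "0 \<le> t \<Longrightarrow> \<exists>B. \<forall>f\<in>L2 M. L2_norm M (P t f) \<le> B * L2_norm M f"
  using C0 by (auto simp: C0_semigroup_def)

lemma P_zero: "f \<in> L2 M \<Longrightarrow> AE x in M. P 0 f x = f x"
  using C0 by (auto simp: C0_semigroup_def)

lemma P_add: "0 \<le> s \<Longrightarrow> 0 \<le> t \<Longrightarrow> f \<in> L2 M \<Longrightarrow> AE x in M. P (s + t) f x = P s (P t f) x"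
  using C0 by (auto simp: C0_semigroup_def)

lemma P_strong: "f \<in> L2 M \<Longrightarrow> ((\<lambda>t. L2_norm M (\<lambda>x. P t f x - f x)) \<longlongrightarrow> 0) (at_right 0)"
  using C0 by (auto simp: C0_semigroup_def)

lemma P_meas: "0 \<le> t \<Longrightarrow> f \<in> L2 M \<Longrightarrow> P t f \<in> borel_measurable M"
  using P_L2 L2_D(1) by blast

lemma P_diff:
  assumes "0 \<le> t" "f \<in> L2 M" "g \<in> L2 M"
  shows "AE x in M. P t (\<lambda>y. f y - g y) x = P t f x - P t g x"
  using P_lincomb[OF assms, of 1 "-1"] by simp

lemma P_sum:
  assumes "0 \<le> t" "f \<in> L2 M" "g \<in> L2 M"
  shows "AE x in M. P t (\<lambda>y. f y + g y) x = P t f x + P t g x"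
  using P_lincomb[OF assms, of 1 "1"] by simp

lemma P_scale:
  assumes "0 \<le> t" "f \<in> L2 M"
  shows "AE x in M. P t (\<lambda>y. c * f y) x = c * P t f x"
  using P_lincomb[OF assms assms(2), of c 0] by simp

lemma P_norm_diff:
  assumes "0 \<le> t" "f \<in> L2 M" "g \<in> L2 M"
  shows "L2_norm M (\<lambda>x. P t f x - P t g x) = L2_norm M (P t (\<lambda>y. f y - g y))"
proof (rule L2_norm_cong_AE[symmetric])
  show "AE x in M. P t (\<lambda>y. f y - g y) x = P t f x - P t g x" by (rule P_diff[OF assms])
qed (use assms in \<open>auto intro!: L2_D(1) L2_diff P_L2\<close>)

lemma P_cong_AE:
  assumes t: "0 \<le> t" and f: "f \<in> L2 M" and g: "g \<in> L2 M" and eq: "AE x in M. f x = g x"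
  shows "AE x in M. P t f x = P t g x"
proof -
  obtain B where B: "\<forall>f\<in>L2 M. L2_norm M (P t f) \<le> B * L2_norm M f" using P_bounded[OF t] by blast
  have "L2_norm M (\<lambda>x. f x - g x) = L2_norm M (\<lambda>x. 0)"
    using eq f g by (intro L2_norm_cong_AE) (auto intro: L2_D(1) L2_diff)
  then have "L2_norm M (\<lambda>x. f x - g x) = 0" by (simp add: L2_norm_def)
  then have "L2_norm M (\<lambda>x. P t f x - P t g x) \<le> 0"
    using B L2_diff[OF f g] P_norm_diff[OF t f g] by force
  then have "(L2_norm M (\<lambda>x. P t f x - P t g x))\<^sup>2 = 0"
    by (metis L2_norm_nonneg antisym_conv zero_power2)
  then have "(\<integral>x. (P t f x - P t g x)\<^sup>2 \<partial>M) = 0" by (simp add: L2_norm_square)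
  then have "AE x in M. (P t f x - P t g x)\<^sup>2 = 0"
    by (subst (asm) integral_nonneg_eq_0_iff_AE)
      (auto intro!: L2_D(2) L2_diff P_L2 t f g)
  then show ?thesis by simp
qed

text \<open>The operator norm of \<open>P t\<close>, together with functions that almost attain it.\<close>

lemma P_operator_norm:
  assumes t: "0 \<le> t"
  obtains N where "0 \<le> N" "\<And>f. f \<in> L2 M \<Longrightarrow> L2_norm M (P t f) \<le> N * L2_norm M f"
    "\<And>r. 0 < r \<Longrightarrow> 0 < N \<Longrightarrow> \<exists>f\<in>L2 M. L2_norm M f = r \<and> 3/4 * N * r \<le> L2_norm M (P t f)"
proof -
  obtain B where B: "\<And>f. f\<in>L2 M \<Longrightarrow> L2_norm M (P t f) \<le> B * L2_norm M f"
    using P_bounded[OF t] by blast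
  define S where "S = {L2_norm M (P t f) / L2_norm M f | f. f \<in> L2 M \<and> 0 < L2_norm M f}"
  define N where "N = Sup (insert 0 S)"
  have bdd: "bdd_above (insert 0 S)"
  proof (rule bdd_aboveI)
    fix x assume "x \<in> insert 0 S"
    then consider "x = 0" | f where "f \<in> L2 M" "0 < L2_norm M f" "x = L2_norm M (P t f) / L2_norm M f"
      by (auto simp: S_def)
    then show "x \<le> max 0 B"
    proof cases
      case 2
      then have "x \<le> B" using B[OF 2(1)] by (simp add: divide_le_eq)
      then show ?thesis by simp
    qed simp
  qed
  have N0: "0 \<le> N" unfolding N_def by (rule cSup_upper[OF _ bdd]) simp
  have le: "L2_norm M (P t f) \<le> N * L2_norm M f" if f: "f \<in> L2 M" for f
  proof (cases "L2_norm M f = 0")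
    case True
    then show ?thesis using B[OF f] by simp
  next
    case False
    then have pos: "0 < L2_norm M f" by (simp add: less_le)
    then have "L2_norm M (P t f) / L2_norm M f \<le> N"
      unfolding N_def using f by (intro cSup_upper[OF _ bdd]) (auto simp: S_def)
    then show ?thesis using pos by (simp add: divide_le_eq)
  qed
  have ex: "\<exists>f\<in>L2 M. L2_norm M f = r \<and> 3/4 * N * r \<le> L2_norm M (P t f)"
    if r: "0 < r" and N: "0 < N" for r
  proof -
    have "3/4 * N < Sup (insert 0 S)" using N by (simp add: N_def[symmetric])
    then obtain y where y: "y \<in> insert 0 S" "3/4 * N < y"
      using less_cSup_iff[OF _ bdd] by blast
    then obtain f where f: "f \<in> L2 M" "0 < L2_norm M f" "3/4 * N < L2_norm M (P t f) / L2_norm M f"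
      using N by (auto simp: S_def)
    define c where "c = r / L2_norm M f"
    have c: "0 < c" "c * L2_norm M f = r" using r f(2) by (auto simp: c_def)
    have "L2_norm M (P t (\<lambda>y. c * f y)) = L2_norm M (\<lambda>x. c * P t f x)"
      using P_scale[OF t f(1), of c]
          by (intro L2_norm_cong_AE) (auto intro!: P_meas t L2_scale f L2_D(1) P_L2)
    then have "L2_norm M (P t (\<lambda>y. c * f y)) = c * L2_norm M (P t f)" using c
        by (simp add: L2_norm_scale)
    moreover have "3/4 * N * L2_norm M f \<le> L2_norm M (P t f)"
      using f by (simp add: less_divide_eq)
    then have "c * (3/4 * N * L2_norm M f) \<le> c * L2_norm M (P t f)" using c by simp
    moreover have "c * (3/4 * N * L2_norm M f) = 3/4 * N * r" using c(2) by (simp add: mult_ac)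
    ultimately show ?thesis
      using c by (intro bexI[of _ "\<lambda>y. c * f y"]) (auto intro: L2_scale f simp: L2_norm_scale)
  qed
  show ?thesis using that[OF N0 le ex] .
qed

text \<open>Uniform boundedness near \<open>t = 0\<close>, by a gliding hump: if the norms of \<open>P (T n)\<close> with
  \<open>T n \<rightarrow> 0\<close> exceeded \<open>4\<^sup>n\<close>, a function assembled from almost maximizing functions of size
  \<open>3\<^sup>-\<^sup>n\<close> would have \<open>L2_norm M (P (T n) Y)\<close> of order \<open>(4/3)\<^sup>n\<close>, against strong continuity.\<close>

lemma P_bounded_near_zero:
  obtains \<delta> B where "0 < \<delta>" "1 \<le> B"
    "\<And>t f. 0 \<le> t \<Longrightarrow> t \<le> \<delta> \<Longrightarrow> f \<in> L2 M \<Longrightarrow> L2_norm M (P t f) \<le> B * L2_norm M f"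
proof -
  have "\<exists>\<delta>>0. \<exists>B\<ge>1. \<forall>t. 0 < t \<longrightarrow> t \<le> \<delta> \<longrightarrow> (\<forall>f\<in>L2 M. L2_norm M (P t f) \<le> B * L2_norm M f)"
  proof (rule ccontr)
    assume neg0: "\<not> ?thesis"
    have neg: "\<exists>t. 0 < t \<and> t \<le> \<delta> \<and> (\<exists>f\<in>L2 M. B * L2_norm M f < L2_norm M (P t f))"
      if "0 < \<delta>" "1 \<le> B" for \<delta> B
      using neg0 that by (meson not_le)
    have "\<forall>n. \<exists>t. 0 < t \<and> t \<le> 1 / real (Suc n) \<and> (\<exists>f\<in>L2 M. 4 ^ n * L2_norm M f < L2_norm M (P t f))"
      by (intro allI neg) auto
    from choice[OF this] obtain T where T: "\<And>n. 0 < T n" "\<And>n. T n \<le> 1 / real (Suc n)"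
      "\<And>n. \<exists>f\<in>L2 M. 4 ^ n * L2_norm M f < L2_norm M (P (T n) f)" by blast
    have "\<forall>n. \<exists>N g. 4 ^ n \<le> N \<and> (\<forall>f\<in>L2 M. L2_norm M (P (T n) f) \<le> N * L2_norm M f) \<and>
        g \<in> L2 M \<and> L2_norm M g = (1/3) ^ n \<and> 3/4 * N * (1/3) ^ n \<le> L2_norm M (P (T n) g)"
    proof
      fix n
      obtain N where N: "0 \<le> N" "\<And>f. f \<in> L2 M \<Longrightarrow> L2_norm M (P (T n) f) \<le> N * L2_norm M f"
        "\<And>r. 0 < r \<Longrightarrow> 0 < N \<Longrightarrow> \<exists>f\<in>L2 M. L2_norm M f = r \<and> 3/4 * N * r \<le> L2_norm M (P (T n) f)"
        using P_operator_norm[OF less_imp_le[OF T(1)[of n]]] by blast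
      obtain f where f: "f \<in> L2 M" "4 ^ n * L2_norm M f < L2_norm M (P (T n) f)" using T(3) by blast
      have "4 ^ n * L2_norm M f < N * L2_norm M f" using f N(2)[OF f(1)] by linarith
      then have N4: "4 ^ n \<le> N"
        using L2_norm_nonneg[of M f] by (simp add: mult_less_cancel_right)
      moreover have "0 < N" using N4 by (meson less_le_trans zero_less_numeral zero_less_power)
      ultimately show "\<exists>N g. 4 ^ n \<le> N \<and> (\<forall>f\<in>L2 M. L2_norm M (P (T n) f) \<le> N * L2_norm M f) \<and>
        g \<in> L2 M \<and> L2_norm M g = (1/3) ^ n \<and> 3/4 * N * (1/3) ^ n \<le> L2_norm M (P (T n) g)"
        using N(2) N(3)[of "(1/3) ^ n"] by auto
    qed
    from choice[OF this] obtain N where "\<forall>n. \<exists>g. 4 ^ n \<le> N n \<and> (\<forall>f\<in>L2 M. L2_norm M (P (T n) f) \<le>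
        N n * L2_norm M f) \<and>
        g \<in> L2 M \<and> L2_norm M g = (1/3) ^ n \<and> 3/4 * N n * (1/3) ^ n \<le> L2_norm M (P (T n) g)" ..
    from choice[OF this] obtain g where N: "\<And>n. 4 ^ n \<le> N n"
      "\<And>n f. f \<in> L2 M \<Longrightarrow> L2_norm M (P (T n) f) \<le> N n * L2_norm M f"
      and g: "\<And>n. g n \<in> L2 M" "\<And>n. L2_norm M (g n) = (1/3) ^ n"
        "\<And>n. 3/4 * N n * (1/3) ^ n \<le> L2_norm M (P (T n) (g n))"
      by blast
    define step where "step n x =
      (if L2_norm M (P (T n) (g n)) \<le> L2_norm M (P (T n) (\<lambda>y. x y + g n y))
       then (\<lambda>y. x y + g n y) else (\<lambda>y. x y - g n y))" for n x
    define X where "X = rec_nat (\<lambda>_. 0) step"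
    have X_Suc: "X (Suc n) = step n (X n)" and X_0: "X 0 = (\<lambda>_. 0)" for n
      by (auto simp: X_def)
    have X: "X n \<in> L2 M" for n
    proof (induction n)
      case 0
      then show ?case by (simp add: X_0 L2_def)
    next
      case (Suc n)
      then show ?case using g(1) by (auto simp: X_Suc step_def intro: L2_add L2_diff)
    qed
    have inc: "L2_norm M (\<lambda>x. X (Suc n) x - X n x) \<le> (1/3) ^ n" for n
      using g(2)[of n] L2_norm_scale[of M "-1" "g n"] by (auto simp: X_Suc step_def)
    \<comment> \<open>One of the two signs does not decrease the image, since \<open>2 g = (x + g) - (x - g)\<close>.\<close>
    have big: "L2_norm M (P (T n) (g n)) \<le> L2_norm M (P (T n) (X (Suc n)))" for n
    proof (cases "L2_norm M (P (T n) (g n)) \<le> L2_norm M (P (T n) (\<lambda>y. X n y + g n y))")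
      case True
      then show ?thesis by (simp add: X_Suc step_def)
    next
      case False
      have t: "0 \<le> T n" using T(1)[of n] by simp
      let ?a = "P (T n) (\<lambda>y. X n y + g n y)" and ?b = "P (T n) (\<lambda>y. X n y - g n y)"
      have ab: "?a \<in> L2 M" "?b \<in> L2 M" by (auto intro!: P_L2 L2_add L2_diff X g t)
      have "2 * L2_norm M (P (T n) (g n)) = L2_norm M (\<lambda>x. 2 * P (T n) (g n) x)"
        by (simp add: L2_norm_scale)
      also have "\<dots> = L2_norm M (\<lambda>x. ?a x - ?b x)"
        using P_sum[OF t X[of n] g(1)[of n]] P_diff[OF t X[of n] g(1)[of n]] ab
        by (intro L2_norm_cong_AE) (auto intro!: L2_D(1) L2_diff L2_scale P_L2 t g simp: fun_eq_iff)
      also have "\<dots> \<le> L2_norm M ?a + L2_norm M ?b"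
        using L2_norm_triangle[OF ab(1) L2_scale[OF ab(2), of "-1"]] L2_norm_scale[of M "-1" ?b] by simp
      finally show ?thesis using False by (simp add: X_Suc step_def)
    qed
    obtain Y where Y: "Y \<in> L2 M" "\<And>n. L2_norm M (\<lambda>x. Y x - X n x) \<le> 3/2 * (1/3) ^ n"
      using L2_complete_geometric[of X M, OF X inc] by blast
    have grow: "1/4 * (4/3) ^ n \<le> L2_norm M (P (T n) Y)" for n
    proof -
      have t: "0 \<le> T n" using T(1)[of n] by simp
      have N0: "0 \<le> N n" using N(1)[of n] by (meson order_trans zero_le_numeral zero_le_power)
      have "L2_norm M (\<lambda>x. P (T n) (X (Suc n)) x - P (T n) Y x) =
          L2_norm M (P (T n) (\<lambda>y. X (Suc n) y - Y y))"
        by (rule P_norm_diff[OF t X Y(1)])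
      also have "\<dots> \<le> N n * L2_norm M (\<lambda>y. X (Suc n) y - Y y)" by (intro N L2_diff X Y)
      also have "\<dots> \<le> N n * (3/2 * (1/3) ^ Suc n)"
        using Y(2)[of "Suc n"] N0 by (intro mult_left_mono) (simp_all add: L2_norm_minus_commute)
      finally have "L2_norm M (\<lambda>x. P (T n) (X (Suc n)) x - P (T n) Y x) \<le> 1/2 * N n * (1/3) ^ n" by simp
      moreover have "L2_norm M (P (T n) (X (Suc n))) \<le>
          L2_norm M (\<lambda>x. P (T n) (X (Suc n)) x - P (T n) Y x) + L2_norm M (P (T n) Y)"
        using L2_norm_triangle[OF L2_diff[OF P_L2[OF t X[of "Suc n"]] P_L2[OF t Y(1)]] P_L2[OF t
            Y(1)]] by simp
      ultimately have "1/4 * N n * (1/3) ^ n \<le> L2_norm M (P (T n) Y)" using g(3)[of n] big[of n]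
          by linarith
      moreover have "(4/3::real) ^ n = 4 ^ n * (1/3) ^ n" by (simp add: power_mult_distrib[symmetric])
      moreover have "4 ^ n * (1/3) ^ n \<le> N n * (1/3) ^ n" using N(1) by (intro mult_right_mono) auto
      ultimately show ?thesis by linarith
    qed
    have T0: "T \<longlonglongrightarrow> 0"
      by (rule tendsto_sandwich[OF _ _ tendsto_const LIMSEQ_inverse_real_of_nat])
        (auto intro!: always_eventually less_imp_le[OF T(1)] simp: T(2)[simplified divide_inverse,
            simplified])
    have "filterlim T (at_right 0) sequentially"
      using T0 T(1) by (auto simp: filterlim_at less_le[of 0] intro!: always_eventually)
    from filterlim_compose[OF P_strong[OF Y(1)] this] have "(\<lambda>n. L2_norm M (\<lambda>x. P (T n) Y x - Y x)) \<longlonglongrightarrow> 0"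
      .
    then have "\<forall>\<^sub>F n in sequentially. L2_norm M (\<lambda>x. P (T n) Y x - Y x) < 1"
      by (rule order_tendstoD) simp
    moreover have "filterlim (\<lambda>n. 1/4 * (4/3::real) ^ n) at_top sequentially"
      using filterlim_at_infinity_imp_norm_at_top[OF filterlim_realpow_sequentially_gt1[of "4/3::real"]]
      by (intro filterlim_tendsto_pos_mult_at_top[OF tendsto_const]) auto
    then have "\<forall>\<^sub>F n in sequentially. 1 + L2_norm M Y < 1/4 * (4/3::real) ^ n"
      unfolding filterlim_at_top_dense by blast
    ultimately have "\<forall>\<^sub>F n::nat in sequentially. False"
    proof eventually_elim
      case (elim n)
      have "0 \<le> T n" using T(1)[of n] by simp
      then show ?case
        using L2_norm_triangle[OF L2_diff[OF P_L2[OF \<open>0 \<le> T n\<close> Y(1)] Y(1)] Y(1)] grow[of n] elim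
        unfolding diff_add_cancel by linarith
    qed
    then show False by simp
  qed
  then obtain \<delta> B where *: "0 < \<delta>" "1 \<le> B"
    "\<forall>t. 0 < t \<longrightarrow> t \<le> \<delta> \<longrightarrow> (\<forall>f\<in>L2 M. L2_norm M (P t f) \<le> B * L2_norm M f)" by auto
  have "L2_norm M (P t f) \<le> B * L2_norm M f" if t: "0 \<le> t" "t \<le> \<delta>" and f: "f \<in> L2 M" for t f
  proof (cases "t = 0")
    case True
    have "L2_norm M (P 0 f) = L2_norm M f"
      using P_zero[OF f] by (intro L2_norm_cong_AE) (auto intro!: P_meas L2_D(1)[OF f] f)
    then show ?thesis using True *(2) mult_right_mono[OF *(2), of "L2_norm M f"] by simp
  next
    case False
    then show ?thesis using *(3) t f by simp
  qed
  then show ?thesis by (rule that[OF *(1,2)])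
qed

lemma P_bounded_on:
  obtains K where "1 \<le> K"
    "\<And>t f. 0 \<le> t \<Longrightarrow> t \<le> \<tau> \<Longrightarrow> f \<in> L2 M \<Longrightarrow> L2_norm M (P t f) \<le> K * L2_norm M f"
proof -
  obtain \<delta> B where B: "0 < \<delta>" "1 \<le> B"
    "\<And>t f. 0 \<le> t \<Longrightarrow> t \<le> \<delta> \<Longrightarrow> f \<in> L2 M \<Longrightarrow> L2_norm M (P t f) \<le> B * L2_norm M f"
    using P_bounded_near_zero by blast
  have it: "L2_norm M (P t f) \<le> B ^ Suc n * L2_norm M f"
    if "0 \<le> t" "t \<le> real (Suc n) * \<delta>" "f \<in> L2 M" for t n f
    using that
  proof (induction n arbitrary: t)
    case 0
    then show ?case using B(3) by simp
  next
    case (Suc n)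
    define s where "s = min t \<delta>"
    have s: "0 \<le> s" "s \<le> \<delta>" "0 \<le> t - s" "t - s \<le> real (Suc n) * \<delta>"
      using Suc.prems B(1) by (auto simp: s_def min_def algebra_simps)
    have "L2_norm M (P t f) = L2_norm M (P s (P (t - s) f))"
      using P_add[OF s(1,3) Suc.prems(3)] Suc.prems s
      by (intro L2_norm_cong_AE) (auto intro!: P_meas P_L2)
    also have "\<dots> \<le> B * L2_norm M (P (t - s) f)" using s Suc.prems by (intro B P_L2)
    also have "\<dots> \<le> B * (B ^ Suc n * L2_norm M f)"
      using B(2) s Suc by (intro mult_left_mono) auto
    finally show ?case by (simp add: mult_ac)
  qed
  obtain n where "\<tau> / \<delta> < real n" using reals_Archimedean2 by blast
  then have "\<tau> \<le> real (Suc n) * \<delta>" using B(1) by (simp add: divide_less_eq algebra_simps)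
  then show ?thesis using it B(2)
      by (intro that[of "B ^ Suc n"]) (auto simp del: power_Suc intro: one_le_power)
qed

end

section \<open>Truncated Laplace transforms of a semigroup\<close>

lemma continuous_on_from_increments:
  fixes \<phi> \<omega> :: "real \<Rightarrow> real"
  assumes inc: "\<And>s t. 0 \<le> s \<Longrightarrow> s < t \<Longrightarrow> t \<le> \<tau> \<Longrightarrow> \<bar>\<phi> t - \<phi> s\<bar> \<le> \<omega> (t - s)"
    and \<omega>: "(\<omega> \<longlongrightarrow> 0) (at_right 0)"
  shows "continuous_on {0..\<tau>} \<phi>"
  unfolding continuous_on_iff
proof (intro ballI allI impI)
  fix t e :: real assume t: "t \<in> {0..\<tau>}" and e: "0 < e"
  have "\<forall>\<^sub>F h in at_right 0. \<omega> h < e" by (rule order_tendstoD(2)[OF \<omega> e])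
  then obtain d where d: "0 < d" "\<And>h. 0 < h \<Longrightarrow> h < d \<Longrightarrow> \<omega> h < e"
    unfolding eventually_at_right_field by auto
  have "dist (\<phi> s) (\<phi> t) < e" if s: "s \<in> {0..\<tau>}" "dist s t < d" for s
  proof (cases s t rule: linorder_cases)
    case less
    then show ?thesis using inc[of s t] d(2)[of "t - s"] s t by (auto simp: dist_real_def)
  next
    case equal
    then show ?thesis using e by simp
  next
    case greater
    then show ?thesis using inc[of t s] d(2)[of "s - t"] s t by (auto simp: dist_real_def)
  qed
  then show "\<exists>d>0. \<forall>s\<in>{0..\<tau>}. dist s t < d \<longrightarrow> dist (\<phi> s) (\<phi> t) < e" using d(1) by blast
qed

lemma has_derivative_from_forward_increments:
  fixes \<phi> \<phi>' \<omega> :: "real \<Rightarrow> real"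
  assumes cont: "continuous_on {0..\<tau>} \<phi>'"
    and inc: "\<And>s t. 0 \<le> s \<Longrightarrow> s < t \<Longrightarrow> t \<le> \<tau> \<Longrightarrow>
      \<bar>\<phi> t - \<phi> s - (t - s) * \<phi>' s\<bar> \<le> (t - s) * \<omega> (t - s)"
    and \<omega>: "(\<omega> \<longlongrightarrow> 0) (at_right 0)"
    and t: "t \<in> {0..\<tau>}"
  shows "(\<phi> has_real_derivative \<phi>' t) (at t within {0..\<tau>})"
  unfolding has_field_derivative_def has_derivative_within_alt
proof (intro conjI allI impI)
  show "bounded_linear ((*) (\<phi>' t))" by (rule bounded_linear_mult_right)
  fix e :: real assume e: "0 < e"
  have "\<forall>\<^sub>F h in at_right 0. \<omega> h < e / 2" by (rule order_tendstoD(2)[OF \<omega>]) (use e in simp)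
  then obtain d1 where d1: "0 < d1" "\<And>h. 0 < h \<Longrightarrow> h < d1 \<Longrightarrow> \<omega> h < e / 2"
    unfolding eventually_at_right_field by auto
  obtain d2 where d2: "0 < d2" "\<And>s. s \<in> {0..\<tau>} \<Longrightarrow> dist s t < d2 \<Longrightarrow> dist (\<phi>' s) (\<phi>' t) < e / 2"
    using cont t e unfolding continuous_on_iff by (metis half_gt_zero)
  have "norm (\<phi> y - \<phi> t - \<phi>' t * (y - t)) \<le> e * norm (y - t)"
    if y: "y \<in> {0..\<tau>}" "norm (y - t) < min d1 d2" for y
  proof (cases y t rule: linorder_cases)
    case less
    have "\<bar>\<phi> t - \<phi> y - (t - y) * \<phi>' y\<bar> \<le> (t - y) * \<omega> (t - y)" using inc[of y t] less y t by auto
    also have "\<dots> \<le> (t - y) * (e / 2)" using d1(2)[of "t - y"] less y by (intro mult_left_mono) auto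
    finally have 1: "\<bar>\<phi> t - \<phi> y - (t - y) * \<phi>' y\<bar> \<le> (t - y) * (e / 2)" .
    have "\<bar>(t - y) * (\<phi>' y - \<phi>' t)\<bar> = (t - y) * \<bar>\<phi>' y - \<phi>' t\<bar>" using less by (simp add: abs_mult)
    also have "\<dots> \<le> (t - y) * (e / 2)"
      using d2(2)[of y] less y by (intro mult_left_mono) (auto simp: dist_real_def)
    finally have 2: "\<bar>(t - y) * (\<phi>' y - \<phi>' t)\<bar> \<le> (t - y) * (e / 2)" .
    have "\<phi> y - \<phi> t - \<phi>' t * (y - t) = - (\<phi> t - \<phi> y - (t - y) * \<phi>' y) - (t - y) * (\<phi>' y - \<phi>' t)"
      by (simp add: algebra_simps)
    then have "\<bar>\<phi> y - \<phi> t - \<phi>' t * (y - t)\<bar> \<le> (t - y) * (e / 2) + (t - y) * (e / 2)"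
      using 1 2 by linarith
    then show ?thesis using less by (simp add: field_simps)
  next
    case equal
    then show ?thesis by simp
  next
    case greater
    have "\<bar>\<phi> y - \<phi> t - (y - t) * \<phi>' t\<bar> \<le> (y - t) * \<omega> (y - t)" using inc[of t y] greater y t by auto
    also have "\<dots> \<le> (y - t) * e" using d1(2)[of "y - t"] greater y e by (intro mult_left_mono) auto
    finally show ?thesis using greater by (simp add: mult_ac)
  qed
  then show "\<exists>d>0. \<forall>y\<in>{0..\<tau>}. norm (y - t) < d \<longrightarrow>
      norm (\<phi> y - \<phi> t - \<phi>' t * (y - t)) \<le> e * norm (y - t)"
    using d1(1) d2(1) by (intro exI[of _ "min d1 d2"]) auto
qed

context L2_semigroup
begin

text \<open>Bounding increments by \<open>P (t - s) z - z\<close> makes right continuity at \<open>0\<close> uniform in \<open>s\<close>, which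
  gives two-sided continuity and differentiability.\<close>

lemma P_increment_norm:
  assumes s: "0 \<le> s" and t: "s \<le> t" and z: "z \<in> L2 M"
    and K: "\<And>f. f \<in> L2 M \<Longrightarrow> L2_norm M (P s f) \<le> K * L2_norm M f"
  shows "L2_norm M (\<lambda>x. P t z x - P s z x) \<le> K * L2_norm M (\<lambda>x. P (t - s) z x - z x)"
proof -
  have ts: "0 \<le> t - s" "0 \<le> t" using s t by auto
  note m [measurable] = P_meas[OF s P_L2[OF ts(1) z]] P_meas[OF s z] P_meas[OF ts(2) z]
  have "L2_norm M (\<lambda>x. P t z x - P s z x) = L2_norm M (\<lambda>x. P s (P (t - s) z) x - P s z x)"
    using P_add[OF s ts(1) z] by (intro L2_norm_cong_AE) auto
  also have "\<dots> = L2_norm M (P s (\<lambda>x. P (t - s) z x - z x))"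
    by (rule P_norm_diff[OF s P_L2[OF ts(1) z] z])
  also have "\<dots> \<le> K * L2_norm M (\<lambda>x. P (t - s) z x - z x)"
    by (intro K L2_diff P_L2 ts z)
  finally show ?thesis .
qed

lemma pairing_continuous:
  assumes w: "w \<in> L2 M" and z: "z \<in> L2 M"
  shows "continuous_on {0..\<tau>} (\<lambda>t. \<integral>x. w x * P t z x \<partial>M)"
proof -
  obtain K where K: "1 \<le> K"
    "\<And>t f. 0 \<le> t \<Longrightarrow> t \<le> \<tau> \<Longrightarrow> f \<in> L2 M \<Longrightarrow> L2_norm M (P t f) \<le> K * L2_norm M f"
    using P_bounded_on[of \<tau>] by blast
  show ?thesis
  proof (rule continuous_on_from_increments)
    fix s t assume st: "0 \<le> s" "s < t" "t \<le> \<tau>"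
    have L: "P t z \<in> L2 M" "P s z \<in> L2 M" using st z by (auto intro: P_L2)
    have "(\<integral>x. w x * P t z x \<partial>M) - (\<integral>x. w x * P s z x \<partial>M) = (\<integral>x. w x * (P t z x - P s z x) \<partial>M)"
      using L2_integrable_mult[OF w L(1)] L2_integrable_mult[OF w L(2)]
      by (simp add: right_diff_distrib)
    also have "\<bar>\<dots>\<bar> \<le> L2_norm M w * L2_norm M (\<lambda>x. P t z x - P s z x)"
      by (rule L2_Cauchy_Schwarz[OF w L2_diff[OF L]])
    also have "\<dots> \<le> L2_norm M w * (K * L2_norm M (\<lambda>x. P (t - s) z x - z x))"
      using st K by (intro mult_left_mono P_increment_norm z) auto
    finally show "\<bar>(\<integral>x. w x * P t z x \<partial>M) - (\<integral>x. w x * P s z x \<partial>M)\<bar> \<le>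
        (\<lambda>h. L2_norm M w * (K * L2_norm M (\<lambda>x. P h z x - z x))) (t - s)" .
  next
    show "((\<lambda>h. L2_norm M w * (K * L2_norm M (\<lambda>x. P h z x - z x))) \<longlongrightarrow> 0) (at_right 0)"
      by (rule tendsto_eq_intros P_strong[OF z] refl | simp)+
  qed
qed

lemma generator_increment_AE:
  assumes s: "0 \<le> s" and h: "0 < h" and z: "z \<in> L2 M" and w: "w \<in> L2 M"
  shows "AE x in M. (P (s + h) z x - P s z x) / h - P s w x =
    P s (\<lambda>y. (P h z y - z y) / h - w y) x"
proof -
  have h': "0 \<le> h" using h by simp
  have Lh: "P h z \<in> L2 M" by (rule P_L2[OF h' z])
  have "AE x in M. P s (\<lambda>y. (1/h) * (P h z y - z y) + (-1) * w y) x =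
      (1/h) * P s (\<lambda>y. P h z y - z y) x + (-1) * P s w x"
    by (rule P_lincomb[OF s L2_diff[OF Lh z] w])
  moreover have "AE x in M. P s (\<lambda>y. P h z y - z y) x = P s (P h z) x - P s z x"
    by (rule P_diff[OF s Lh z])
  moreover have "AE x in M. P (s + h) z x = P s (P h z) x" by (rule P_add[OF s h' z])
  ultimately show ?thesis by eventually_elim simp
qed

lemma generator_P:
  assumes t: "0 \<le> t" and gen: "infinitesimal_generator M P z w"
  shows "infinitesimal_generator M P (P t z) (P t w)"
proof -
  have z: "z \<in> L2 M" and w: "w \<in> L2 M"
    and lim: "((\<lambda>h. L2_norm M (\<lambda>x. (P h z x - z x) / h - w x)) \<longlongrightarrow> 0) (at_right 0)"
    using gen by (auto simp: infinitesimal_generator_def)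
  obtain B where B: "\<And>f. f \<in> L2 M \<Longrightarrow> L2_norm M (P t f) \<le> B * L2_norm M f"
    using P_bounded[OF t] by blast
  have "((\<lambda>h. L2_norm M (\<lambda>x. (P h (P t z) x - P t z x) / h - P t w x)) \<longlongrightarrow> 0) (at_right 0)"
  proof (rule tendsto_sandwich[OF _ _ tendsto_const])
    show "((\<lambda>h. B * L2_norm M (\<lambda>x. (P h z x - z x) / h - w x)) \<longlongrightarrow> 0) (at_right 0)"
      by (rule tendsto_eq_intros lim refl | simp)+
    show "\<forall>\<^sub>F h in at_right 0. L2_norm M (\<lambda>x. (P h (P t z) x - P t z x) / h - P t w x)
        \<le> B * L2_norm M (\<lambda>x. (P h z x - z x) / h - w x)"
      using eventually_at_right_less
    proof eventually_elim
      case (elim h)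
      then have h: "0 \<le> h" by simp
      have L: "(\<lambda>y. (P h z y - z y) / h - w y) \<in> L2 M"
        using L2_diff[OF L2_scale[OF L2_diff[OF P_L2[OF h z] z], of "1/h"] w] by simp
      note [measurable] = P_meas[OF h P_L2[OF t z]] P_meas[OF t z] P_meas[OF t w] P_meas[OF t L]
      have "AE x in M. P (h + t) z x = P h (P t z) x" by (rule P_add[OF h t z])
      then have "AE x in M. (P h (P t z) x - P t z x) / h - P t w x =
          P t (\<lambda>y. (P h z y - z y) / h - w y) x"
        using generator_increment_AE[OF t elim z w] by eventually_elim (simp add: add.commute)
      then have "L2_norm M (\<lambda>x. (P h (P t z) x - P t z x) / h - P t w x) =
          L2_norm M (P t (\<lambda>y. (P h z y - z y) / h - w y))"
        by (intro L2_norm_cong_AE) auto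
      then show ?case using B[OF L] by simp
    qed
  qed simp
  then show ?thesis using P_L2[OF t z] P_L2[OF t w] by (simp add: infinitesimal_generator_def)
qed

lemma pairing_has_derivative:
  assumes u: "u \<in> L2 M" and gen: "infinitesimal_generator M P z w" and t: "t \<in> {0..\<tau>}"
  shows "((\<lambda>t. \<integral>x. u x * P t z x \<partial>M) has_real_derivative (\<integral>x. u x * P t w x \<partial>M)) (at t within {0..\<tau>})"
proof -
  have z: "z \<in> L2 M" and w: "w \<in> L2 M"
    and lim: "((\<lambda>h. L2_norm M (\<lambda>x. (P h z x - z x) / h - w x)) \<longlongrightarrow> 0) (at_right 0)"
    using gen by (auto simp: infinitesimal_generator_def)
  obtain K where K: "1 \<le> K"
    "\<And>t f. 0 \<le> t \<Longrightarrow> t \<le> \<tau> \<Longrightarrow> f \<in> L2 M \<Longrightarrow> L2_norm M (P t f) \<le> K * L2_norm M f"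
    using P_bounded_on[of \<tau>] by blast
  show ?thesis
  proof (rule has_derivative_from_forward_increments[OF pairing_continuous[OF u w] _ _ t])
    show "((\<lambda>h. L2_norm M u * (K * L2_norm M (\<lambda>x. (P h z x - z x) / h - w x))) \<longlongrightarrow> 0) (at_right 0)"
      by (rule tendsto_eq_intros lim refl | simp)+
    fix s t assume st: "0 \<le> s" "s < t" "t \<le> \<tau>"
    define h where "h = t - s"
    have h: "0 < h" "0 \<le> h" "t = s + h" "0 \<le> s + h" using st by (auto simp: h_def)
    have D: "(\<lambda>y. (P h z y - z y) / h - w y) \<in> L2 M"
      using L2_diff[OF L2_scale[OF L2_diff[OF P_L2[OF h(2) z] z], of "1/h"] w] by simp
    note [simp] = L2_integrable_mult[OF u P_L2[OF h(4) z]] L2_integrable_mult[OF u P_L2[OF st(1) z]]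
       L2_integrable_mult[OF u P_L2[OF st(1) w]]
    note [measurable] = P_meas[OF h(4) z] P_meas[OF st(1) z] P_meas[OF st(1) w] L2_D(1)[OF u]
      P_meas[OF st(1) D]
    have "(\<integral>x. u x * P t z x \<partial>M) - (\<integral>x. u x * P s z x \<partial>M) - (t - s) * (\<integral>x. u x * P s w x \<partial>M) =
        (\<integral>x. u x * P (s + h) z x - u x * P s z x - h * (u x * P s w x) \<partial>M)"
      by (simp add: h)
    also have "\<dots> = (\<integral>x. h * (u x * P s (\<lambda>y. (P h z y - z y) / h - w y) x) \<partial>M)"
    proof (rule integral_cong_AE)
      show "AE x in M. u x * P (s + h) z x - u x * P s z x - h * (u x * P s w x) =
          h * (u x * P s (\<lambda>y. (P h z y - z y) / h - w y) x)"
        using generator_increment_AE[OF st(1) h(1) z w]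
      proof eventually_elim
        case (elim x)
        show ?case unfolding elim[symmetric] using h(1) by (simp add: field_simps)
      qed
    qed simp_all
    also have "\<bar>\<dots>\<bar> = h * \<bar>\<integral>x. u x * P s (\<lambda>y. (P h z y - z y) / h - w y) x \<partial>M\<bar>"
      using h(1) by (simp add: abs_mult)
    also have "\<dots> \<le> h * (L2_norm M u * L2_norm M (P s (\<lambda>y. (P h z y - z y) / h - w y)))"
      using h(1) by (intro mult_left_mono L2_Cauchy_Schwarz u P_L2 st D) auto
    also have "\<dots> \<le> h * (L2_norm M u * (K * L2_norm M (\<lambda>y. (P h z y - z y) / h - w y)))"
      using h(1) st by (intro mult_left_mono K D) auto
    finally show "\<bar>(\<integral>x. u x * P t z x \<partial>M) - (\<integral>x. u x * P s z x \<partial>M) - (t - s) * (\<integral>x. u x * P s w x \<partial>M)\<bar>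
        \<le> (t - s) * (\<lambda>h. L2_norm M u * (K * L2_norm M (\<lambda>x. (P h z x - z x) / h - w x))) (t - s)"
      by (simp add: h_def)
  qed
qed

text \<open>A truncated Laplace transform of the semigroup, tested against \<open>u\<close>. The hypothesis \<open>sym\<close>
  says that the generator, sending \<open>z\<close> to \<open>w\<close> and \<open>u\<close> to \<open>v\<close>, is symmetric; it lets one compute the
  transform from \<open>k * u - v\<close> alone, without knowing \<open>P\<close>.\<close>

lemma truncated_resolvent:
  assumes u: "u \<in> L2 M" and v: "v \<in> L2 M" and gen: "infinitesimal_generator M P z w"
    and sym: "\<And>t. 0 \<le> t \<Longrightarrow> (\<integral>x. u x * P t w x \<partial>M) = (\<integral>x. v x * P t z x \<partial>M)"
    and \<tau>: "0 \<le> \<tau>"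
  shows "((\<lambda>t. exp (- k * t) * (\<integral>x. (k * u x - v x) * P t z x \<partial>M)) has_integral
    (\<integral>x. u x * z x \<partial>M) - exp (- k * \<tau>) * (\<integral>x. u x * P \<tau> z x \<partial>M)) {0..\<tau>}"
proof -
  have z: "z \<in> L2 M" using gen by (auto simp: infinitesimal_generator_def)
  let ?F = "\<lambda>t. - (exp (- k * t) * (\<integral>x. u x * P t z x \<partial>M))"
  have "((\<lambda>t. exp (- k * t) * (\<integral>x. (k * u x - v x) * P t z x \<partial>M)) has_integral ?F \<tau> - ?F 0) {0..\<tau>}"
  proof (rule fundamental_theorem_of_calculus[OF \<tau>])
    fix t assume t: "t \<in> {0..\<tau>}"
    then have t0: "0 \<le> t" by simp
    have eq: "(\<integral>x. (k * u x - v x) * P t z x \<partial>M) = k * (\<integral>x. u x * P t z x \<partial>M) - (\<integral>x. u x * P t w x \<partial>M)"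
      using L2_integrable_mult[OF u P_L2[OF t0 z]] L2_integrable_mult[OF v P_L2[OF t0 z]]
      by (simp add: sym[OF t0] left_diff_distrib mult.assoc)
    show "(?F has_vector_derivative exp (- k * t) * (\<integral>x. (k * u x - v x) * P t z x \<partial>M)) (at t within
        {0..\<tau>})"
      unfolding has_real_derivative_iff_has_vector_derivative[symmetric] eq
      by (auto intro!: derivative_eq_intros pairing_has_derivative[OF u gen t] simp: algebra_simps)
  qed
  moreover have "(\<integral>x. u x * P 0 z x \<partial>M) = (\<integral>x. u x * z x \<partial>M)"
    using P_zero[OF z] L2_D(1)[OF u] L2_D(1)[OF z] P_meas[OF order_refl z]
    by (intro integral_cong_AE) auto
  ultimately show ?thesis by simp
qed

end

section \<open>A smooth step\<close>

lemma exists_antiderivative: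
  fixes f :: "real \<Rightarrow> real"
  assumes "continuous_on UNIV f"
  shows "\<exists>F. \<forall>x. (F has_real_derivative f x) (at x)"
  using einterval_antiderivative[of "-\<infinity>" \<infinity> f] assms
  by (simp add: has_real_derivative_iff_has_vector_derivative continuous_on_eq_continuous_at)

lemma DERIV_max_0_power:
  "((\<lambda>x::real. max 0 x ^ Suc (Suc n)) has_real_derivative real (Suc (Suc n)) * max 0 x ^ Suc n) (at x)"
proof (cases x "0::real" rule: linorder_cases)
  case less
  have "((\<lambda>x. 0) has_real_derivative 0) (at x)" by simp
  then have "((\<lambda>x::real. max 0 x ^ Suc (Suc n)) has_real_derivative 0) (at x)"
    by (rule has_field_derivative_transform_within_open[of _ _ _ "{..<0}"]) (use less in auto)
  then show ?thesis using less by (simp add: max_def)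
next
  case greater
  have "((\<lambda>x. x ^ Suc (Suc n)) has_real_derivative real (Suc (Suc n)) * x ^ Suc n) (at x)"
    using DERIV_pow[of "Suc (Suc n)" x] by simp
  then have "((\<lambda>x::real. max 0 x ^ Suc (Suc n)) has_real_derivative real (Suc (Suc n)) * x ^ Suc n)
      (at x)"
    by (rule has_field_derivative_transform_within_open[of _ _ _ "{0<..}"]) (use greater in auto)
  then show ?thesis using greater by (simp add: max_def)
next
  case equal
  have "((\<lambda>h::real. (max 0 (0 + h) ^ Suc (Suc n) - max 0 0 ^ Suc (Suc n)) / h) \<longlongrightarrow> 0) (at 0)"
  proof (rule Lim_null_comparison)
    show "\<forall>\<^sub>F h in at 0. norm ((max 0 (0 + h) ^ Suc (Suc n) - max 0 0 ^ Suc (Suc n)) / h) \<le> \<bar>h\<bar> ^ Suc n"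
      by (intro always_eventually allI) (auto simp: max_def abs_mult power_abs intro: mult_nonpos_nonneg)
    show "((\<lambda>h::real. \<bar>h\<bar> ^ Suc n) \<longlongrightarrow> 0) (at 0)"
      by (rule tendsto_eq_intros refl | simp)+
  qed
  then show ?thesis using equal by (simp add: DERIV_def)
qed

lemma DERIV_bump_factor:
  "((\<lambda>x::real. max 0 x ^ 3) has_real_derivative 3 * max 0 x ^ 2) (at x)"
  "((\<lambda>x::real. max 0 x ^ 2) has_real_derivative 2 * max 0 x) (at x)"
  using DERIV_max_0_power[of 1 x] DERIV_max_0_power[of 0 x]
      by (simp_all add: numeral_3_eq_3 numeral_2_eq_2)

lemma DERIV_one_minus: "((\<lambda>x::real. 1 - x) has_real_derivative - 1) (at x)"
  by (auto intro!: derivative_eq_intros)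

definition bump :: "real \<Rightarrow> real" where
  "bump x = max 0 x ^ 3 * max 0 (1 - x) ^ 3"

text \<open>An antiderivative of \<open>bump\<close>, determined up to a constant that cancels in \<open>step\<close>.\<close>

definition bump_integral :: "real \<Rightarrow> real" where
  "bump_integral = (SOME F. \<forall>x. (F has_real_derivative bump x) (at x))"

text \<open>A step of class \<open>C\<^sup>3\<close> from \<open>0\<close> on \<open>x \<le> 0\<close> to \<open>1\<close> on \<open>x \<ge> 1\<close>, and its derivatives.
  All cutoffs and test functions below are built from it.\<close>

definition step :: "real \<Rightarrow> real" where
  "step x = (bump_integral x - bump_integral 0) / (bump_integral 1 - bump_integral 0)"

definition step1 :: "real \<Rightarrow> real" where
  "step1 x = bump x / (bump_integral 1 - bump_integral 0)"

definition step2 :: "real \<Rightarrow> real" where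
  "step2 x = (3 * max 0 x ^ 2 * max 0 (1 - x) ^ 3 - max 0 x ^ 3 * (3 * max 0 (1 - x) ^ 2))
     / (bump_integral 1 - bump_integral 0)"

definition step3 :: "real \<Rightarrow> real" where
  "step3 x = (6 * max 0 x * max 0 (1 - x) ^ 3 - 18 * max 0 x ^ 2 * max 0 (1 - x) ^ 2
     + 6 * max 0 x ^ 3 * max 0 (1 - x)) / (bump_integral 1 - bump_integral 0)"

lemma continuous_bump: "continuous_on UNIV bump"
  unfolding bump_def by (intro continuous_intros)

lemma DERIV_bump_integral: "(bump_integral has_real_derivative bump x) (at x)"
proof -
  have "\<forall>x. (bump_integral has_real_derivative bump x) (at x)"
    unfolding bump_integral_def by (rule someI_ex[OF exists_antiderivative[OF continuous_bump]])
  then show ?thesis ..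
qed

lemma bump_nonneg: "0 \<le> bump x"
  by (simp add: bump_def)

lemma bump_pos: "0 < x \<Longrightarrow> x < 1 \<Longrightarrow> 0 < bump x"
  by (simp add: bump_def)

lemma bump_integral_less: "bump_integral 0 < bump_integral 1"
proof -
  have "bump_integral 0 \<le> bump_integral (1/4)" "bump_integral (3/4) \<le> bump_integral 1"
    by (rule DERIV_nonneg_imp_nondecreasing, simp, use DERIV_bump_integral bump_nonneg in blast)+
  moreover have "bump_integral (1/4) < bump_integral (3/4)"
    by (rule DERIV_pos_imp_increasing[of "1/4" "3/4"], simp)
      (use DERIV_bump_integral bump_pos in \<open>auto intro!: exI\<close>)
  ultimately show ?thesis by linarith
qed

lemma DERIV_step: "(step has_real_derivative step1 x) (at x)"
  unfolding step_def[abs_def] step1_def using bump_integral_less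
  by (auto intro!: derivative_eq_intros DERIV_bump_integral)

lemma DERIV_step1: "(step1 has_real_derivative step2 x) (at x)"
proof -
  have "((\<lambda>x. max 0 (1 - x) ^ 3) has_real_derivative - (3 * max 0 (1 - x) ^ 2)) (at x)"
    using DERIV_chain2[OF DERIV_bump_factor(1) DERIV_one_minus] by simp
  then have "(bump has_real_derivative 3 * max 0 x ^ 2 * max 0 (1 - x) ^ 3 +
      (- (3 * max 0 (1 - x) ^ 2)) * max 0 x ^ 3) (at x)"
    unfolding bump_def[abs_def] by (rule DERIV_mult[OF DERIV_bump_factor(1)])
  from DERIV_cdivide[OF this, of "bump_integral 1 - bump_integral 0"] show ?thesis
    unfolding step1_def[abs_def] step2_def by (simp add: mult_ac)
qed

lemma DERIV_step2: "(step2 has_real_derivative step3 x) (at x)"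
proof -
  have c: "((\<lambda>x. max 0 (1 - x) ^ 3) has_real_derivative - (3 * max 0 (1 - x) ^ 2)) (at x)"
    using DERIV_chain2[OF DERIV_bump_factor(1) DERIV_one_minus] by simp
  have d: "((\<lambda>x. max 0 (1 - x) ^ 2) has_real_derivative - (2 * max 0 (1 - x))) (at x)"
    using DERIV_chain2[OF DERIV_bump_factor(2) DERIV_one_minus] by simp
  show ?thesis unfolding step2_def[abs_def] step3_def
    by (rule DERIV_cdivide) (rule derivative_eq_intros DERIV_bump_factor c d refl | simp add:
        algebra_simps power2_eq_square)+
qed

lemma continuous_on_step3: "continuous_on A step3"
  unfolding step3_def using bump_integral_less by (intro continuous_intros) auto

lemma continuous_on_step2: "continuous_on A step2"
  by (meson DERIV_continuous_on DERIV_step2 has_field_derivative_at_within)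

lemma continuous_on_step1: "continuous_on A step1"
  by (meson DERIV_continuous_on DERIV_step1 has_field_derivative_at_within)

lemma continuous_on_step: "continuous_on A step"
  by (meson DERIV_continuous_on DERIV_step has_field_derivative_at_within)

lemma step1_nonneg: "0 \<le> step1 x"
  unfolding step1_def using bump_integral_less bump_nonneg by (simp add: less_imp_le)

lemma step_derivs_outside:
  assumes "x \<le> 0 \<or> 1 \<le> x"
  shows "step1 x = 0" "step2 x = 0" "step3 x = 0"
  using assms by (auto simp: step1_def step2_def step3_def bump_def max_def)

lemma DERIV_step_affine:
  "((\<lambda>x. step (m * (x - a) + c)) has_real_derivative m * step1 (m * (x - a) + c)) (at x)"
proof -
  have "((\<lambda>x. m * (x - a) + c) has_real_derivative m) (at x)" by (auto intro!: derivative_eq_intros)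
  from DERIV_chain2[OF DERIV_step this] show ?thesis by (simp add: mult.commute)
qed

lemma step_mono: "x \<le> y \<Longrightarrow> step x \<le> step y"
  by (rule DERIV_nonneg_imp_nondecreasing) (use DERIV_step step1_nonneg in blast)+

lemma step_le_0: "x \<le> 0 \<Longrightarrow> step x = 0"
proof (rule antisym)
  assume x: "x \<le> 0"
  show "step x \<le> 0" using step_mono[OF x] by (simp add: step_def)
  have "step 0 \<le> step x"
    by (rule DERIV_nonpos_imp_nonincreasing[OF x])
      (use DERIV_step step_derivs_outside(1) in \<open>fastforce\<close>)
  then show "0 \<le> step x" by (simp add: step_def)
qed

lemma step_ge_1: "1 \<le> x \<Longrightarrow> step x = 1"
proof (rule antisym)
  assume x: "1 \<le> x"
  have s1: "step 1 = 1" using bump_integral_less by (simp add: step_def)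
  show "1 \<le> step x" using step_mono[OF x] s1 by simp
  have "step x \<le> step 1"
    by (rule DERIV_nonpos_imp_nonincreasing[OF x])
      (use DERIV_step step_derivs_outside(1) in \<open>fastforce\<close>)
  then show "step x \<le> 1" using s1 by simp
qed

lemma step_nonneg: "0 \<le> step x" and step_le_1: "step x \<le> 1"
  using step_mono[of "min x 0" x] step_mono[of x "max x 1"] by (auto simp: step_le_0 step_ge_1)

section \<open>Weak derivatives on intervals\<close>

lemma restrict_lborel_integral:
  fixes f :: "real \<Rightarrow> real"
  assumes "I \<in> sets borel"
  shows "(\<integral>x. f x \<partial>restrict_space lborel I) = (\<integral>x. indicator I x * f x \<partial>lborel)"
  using assms by (subst integral_restrict_space) auto

lemma restrict_lborel_integrable:
  fixes f :: "real \<Rightarrow> real"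
  assumes "I \<in> sets borel"
  shows "integrable (restrict_space lborel I) f \<longleftrightarrow> integrable lborel (\<lambda>x. indicator I x * f x)"
  using assms by (subst integrable_restrict_space) auto

lemma restrict_lborel_measurable:
  fixes f :: "real \<Rightarrow> real"
  assumes "I \<in> sets borel"
  shows "f \<in> borel_measurable (restrict_space lborel I) \<longleftrightarrow> (\<lambda>x. indicator I x * f x) \<in>
      borel_measurable lborel"
  using assms by (subst borel_measurable_restrict_space_iff) auto

lemma restrict_lborel_AE:
  assumes "I \<in> sets borel"
  shows "(AE x in restrict_space lborel I. Q x) \<longleftrightarrow> (AE x in lborel. x \<in> I \<longrightarrow> Q x)"
  using assms by (subst AE_restrict_space_iff) auto

lemma L2_restrict_integrable_mult:
  assumes I: "I \<in> sets borel" and f: "f \<in> L2 (restrict_space lborel I)"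
    and ab: "{a..b} \<subseteq> I" and h: "continuous_on {a..b} h"
  shows "integrable lborel (\<lambda>x::real. indicator {a..b} x * (f x * h x))"
proof -
  have "(\<lambda>x. indicator {a..b} x * h x) \<in> L2 (restrict_space lborel I)"
  proof -
    have m: "(\<lambda>x. indicator {a..b} x * h x) \<in> borel_measurable lborel"
      using borel_measurable_continuous_on_indicator[OF _ h] by simp
    have "integrable lborel (\<lambda>x. indicator {a..b} x *\<^sub>R (h x)\<^sup>2)"
      by (intro borel_integrable_compact continuous_intros h compact_Icc)
    also have "(\<lambda>x. indicator {a..b} x *\<^sub>R (h x)\<^sup>2) = (\<lambda>x. indicator I x * (indicator {a..b} x * h x)\<^sup>2)"
      using ab by (auto simp: fun_eq_iff indicator_def)
    finally show ?thesis
      using m I by (auto simp: L2_def restrict_lborel_measurable restrict_lborel_integrable)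
  qed
  from L2_integrable_mult[OF f this] have "integrable lborel (\<lambda>x. indicator I x * (f x * (indicator
      {a..b} x * h x)))"
    using I by (simp add: restrict_lborel_integrable)
  also have "(\<lambda>x. indicator I x * (f x * (indicator {a..b} x * h x))) =
      (\<lambda>x. indicator {a..b} x * (f x * h x))"
    using ab by (auto simp: fun_eq_iff indicator_def)
  finally show ?thesis .
qed

lemma continuous_integrable_Icc:
  "continuous_on {a..b} h \<Longrightarrow> integrable lborel (\<lambda>x::real. indicator {a..b} x * (h x::real))"
  using borel_integrable_compact[OF compact_Icc, of a b h] by simp

lemma FTC_Icc:
  fixes F f :: "real \<Rightarrow> real"
  assumes "a \<le> b" "\<And>x. (F has_real_derivative f x) (at x)" "continuous_on {a..b} f"
  shows "(\<integral>x. indicator {a..b} x * f x \<partial>lborel) = F b - F a"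
  using integral_FTC_Icc[OF assms(1) _ assms(3), of F] assms(2)
  by (simp add: has_real_derivative_iff_has_vector_derivative[symmetric] has_field_derivative_at_within)

lemma test_functionsI:
  assumes "\<And>x. (\<phi> has_real_derivative \<phi>' x) (at x)" "continuous_on UNIV \<phi>'"
    and "{a..b} \<subseteq> interior I" "\<And>x. x \<notin> {a..b} \<Longrightarrow> \<phi> x = 0"
  shows "\<phi> \<in> test_functions I"
  unfolding test_functions_def C1_differentiable_on_def
  using assms by (auto simp: has_real_derivative_iff_has_vector_derivative[symmetric] intro!: exI[of
      _ \<phi>'] exI[of _ "{a..b}"])

lemma approximate_identity:
  assumes ab: "a \<le> b" and c: "c \<in> {a..b}" and h: "continuous_on {a..b} h"
    and k: "\<And>n. continuous_on {a..b} (k n)" "\<And>n x. (0::real) \<le> k n x"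
    and supp: "\<And>n x. 2 / real (Suc n) < \<bar>x - c\<bar> \<Longrightarrow> k n x = 0"
    and one: "\<forall>\<^sub>F n in sequentially. (\<integral>x. indicator {a..b} x * k n x \<partial>lborel) = 1"
  shows "(\<lambda>n. \<integral>x. indicator {a..b} x * (h x * k n x) \<partial>lborel) \<longlonglongrightarrow> h c"
proof (rule LIMSEQ_I)
  fix e :: real assume e: "0 < e"
  obtain d where d: "0 < d" "\<And>x. x \<in> {a..b} \<Longrightarrow> dist x c < d \<Longrightarrow> dist (h x) (h c) < e / 2"
    using h c e unfolding continuous_on_iff by (metis half_gt_zero)
  have "(\<lambda>n. 2 / real (Suc n)) \<longlonglongrightarrow> 0"
    using tendsto_mult[OF tendsto_const LIMSEQ_inverse_real_of_nat, of 2] by (simp add: divide_inverse)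
  then have "\<forall>\<^sub>F n in sequentially. 2 / real (Suc n) < d" by (rule order_tendstoD(2)) (rule d)
  with one have "\<forall>\<^sub>F n in sequentially. norm ((\<integral>x. indicator {a..b} x * (h x * k n x) \<partial>lborel) - h
      c) < e"
  proof eventually_elim
    case (elim n)
    note i1 = continuous_integrable_Icc[OF k(1)[of n]]
    note i2 = continuous_integrable_Icc[OF continuous_on_mult[OF h k(1)[of n]]]
    have "(\<integral>x. indicator {a..b} x * (h x * k n x) \<partial>lborel) - h c =
        (\<integral>x. indicator {a..b} x * (h x * k n x) - h c * (indicator {a..b} x * k n x) \<partial>lborel)"
      using elim i1 i2 by (subst Bochner_Integration.integral_diff) auto
    also have "norm \<dots> \<le> (\<integral>x. e / 2 * (indicator {a..b} x * k n x) \<partial>lborel)"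
    proof (rule Bochner_Integration.integral_norm_bound_integral)
      fix x
      show "norm (indicator {a..b} x * (h x * k n x) - h c * (indicator {a..b} x * k n x)) \<le>
          e / 2 * (indicator {a..b} x * k n x)"
      proof (cases "x \<in> {a..b} \<and> \<bar>x - c\<bar> < d")
        case True
        then have "\<bar>h x - h c\<bar> * k n x \<le> e / 2 * k n x"
          using d(2)[of x] k(2)[of n x] by (intro mult_right_mono) (auto simp: dist_real_def)
        moreover have "h x * k n x - h c * k n x = (h x - h c) * k n x" by (simp add: algebra_simps)
        ultimately show ?thesis using True k(2)[of n x] by (simp add: abs_mult)
      next
        case False
        then show ?thesis using supp[of n x] elim by (auto simp: indicator_def)
      qed
    qed (use i1 i2 in auto)
    also have "\<dots> = e / 2" using elim by simp
    finally show ?case using e by simp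
  qed
  then show "\<exists>N. \<forall>n\<ge>N. norm ((\<integral>x. indicator {a..b} x * (h x * k n x) \<partial>lborel) - h c) < e"
    by (simp add: eventually_sequentially)
qed

text \<open>Cutoffs of \<open>{a..b}\<close> whose derivative consists of two opposite approximate identities,
  at \<open>a\<close> and at \<open>b\<close>.\<close>

definition cutoff :: "real \<Rightarrow> real \<Rightarrow> nat \<Rightarrow> real \<Rightarrow> real" where
  "cutoff a b n x = step (real (Suc n) * (x - a) - 1) - step (real (Suc n) * (x - b) + 2)"

lemma DERIV_cutoff:
  "(cutoff a b n has_real_derivative
     real (Suc n) * step1 (real (Suc n) * (x - a) - 1) - real (Suc n) * step1 (real (Suc n) * (x -
         b) + 2)) (at x)"
  unfolding cutoff_def[abs_def]
  using DERIV_diff[OF DERIV_step_affine[of "real (Suc n)" a "-1"] DERIV_step_affine[of "real (Suc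
      n)" b 2]] by simp

lemma abs_cutoff_le: "\<bar>cutoff a b n x\<bar> \<le> 1"
  using step_nonneg[of "real (Suc n) * (x - a) - 1"] step_le_1[of "real (Suc n) * (x - a) - 1"]
    step_nonneg[of "real (Suc n) * (x - b) + 2"] step_le_1[of "real (Suc n) * (x - b) + 2"]
  unfolding cutoff_def by linarith

lemma cutoff_tendsto_1:
  assumes "a < x" "x < b"
  shows "(\<lambda>n. cutoff a b n x) \<longlonglongrightarrow> 1"
proof (rule tendsto_eventually)
  have "\<forall>\<^sub>F n in sequentially. 2 / (x - a) \<le> real n \<and> 2 / (b - x) \<le> real n"
    by (intro eventually_conj eventually_ge_at_top[THEN filterlim_real_sequentially[unfolded
        filterlim_iff, rule_format]])
  then show "\<forall>\<^sub>F n in sequentially. cutoff a b n x = 1"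
  proof eventually_elim
    case (elim n)
    then have "2 \<le> real n * (x - a)" "2 \<le> real n * (b - x)" using assms by (simp_all add: divide_le_eq)
    then have "1 \<le> real (Suc n) * (x - a) - 1" "real (Suc n) * (x - b) + 2 \<le> 0"
      using assms by (auto simp: algebra_simps)
    then show ?case unfolding cutoff_def by (simp add: step_le_0 step_ge_1)
  qed
qed

lemma integral_cutoff_tendsto:
  assumes int: "integrable lborel (\<lambda>x. indicator {a..b} x * h x)"
  shows "(\<lambda>n. \<integral>x. indicator {a..b} x * (h x * cutoff a b n x) \<partial>lborel) \<longlonglongrightarrow>
      (\<integral>x. indicator {a..b} x * h x \<partial>lborel)"
proof (rule integral_dominated_convergence[where w="\<lambda>x. \<bar>indicator {a..b} x * h x\<bar>"])
  have [measurable]: "(\<lambda>x. indicator {a..b} x * h x) \<in> borel_measurable lborel" using int by simp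
  have [measurable]: "cutoff a b n \<in> borel_measurable borel" for n
    by (intro borel_measurable_continuous_onI) (meson DERIV_continuous_on DERIV_cutoff
        has_field_derivative_at_within)
  show "(\<lambda>x. indicator {a..b} x * h x) \<in> borel_measurable lborel" using int by simp
  show "(\<lambda>x. indicator {a..b} x * (h x * cutoff a b n x)) \<in> borel_measurable lborel" for n
    unfolding mult.assoc[symmetric] by simp
  show "integrable lborel (\<lambda>x. \<bar>indicator {a..b} x * h x\<bar>)" using int by simp
  have "AE x in lborel. x \<noteq> a" "AE x in lborel. x \<noteq> b" by (rule AE_lborel_singleton)+
  then show "AE x in lborel. (\<lambda>n. indicator {a..b} x * (h x * cutoff a b n x)) \<longlonglongrightarrow>
      indicator {a..b} x * h x"
  proof eventually_elim
    case (elim x)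
    show ?case
    proof (cases "x \<in> {a..b}")
      case True
      then have "(\<lambda>n. h x * cutoff a b n x) \<longlonglongrightarrow> h x * 1"
        using elim by (intro tendsto_intros cutoff_tendsto_1) auto
      then show ?thesis using True by simp
    qed simp
  qed
  show "AE x in lborel. norm (indicator {a..b} x * (h x * cutoff a b n x)) \<le>
      \<bar>indicator {a..b} x * h x\<bar>" for n
  proof (intro AE_I2)
    fix x
    have "\<bar>indicator {a..b} x * h x\<bar> * \<bar>cutoff a b n x\<bar> \<le> \<bar>indicator {a..b} x * h x\<bar> * 1"
      by (intro mult_left_mono abs_cutoff_le) simp
    then show "norm (indicator {a..b} x * (h x * cutoff a b n x)) \<le> \<bar>indicator {a..b} x * h x\<bar>"
      by (simp add: abs_mult mult_ac)
  qed
qed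

text \<open>Integration by parts up to the boundary, although weak derivatives only see test functions
  with support in the interior.\<close>

lemma weak_derivative_by_parts:
  assumes ab: "a < b" "{a..b} \<subseteq> I" and I: "I \<in> sets borel"
    and f: "f \<in> L2 (restrict_space lborel I)" and g: "g \<in> L2 (restrict_space lborel I)"
    and wd: "weak_derivative I f g"
    and F: "continuous_on {a..b} F" "AE x in lborel. x \<in> {a..b} \<longrightarrow> f x = F x"
    and \<phi>: "\<And>x. (\<phi> has_real_derivative \<phi>' x) (at x)" "continuous_on UNIV \<phi>'"
  shows "(\<integral>x. indicator {a..b} x * (g x * \<phi> x) \<partial>lborel) =
    F b * \<phi> b - F a * \<phi> a - (\<integral>x. indicator {a..b} x * (F x * \<phi>' x) \<partial>lborel)"
proof -
  \<comment> \<open>The derivative of the cutoff is \<open>p n - q n\<close>.\<close>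
  define p where "p n x = real (Suc n) * step1 (real (Suc n) * (x - a) - 1)" for n x
  define q where "q n x = real (Suc n) * step1 (real (Suc n) * (x - b) + 2)" for n x
  have cont_pq: "continuous_on A (p n)" "continuous_on A (q n)" for A n
    unfolding p_def q_def
    by (intro continuous_intros continuous_on_compose2[OF continuous_on_step1[of UNIV]]; simp)+
  have cont_\<phi>: "continuous_on A \<phi>" for A
    by (meson DERIV_continuous_on \<phi>(1) has_field_derivative_at_within)
  have cont_\<phi>': "continuous_on A \<phi>'" for A using \<phi>(2) continuous_on_subset by blast
  have cont_c: "continuous_on A (cutoff a b n)" for A n
    by (meson DERIV_continuous_on DERIV_cutoff has_field_derivative_at_within)
  have big: "\<forall>\<^sub>F n in sequentially. 4 / (b - a) \<le> real n"
    by (intro eventually_ge_at_top[THEN filterlim_real_sequentially[unfolded filterlim_iff,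
        rule_format]])
  have lim_p: "(\<lambda>n. \<integral>x. indicator {a..b} x * ((F x * \<phi> x) * p n x) \<partial>lborel) \<longlonglongrightarrow> F a * \<phi> a"
  proof (rule approximate_identity)
    show "\<forall>\<^sub>F n in sequentially. (\<integral>x. indicator {a..b} x * p n x \<partial>lborel) = 1"
      using big
    proof eventually_elim
      case (elim n)
      have "(\<integral>x. indicator {a..b} x * p n x \<partial>lborel) =
          step (real (Suc n) * (b - a) - 1) - step (real (Suc n) * (a - a) - 1)"
        unfolding p_def[abs_def] using ab
        using DERIV_step_affine[of "real (Suc n)" a "-1"] cont_pq(1)[unfolded p_def[abs_def], of _ n]
        by (intro FTC_Icc) auto
      moreover have "4 \<le> real n * (b - a)" using elim ab by (simp add: divide_le_eq)
      then have "1 \<le> real (Suc n) * (b - a) - 1" using ab by (simp add: algebra_simps)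
      ultimately show ?case by (simp add: step_le_0 step_ge_1)
    qed
    fix n x assume "2 / real (Suc n) < \<bar>x - a\<bar>"
    then have "2 < real (Suc n) * \<bar>x - a\<bar>" by (simp add: divide_less_eq mult.commute)
    then have "real (Suc n) * (x - a) - 1 \<le> 0 \<or> 1 \<le> real (Suc n) * (x - a) - 1"
      using mult_nonneg_nonpos[of "real (Suc n)" "x - a"] by (cases "x \<le> a") auto
    then show "p n x = 0" unfolding p_def by (simp add: step_derivs_outside)
  qed (use ab F cont_\<phi> cont_pq in \<open>auto intro!: continuous_intros simp: p_def step1_nonneg\<close>)
  have lim_q: "(\<lambda>n. \<integral>x. indicator {a..b} x * ((F x * \<phi> x) * q n x) \<partial>lborel) \<longlonglongrightarrow> F b * \<phi> b"
  proof (rule approximate_identity)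
    show "\<forall>\<^sub>F n in sequentially. (\<integral>x. indicator {a..b} x * q n x \<partial>lborel) = 1"
      using big
    proof eventually_elim
      case (elim n)
      have "(\<integral>x. indicator {a..b} x * q n x \<partial>lborel) =
          step (real (Suc n) * (b - b) + 2) - step (real (Suc n) * (a - b) + 2)"
        unfolding q_def[abs_def] using ab
        using DERIV_step_affine[of "real (Suc n)" b 2] cont_pq(2)[unfolded q_def[abs_def], of _ n]
        by (intro FTC_Icc) auto
      moreover have "4 \<le> real n * (b - a)" using elim ab by (simp add: divide_le_eq)
      then have "real (Suc n) * (a - b) + 2 \<le> 0" using ab by (simp add: algebra_simps)
      ultimately show ?case by (simp add: step_le_0 step_ge_1)
    qed
    fix n x assume "2 / real (Suc n) < \<bar>x - b\<bar>"
    then have "2 < real (Suc n) * \<bar>x - b\<bar>" by (simp add: divide_less_eq mult.commute)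
    then have "real (Suc n) * (x - b) + 2 \<le> 0 \<or> 1 \<le> real (Suc n) * (x - b) + 2"
      by (cases "x \<le> b") (auto simp: algebra_simps)
    then show "q n x = 0" unfolding q_def by (simp add: step_derivs_outside)
  qed (use ab F cont_\<phi> cont_pq in \<open>auto intro!: continuous_intros simp: q_def step1_nonneg\<close>)
  have int_F: "integrable lborel (\<lambda>x. indicator {a..b} x * (F x * \<phi>' x))"
    by (intro continuous_integrable_Icc continuous_intros F cont_\<phi>')
  have int_g: "integrable lborel (\<lambda>x. indicator {a..b} x * (g x * \<phi> x))"
    by (rule L2_restrict_integrable_mult[OF I g ab(2) cont_\<phi>])
  have ev: "\<forall>\<^sub>F n in sequentially.
    - (\<integral>x. indicator {a..b} x * ((g x * \<phi> x) * cutoff a b n x) \<partial>lborel) =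
      (\<integral>x. indicator {a..b} x * ((F x * \<phi>' x) * cutoff a b n x) \<partial>lborel) +
      ((\<integral>x. indicator {a..b} x * ((F x * \<phi> x) * p n x) \<partial>lborel) -
       (\<integral>x. indicator {a..b} x * ((F x * \<phi> x) * q n x) \<partial>lborel))"
    using big
  proof eventually_elim
    case (elim n)
    define t where "t x = \<phi> x * cutoff a b n x" for x
    define t' where "t' x = \<phi>' x * cutoff a b n x + \<phi> x * (p n x - q n x)" for x
    define c d where "c = a + 1 / real (Suc n)" and "d = b - 1 / real (Suc n)"
    have cd: "a < c" "d < b" by (auto simp: c_def d_def)
    have t: "(t has_real_derivative t' x) (at x)" for x
      unfolding t_def[abs_def] t'_def p_def q_def
      by (rule DERIV_cong[OF DERIV_mult[OF \<phi>(1) DERIV_cutoff]]) (simp add: algebra_simps)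
    have t'c: "continuous_on A t'" for A
      unfolding t'_def[abs_def] by (intro continuous_intros cont_\<phi> cont_\<phi>' cont_c cont_pq)
    have 4: "4 \<le> real n * (b - a)" using elim ab by (simp add: divide_le_eq)
    have zero: "cutoff a b n x = 0" "p n x = 0" "q n x = 0" if x: "x \<notin> {c..d}" for x
    proof -
      have mul: "real (Suc n) * c = real (Suc n) * a + 1" "real (Suc n) * d = real (Suc n) * b - 1"
        by (auto simp: c_def d_def field_simps)
      have 5: "real (Suc n) * (b - a) \<ge> 4" using 4 ab by (simp add: algebra_simps)
      from x consider "x < c" | "d < x" by fastforce
      then have "(real (Suc n) * (x - a) - 1 \<le> 0 \<and> real (Suc n) * (x - b) + 2 \<le> 0) \<or>
          (1 \<le> real (Suc n) * (x - a) - 1 \<and> 1 \<le> real (Suc n) * (x - b) + 2)"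
      proof cases
        case 1
        then have "real (Suc n) * x < real (Suc n) * c" by (intro mult_strict_left_mono) auto
        then show ?thesis using 5 unfolding mul right_diff_distrib by linarith
      next
        case 2
        then have "real (Suc n) * d < real (Suc n) * x" by (intro mult_strict_left_mono) auto
        then show ?thesis using 5 unfolding mul right_diff_distrib by linarith
      qed
      then show "cutoff a b n x = 0" "p n x = 0" "q n x = 0"
        unfolding cutoff_def p_def q_def by (auto simp: step_le_0 step_ge_1 step_derivs_outside)
    qed
    have tzero: "t x = 0" "t' x = 0" if "x \<notin> {c..d}" for x
      using zero[OF that] by (auto simp: t_def t'_def)
    have "{c..d} \<subseteq> {a<..<b}" using cd by auto
    also have "\<dots> \<subseteq> interior I" using ab(2) by (intro interior_maximal) auto
    finally have "t \<in> test_functions I" by (intro test_functionsI[OF t t'c _ tzero(1)]) auto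
    moreover have "deriv t = t'" using t by (auto intro: DERIV_imp_deriv)
    ultimately have "(\<integral>x. indicator I x * (f x * t' x) \<partial>lborel) =
        - (\<integral>x. indicator I x * (g x * t x) \<partial>lborel)"
      using wd I unfolding weak_derivative_def restrict_lborel_integral[OF I] by auto
    moreover have "(\<integral>x. indicator I x * (g x * t x) \<partial>lborel) =
        (\<integral>x. indicator {a..b} x * ((g x * \<phi> x) * cutoff a b n x) \<partial>lborel)"
    proof (rule Bochner_Integration.integral_cong[OF refl])
      fix x show "indicator I x * (g x * t x) = indicator {a..b} x * (g x * \<phi> x * cutoff a b n x)"
        using zero(1)[of x] cd subsetD[OF ab(2), of x]
            by (cases "x \<in> {c..d}") (auto simp: t_def indicator_def)
    qed
    moreover have "(\<integral>x. indicator I x * (f x * t' x) \<partial>lborel) =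
        (\<integral>x. indicator {a..b} x * (F x * t' x) \<partial>lborel)"
    proof (rule integral_cong_AE)
      have [measurable]: "t' \<in> borel_measurable borel" using t'c
          by (rule borel_measurable_continuous_onI)
      have [measurable]: "(\<lambda>x. indicator I x * f x) \<in> borel_measurable lborel"
        using L2_D(1)[OF f] I by (simp add: restrict_lborel_measurable)
      show "(\<lambda>x. indicator I x * (f x * t' x)) \<in> borel_measurable lborel"
        unfolding mult.assoc[symmetric] by simp
      show "(\<lambda>x. indicator {a..b} x * (F x * t' x)) \<in> borel_measurable lborel"
        using continuous_integrable_Icc[OF continuous_on_mult[OF F(1) t'c]] by simp
      show "AE x in lborel. indicator I x * (f x * t' x) = indicator {a..b} x * (F x * t' x)"
        using F(2)
      proof eventually_elim
        case (elim x)
        then show ?case using tzero(2)[of x] cd subsetD[OF ab(2), of x]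
            by (cases "x \<in> {c..d}") (auto simp: indicator_def)
      qed
    qed
    moreover have "(\<integral>x. indicator {a..b} x * (F x * t' x) \<partial>lborel) =
      (\<integral>x. indicator {a..b} x * ((F x * \<phi>' x) * cutoff a b n x) +
        (indicator {a..b} x * ((F x * \<phi> x) * p n x) - indicator {a..b} x * ((F x * \<phi> x) * q n x))
            \<partial>lborel)"
      by (rule Bochner_Integration.integral_cong) (auto simp: t'_def algebra_simps)
    moreover have "\<dots> = (\<integral>x. indicator {a..b} x * ((F x * \<phi>' x) * cutoff a b n x) \<partial>lborel) +
      ((\<integral>x. indicator {a..b} x * ((F x * \<phi> x) * p n x) \<partial>lborel) -
       (\<integral>x. indicator {a..b} x * ((F x * \<phi> x) * q n x) \<partial>lborel))"
    proof -
      have "integrable lborel (\<lambda>x. indicator {a..b} x * ((F x * \<phi>' x) * cutoff a b n x))"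
        "integrable lborel (\<lambda>x. indicator {a..b} x * ((F x * \<phi> x) * p n x))"
        "integrable lborel (\<lambda>x. indicator {a..b} x * ((F x * \<phi> x) * q n x))"
        by (intro continuous_integrable_Icc continuous_intros F cont_\<phi> cont_\<phi>' cont_c cont_pq)+
      then show ?thesis by simp
    qed
    ultimately show ?case by simp
  qed
  have l1: "(\<lambda>n. - (\<integral>x. indicator {a..b} x * ((g x * \<phi> x) * cutoff a b n x) \<partial>lborel)) \<longlonglongrightarrow>
      - (\<integral>x. indicator {a..b} x * (g x * \<phi> x) \<partial>lborel)"
    by (intro tendsto_minus integral_cutoff_tendsto int_g)
  have l2: "(\<lambda>n. (\<integral>x. indicator {a..b} x * ((F x * \<phi>' x) * cutoff a b n x) \<partial>lborel) +
      ((\<integral>x. indicator {a..b} x * ((F x * \<phi> x) * p n x) \<partial>lborel) -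
       (\<integral>x. indicator {a..b} x * ((F x * \<phi> x) * q n x) \<partial>lborel))) \<longlonglongrightarrow>
       (\<integral>x. indicator {a..b} x * (F x * \<phi>' x) \<partial>lborel) + (F a * \<phi> a - F b * \<phi> b)"
    by (intro tendsto_add tendsto_diff integral_cutoff_tendsto int_F lim_p lim_q)
  from tendsto_unique[OF _ tendsto_cong[OF ev, THEN iffD1, OF l1] l2]
  show ?thesis by simp
qed

text \<open>A function with vanishing integrals over all compact subintervals vanishes almost
  everywhere: the measures with densities \<open>D\<^sup>+\<close> and \<open>D\<^sup>-\<close> coincide.\<close>

lemma AE_zero_if_integrals_zero:
  fixes D :: "real \<Rightarrow> real"
  assumes int: "integrable lborel (\<lambda>x. indicator {a..b} x * D x)"
    and zero: "\<And>c d. a \<le> c \<Longrightarrow> c < d \<Longrightarrow> d \<le> b \<Longrightarrow> (\<integral>x. indicator {c..d} x * D x \<partial>lborel) = 0"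
  shows "AE x in lborel. x \<in> {a..b} \<longrightarrow> D x = 0"
proof -
  define h where "h x = indicator {a..b} x * D x" for x
  have hi: "integrable lborel h" using int by (simp add: h_def[abs_def])
  then have [measurable]: "h \<in> borel_measurable borel" by simp
  have z: "(\<integral>x. indicator {c<..} x * h x \<partial>lborel) = 0" for c
  proof (cases "max a c < b")
    case True
    have "(\<integral>x. indicator {c<..} x * h x \<partial>lborel) = (\<integral>x. indicator {max a c..b} x * D x \<partial>lborel)"
    proof (rule integral_cong_AE)
      have eq: "(\<lambda>x. indicator {max a c..b} x * D x) = (\<lambda>x. indicator {max a c..b} x * h x)"
        by (auto simp: h_def indicator_def)
      show "(\<lambda>x. indicator {max a c..b} x * D x) \<in> borel_measurable lborel"
        unfolding eq by simp
      show "AE x in lborel. indicator {c<..} x * h x = indicator {max a c..b} x * D x"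
        using AE_lborel_singleton[of c] by eventually_elim (auto simp: h_def indicator_def)
    qed simp
    then show ?thesis using zero[of "max a c" b] True by simp
  next
    case False
    have "AE x in lborel. indicator {c<..} x * h x = 0"
      using AE_lborel_singleton[of b] by eventually_elim (use False in \<open>auto simp: h_def indicator_def\<close>)
    then show ?thesis by (rule integral_eq_zero_AE)
  qed
  have pm: "(\<integral>\<^sup>+x. ennreal (h x) * indicator {c<..} x \<partial>lborel) =
      (\<integral>\<^sup>+x. ennreal (- h x) * indicator {c<..} x \<partial>lborel)"
    "(\<integral>\<^sup>+x. ennreal (h x) * indicator {c<..} x \<partial>lborel) < \<infinity>" for c
  proof -
    have i: "integrable lborel (\<lambda>x. indicator {c<..} x * h x)"
      using integrable_mult_indicator[OF _ hi, of "{c<..}"] by simp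
    have ip: "integrable lborel (\<lambda>x. max 0 (indicator {c<..} x * h x))"
      and im: "integrable lborel (\<lambda>x. max 0 (- (indicator {c<..} x * h x)))" using i by auto
    have "(\<integral>x. max 0 (indicator {c<..} x * h x) \<partial>lborel) - (\<integral>x. max 0 (- (indicator {c<..} x * h x))
        \<partial>lborel) =
        (\<integral>x. max 0 (indicator {c<..} x * h x) - max 0 (- (indicator {c<..} x * h x)) \<partial>lborel)"
      using ip im by simp
    also have "\<dots> = (\<integral>x. indicator {c<..} x * h x \<partial>lborel)"
      by (rule Bochner_Integration.integral_cong) (auto simp: max_def)
    finally have eq: "(\<integral>x. max 0 (indicator {c<..} x * h x) \<partial>lborel) =
        (\<integral>x. max 0 (- (indicator {c<..} x * h x)) \<partial>lborel)"
      using z by simp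
    have 1: "(\<integral>\<^sup>+x. ennreal (h x) * indicator {c<..} x \<partial>lborel) =
        ennreal (\<integral>x. max 0 (indicator {c<..} x * h x) \<partial>lborel)"
      by (subst nn_integral_eq_integral[OF ip, symmetric])
        (auto intro!: nn_integral_cong simp: indicator_def max_def ennreal_neg)
    have 2: "(\<integral>\<^sup>+x. ennreal (- h x) * indicator {c<..} x \<partial>lborel) =
        ennreal (\<integral>x. max 0 (- (indicator {c<..} x * h x)) \<partial>lborel)"
      by (subst nn_integral_eq_integral[OF im, symmetric])
        (auto intro!: nn_integral_cong simp: indicator_def max_def ennreal_neg)
    show "(\<integral>\<^sup>+x. ennreal (h x) * indicator {c<..} x \<partial>lborel) =
        (\<integral>\<^sup>+x. ennreal (- h x) * indicator {c<..} x \<partial>lborel)"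
      "(\<integral>\<^sup>+x. ennreal (h x) * indicator {c<..} x \<partial>lborel) < \<infinity>"
      unfolding 1 2 eq by simp_all
  qed
  have "density lborel (\<lambda>x. ennreal (h x)) = density lborel (\<lambda>x. ennreal (- h x))"
    by (rule measure_eqI_lessThan) (use pm in \<open>auto simp: emeasure_density\<close>)
  then have "AE x in lborel. ennreal (h x) = ennreal (- h x)"
    by (rule sigma_finite_measure.density_unique[OF lborel.sigma_finite_measure_axioms, rotated 2]) auto
  then show ?thesis
  proof eventually_elim
    case (elim x)
    then have "h x = 0" by (cases "h x \<ge> 0") (auto simp: ennreal_neg not_le)
    then show ?case by (auto simp: h_def)
  qed
qed

lemma weak_derivative_C1:
  assumes I: "I \<in> sets borel"
    and f: "\<And>x. (f has_real_derivative f' x) (at x)" "continuous_on UNIV f'"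
  shows "weak_derivative I f f'"
  unfolding weak_derivative_def
proof
  fix \<phi> assume "\<phi> \<in> test_functions I"
  then obtain K \<phi>' where K: "compact K" "K \<subseteq> interior I" "\<And>x. x \<notin> K \<Longrightarrow> \<phi> x = 0"
    and \<phi>: "\<And>x. (\<phi> has_real_derivative \<phi>' x) (at x)" "continuous_on UNIV \<phi>'"
    by (auto simp: test_functions_def C1_differentiable_on_def
        has_real_derivative_iff_has_vector_derivative)
  have KI: "K \<subseteq> I" using K(2) interior_subset by blast
  have d: "deriv \<phi> = \<phi>'" using \<phi> by (auto intro: DERIV_imp_deriv)
  have \<phi>'0: "\<phi>' x = 0" if "x \<notin> K" for x
  proof (rule DERIV_unique)
    show "(\<phi> has_real_derivative \<phi>' x) (at x)" by (rule \<phi>)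
    have "((\<lambda>x. 0) has_real_derivative 0) (at x)" by simp
    then show "(\<phi> has_real_derivative 0) (at x)"
      by (rule has_field_derivative_transform_within_open[of _ _ _ "- K"])
        (use that K compact_imp_closed in \<open>auto simp: open_Compl\<close>)
  qed
  obtain B where B: "\<And>x. x \<in> K \<Longrightarrow> \<bar>x\<bar> \<le> B" "0 < B"
    using compact_imp_bounded[OF K(1)] by (auto simp: bounded_pos)
  define b where "b = B + 1"
  have b: "0 < b" "K \<subseteq> {-b..b}" "b \<notin> K" "-b \<notin> K"
    using B by (fastforce simp: b_def abs_le_iff)+
  have cont: "continuous_on A f" "continuous_on A \<phi>" "continuous_on A f'" "continuous_on A \<phi>'" for A
    using f \<phi> by (meson DERIV_continuous_on has_field_derivative_at_within continuous_on_subset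
        subset_UNIV)+
  have eq: "(\<integral>x. indicator I x * h x \<partial>lborel) = (\<integral>x. indicator {-b..b} x * h x \<partial>lborel)"
    if "\<And>x. x \<notin> K \<Longrightarrow> h x = 0" for h :: "real \<Rightarrow> real"
  proof (rule Bochner_Integration.integral_cong[OF refl])
    fix x show "indicator I x * h x = indicator {-b..b} x * h x"
      using that[of x] KI b(2) by (cases "x \<in> K") (auto simp: indicator_def)
  qed
  have "(\<integral>x. indicator {-b..b} x * (f x * \<phi>' x + f' x * \<phi> x) \<partial>lborel) = f b * \<phi> b - f (-b) * \<phi> (-b)"
    using b(1) by (intro FTC_Icc[where F="\<lambda>x. f x * \<phi> x"])
      (auto intro!: continuous_intros cont derivative_eq_intros f \<phi>)
  also have "\<dots> = 0" using K(3) b by simp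
  finally have "(\<integral>x. indicator {-b..b} x * (f x * \<phi>' x) \<partial>lborel) +
      (\<integral>x. indicator {-b..b} x * (f' x * \<phi> x) \<partial>lborel) = 0"
    using continuous_integrable_Icc[OF continuous_on_mult[OF cont(1) cont(4)], of "-b" b]
      continuous_integrable_Icc[OF continuous_on_mult[OF cont(3) cont(2)], of "-b" b]
    by (simp add: distrib_left)
  then show "(\<integral>x. f x * deriv \<phi> x \<partial>restrict_space lborel I) =
      - (\<integral>x. f' x * \<phi> x \<partial>restrict_space lborel I)"
    unfolding d restrict_lborel_integral[OF I]
    using eq[of "\<lambda>x. f x * \<phi>' x"] eq[of "\<lambda>x. f' x * \<phi> x"] K(3) \<phi>'0 by simp
qed

lemma weak_derivative_unique_C1:
  assumes ab: "a < b" "{a..b} \<subseteq> I" and I: "I \<in> sets borel"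
    and f: "f \<in> L2 (restrict_space lborel I)" and g: "g \<in> L2 (restrict_space lborel I)"
    and wd: "weak_derivative I f g"
    and f': "\<And>x. (f has_real_derivative f' x) (at x)" "continuous_on UNIV f'"
  shows "AE x in lborel. x \<in> {a..b} \<longrightarrow> g x = f' x"
proof -
  have cont: "continuous_on A f" "continuous_on A f'" for A
    using f' by (meson DERIV_continuous_on has_field_derivative_at_within continuous_on_subset
        subset_UNIV)+
  have ig: "integrable lborel (\<lambda>x. indicator {c..d} x * g x)" if "{c..d} \<subseteq> I" for c d
    using L2_restrict_integrable_mult[OF I g that continuous_on_const[of _ 1]] by simp
  note i' = continuous_integrable_Icc[OF cont(2)]
  have "AE x in lborel. x \<in> {a..b} \<longrightarrow> g x - f' x = 0"
  proof (rule AE_zero_if_integrals_zero)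
    show "integrable lborel (\<lambda>x. indicator {a..b} x * (g x - f' x))"
      using ig[OF ab(2)] i' by (simp add: right_diff_distrib)
    fix c d assume cd: "a \<le> c" "c < d" "d \<le> b"
    then have sub: "{c..d} \<subseteq> I" using ab by auto
    have "(\<integral>x. indicator {c..d} x * (g x * 1) \<partial>lborel) =
        f d * 1 - f c * 1 - (\<integral>x. indicator {c..d} x * (f x * 0) \<partial>lborel)"
      by (rule weak_derivative_by_parts[OF cd(2) sub I f g wd cont(1)]) auto
    moreover have "(\<integral>x. indicator {c..d} x * f' x \<partial>lborel) = f d - f c"
      using cd by (intro FTC_Icc f' cont) auto
    ultimately show "(\<integral>x. indicator {c..d} x * (g x - f' x) \<partial>lborel) = 0"
      using ig[OF sub] i' by (simp add: right_diff_distrib)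
  qed
  then show ?thesis by simp
qed

section \<open>Integration over a metric graph\<close>

context metric_graph
begin

text \<open>The legs are the edges and the rays together.\<close>

definition legs :: "'e set" where "legs = edges G \<union> rays G"

lemma finite_legs [simp]: "finite legs"
  using finite_edges finite_rays by (simp add: legs_def)

lemma edge_interval_borel [measurable]: "edge_interval G e \<in> sets borel"
  by (simp add: edge_interval_def)

abbreviation leg_measure :: "'e \<Rightarrow> real measure" where
  "leg_measure e \<equiv> restrict_space lborel (edge_interval G e)"

abbreviation "total_measure \<equiv> count_space legs \<Otimes>\<^sub>M lborel :: ('e \<times> real) measure"

lemma total_measurable:
  fixes F :: "'e \<times> real \<Rightarrow> real"
  shows "F \<in> borel_measurable total_measure \<longleftrightarrow> (\<forall>e\<in>legs. (\<lambda>x. F (e, x)) \<in> borel_measurable lborel)"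
proof
  assume F: "F \<in> borel_measurable total_measure"
  show "\<forall>e\<in>legs. (\<lambda>x. F (e, x)) \<in> borel_measurable lborel"
    using measurable_Pair2[OF F] by auto
next
  assume "\<forall>e\<in>legs. (\<lambda>x. F (e, x)) \<in> borel_measurable lborel"
  then show "F \<in> borel_measurable total_measure"
    by (intro measurable_pair_measure_countable1) (auto intro: countable_finite)
qed

lemma sigma_sets_measurable: "Sigma legs (edge_interval G) \<in> sets total_measure"
proof -
  have "Sigma legs (edge_interval G) = (\<Union>e\<in>legs. {e} \<times> edge_interval G e)" by auto
  also have "\<dots> \<in> sets total_measure"
    by (intro sets.finite_UN) (auto intro!: pair_measureI)
  finally show ?thesis .
qed

lemma graph_measure_eq: "graph_measure G = restrict_space total_measure (Sigma legs (edge_interval G))"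
  by (simp add: graph_measure_def legs_def)

lemma total_nn_integral:
  assumes "F \<in> borel_measurable total_measure"
  shows "(\<integral>\<^sup>+p. F p \<partial>total_measure) = (\<Sum>e\<in>legs. \<integral>\<^sup>+x. F (e, x) \<partial>lborel)"
  using lborel.nn_integral_fst[OF assms] by (simp add: nn_integral_count_space_finite)

lemma graph_measurable:
  fixes F :: "'e \<times> real \<Rightarrow> real"
  shows "F \<in> borel_measurable (graph_measure G) \<longleftrightarrow> (\<forall>e\<in>legs. (\<lambda>x. F (e, x)) \<in> borel_measurable
      (leg_measure e))"
proof -
  have "F \<in> borel_measurable (graph_measure G) \<longleftrightarrow>
      (\<lambda>p. indicator (Sigma legs (edge_interval G)) p * F p) \<in> borel_measurable total_measure"
    unfolding graph_measure_eq using sigma_sets_measurable sets.sets_into_space[OF sigma_sets_measurable]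
    by (subst borel_measurable_restrict_space_iff) (auto simp: Int_absorb1 Int_absorb2)
  also have "\<dots> \<longleftrightarrow> (\<forall>e\<in>legs. (\<lambda>x. indicator (edge_interval G e) x * F (e, x)) \<in> borel_measurable lborel)"
    unfolding total_measurable by (intro ball_cong refl) (simp add: indicator_def)
  finally show ?thesis by (simp add: restrict_lborel_measurable)
qed

lemma graph_nn_integral:
  assumes "(F :: 'e \<times> real \<Rightarrow> real) \<in> borel_measurable (graph_measure G)"
  shows "(\<integral>\<^sup>+p. ennreal (F p) \<partial>graph_measure G) = (\<Sum>e\<in>legs. \<integral>\<^sup>+x. ennreal (F (e, x)) \<partial>leg_measure e)"
proof -
  have m: "(\<lambda>p. indicator (Sigma legs (edge_interval G)) p * F p) \<in> borel_measurable total_measure"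
    using assms unfolding graph_measure_eq using sigma_sets_measurable
    by (subst (asm) borel_measurable_restrict_space_iff) auto
  have "(\<integral>\<^sup>+p. ennreal (F p) \<partial>graph_measure G) =
      (\<integral>\<^sup>+p. ennreal (F p) * indicator (Sigma legs (edge_interval G)) p \<partial>total_measure)"
    unfolding graph_measure_eq using sigma_sets_measurable by (subst nn_integral_restrict_space) auto
  also have "\<dots> = (\<integral>\<^sup>+p. ennreal (indicator (Sigma legs (edge_interval G)) p * F p) \<partial>total_measure)"
    by (intro nn_integral_cong) (auto simp: indicator_def)
  also have "\<dots> = (\<Sum>e\<in>legs. \<integral>\<^sup>+x. ennreal (indicator (Sigma legs (edge_interval G)) (e, x) * F (e,
      x)) \<partial>lborel)"
    using m by (intro total_nn_integral) auto
  also have "\<dots> = (\<Sum>e\<in>legs. \<integral>\<^sup>+x. ennreal (F (e, x)) \<partial>leg_measure e)"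
    by (intro sum.cong refl, subst nn_integral_restrict_space) (auto intro!: nn_integral_cong simp:
        indicator_def)
  finally show ?thesis .
qed

lemma graph_integrable:
  fixes F :: "'e \<times> real \<Rightarrow> real"
  shows "integrable (graph_measure G) F \<longleftrightarrow> (\<forall>e\<in>legs. integrable (leg_measure e) (\<lambda>x. F (e, x)))"
proof (cases "F \<in> borel_measurable (graph_measure G)")
  case True
  have m: "(\<lambda>p. \<bar>F p\<bar>) \<in> borel_measurable (graph_measure G)" using True by measurable
  show ?thesis
    using True graph_measurable[THEN iffD1, OF True] graph_nn_integral[OF m]
    by (auto simp: integrable_iff_bounded less_top[symmetric])
next
  case False
  then show ?thesis using graph_measurable[of F] by (auto dest: borel_measurable_integrable)
qed

lemma graph_integral:
  fixes F :: "'e \<times> real \<Rightarrow> real"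
  assumes "integrable (graph_measure G) F"
  shows "(\<integral>p. F p \<partial>graph_measure G) = (\<Sum>e\<in>legs. \<integral>x. F (e, x) \<partial>leg_measure e)"
proof -
  note i = graph_integrable[THEN iffD1, OF assms]
  have fin: "(\<integral>\<^sup>+x. ennreal (F (e, x)) \<partial>leg_measure e) < \<infinity>" "(\<integral>\<^sup>+x. ennreal (- F (e, x))
      \<partial>leg_measure e) < \<infinity>"
    if "e \<in> legs" for e
    using i[rule_format, OF that] by (auto simp: real_integrable_def less_top)
  have m: "F \<in> borel_measurable (graph_measure G)" "(\<lambda>p. - F p) \<in> borel_measurable (graph_measure G)"
    using assms by auto
  have "(\<integral>p. F p \<partial>graph_measure G) =
      enn2real (\<Sum>e\<in>legs. \<integral>\<^sup>+x. ennreal (F (e, x)) \<partial>leg_measure e)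
      - enn2real (\<Sum>e\<in>legs. \<integral>\<^sup>+x. ennreal (- F (e, x)) \<partial>leg_measure e)"
    by (simp add: real_lebesgue_integral_def[OF assms] graph_nn_integral[OF m(1)]
        graph_nn_integral[OF m(2)])
  also have "\<dots> = (\<Sum>e\<in>legs. enn2real (\<integral>\<^sup>+x. ennreal (F (e, x)) \<partial>leg_measure e))
      - (\<Sum>e\<in>legs. enn2real (\<integral>\<^sup>+x. ennreal (- F (e, x)) \<partial>leg_measure e))"
    using fin by (simp add: enn2real_sum)
  also have "\<dots> = (\<Sum>e\<in>legs. \<integral>x. F (e, x) \<partial>leg_measure e)"
    using i by (simp add: real_lebesgue_integral_def sum_subtractf)
  finally show ?thesis .
qed

lemma graph_AE:
  assumes "\<And>e. e \<in> legs \<Longrightarrow> AE x in leg_measure e. Q (e, x)"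
  shows "AE p in graph_measure G. Q p"
proof -
  have "\<forall>e\<in>legs. \<exists>N. N \<in> null_sets lborel \<and> {x \<in> edge_interval G e. \<not> Q (e, x)} \<subseteq> N"
  proof
    fix e assume "e \<in> legs"
    then have "AE x in lborel. x \<in> edge_interval G e \<longrightarrow> Q (e, x)"
      using assms by (simp add: restrict_lborel_AE)
    then show "\<exists>N. N \<in> null_sets lborel \<and> {x \<in> edge_interval G e. \<not> Q (e, x)} \<subseteq> N"
      by (auto simp: eventually_ae_filter)
  qed
  then obtain N where N: "\<And>e. e \<in> legs \<Longrightarrow> N e \<in> null_sets lborel"
    "\<And>e. e \<in> legs \<Longrightarrow> {x \<in> edge_interval G e. \<not> Q (e, x)} \<subseteq> N e" by metis
  define Z where "Z = Sigma legs N"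
  have Zs: "Z \<in> sets total_measure"
  proof -
    have "Z = (\<Union>e\<in>legs. {e} \<times> N e)" by (auto simp: Z_def)
    also have "\<dots> \<in> sets total_measure"
      by (intro sets.finite_UN) (use N(1) in \<open>auto intro!: pair_measureI\<close>)
    finally show ?thesis .
  qed
  have "emeasure total_measure Z = (\<integral>\<^sup>+p. indicator Z p \<partial>total_measure)" using Zs by simp
  also have "\<dots> = (\<Sum>e\<in>legs. \<integral>\<^sup>+x. indicator Z (e, x) \<partial>lborel)" using Zs by (intro total_nn_integral) simp
  also have "\<dots> = (\<Sum>e\<in>legs. \<integral>\<^sup>+x. indicator (N e) x \<partial>lborel)"
    by (intro sum.cong refl nn_integral_cong) (auto simp: Z_def indicator_def)
  also have "\<dots> = 0" using N(1) by (auto intro!: sum.neutral simp: null_sets_def)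
  finally have "Z \<in> null_sets total_measure" using Zs by (simp add: null_sets_def)
  then have "AE p in total_measure. p \<notin> Z" by (rule AE_not_in)
  then have "AE p in total_measure. p \<in> Sigma legs (edge_interval G) \<longrightarrow> Q p"
    by eventually_elim (use N(2) in \<open>auto simp: Z_def\<close>)
  then show ?thesis
    unfolding graph_measure_eq using sigma_sets_measurable by (subst AE_restrict_space_iff) auto
qed

lemma graph_AE_leg:
  assumes Q: "AE p in graph_measure G. Q p" and e: "e \<in> legs"
  shows "AE x in leg_measure e. Q (e, x)"
proof -
  have pair: "pair_sigma_finite (count_space legs) (lborel :: real measure)"
    by (intro pair_sigma_finite.intro sigma_finite_measure_count_space_finite
        lborel.sigma_finite_measure_axioms) simp
  have "AE p in total_measure. p \<in> Sigma legs (edge_interval G) \<longrightarrow> Q p"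
    using Q unfolding graph_measure_eq using sigma_sets_measurable
        by (subst (asm) AE_restrict_space_iff) auto
  from pair_sigma_finite.AE_pair[OF pair this]
  have "AE x in lborel. (e, x) \<in> Sigma legs (edge_interval G) \<longrightarrow> Q (e, x)"
    using e by (simp add: AE_count_space)
  then show ?thesis using e by (simp add: restrict_lborel_AE)
qed

lemma graph_L2:
  "F \<in> L2 (graph_measure G) \<longleftrightarrow> (\<forall>e\<in>legs. (\<lambda>x. F (e, x)) \<in> L2 (leg_measure e))"
  by (auto simp: L2_def graph_measurable graph_integrable)

end

section \<open>Functions on the star around a vertex\<close>

text \<open>For the legs at a vertex \<open>v\<close> with \<open>r\<close> smaller than all edge lengths, a function on the graph
  is described by its profiles \<open>U e\<close> as functions of the distance to \<open>v\<close>, provided that they vanish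
  at distance \<open>r\<close> and beyond.\<close>

locale metric_star = metric_graph G for G :: "('v, 'e) mgraph" +
  fixes v :: 'v and r :: real
  assumes r_pos: "0 < r" and r_less: "e \<in> edges G \<Longrightarrow> r < len G e"
begin

text \<open>The legs at \<open>v\<close>. On such a leg, \<open>loc e\<close> is the distance to \<open>v\<close> as a function of the coordinate,
  and \<open>orient e\<close> is its derivative. As there are no tadpoles, only one end of \<open>e\<close> is \<open>v\<close>.\<close>

definition incident :: "'e set" where
  "incident = {e \<in> edges G. tail G e = v \<or> head G e = v} \<union> {e \<in> rays G. tail G e = v}"

definition loc :: "'e \<Rightarrow> real \<Rightarrow> real" where
  "loc e x = (if tail G e = v then x else len G e - x)"

definition orient :: "'e \<Rightarrow> real" where
  "orient e = (if tail G e = v then 1 else - 1)"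

text \<open>The function with profiles \<open>U\<close>; it is zero on legs that do not meet \<open>v\<close>.\<close>

definition star :: "('e \<Rightarrow> real \<Rightarrow> real) \<Rightarrow> 'e \<times> real \<Rightarrow> real" where
  "star U = (\<lambda>(e, x). if e \<in> incident then U e (loc e x) else 0)"

lemma incident_legs: "incident \<subseteq> legs"
  by (auto simp: incident_def legs_def)

lemma finite_incident [simp]: "finite incident"
  using incident_legs finite_legs by (rule finite_subset)

lemma card_incident: "card incident = degree G v"
  unfolding incident_def degree_def using finite_edges finite_rays edges_rays_disjoint
  by (intro card_Un_disjoint) auto

lemma orient_square [simp]: "orient e * orient e = 1" "orient e * (orient e * x) = x"
  by (auto simp: orient_def)

lemma abs_orient [simp]: "\<bar>orient e\<bar> = 1"
  by (auto simp: orient_def)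

lemma star_simps [simp]:
  "e \<in> incident \<Longrightarrow> star U (e, x) = U e (loc e x)"
  "e \<notin> incident \<Longrightarrow> star U (e, x) = 0"
  by (auto simp: star_def)

lemma DERIV_loc: "(loc e has_real_derivative orient e) (at x)"
  unfolding loc_def[abs_def] orient_def by (auto intro!: derivative_eq_intros)

lemma DERIV_loc_compose:
  assumes "\<And>x. (h has_real_derivative h' x) (at x)"
  shows "((\<lambda>x. h (loc e x)) has_real_derivative orient e * h' (loc e x)) (at x)"
  using DERIV_chain2[OF assms DERIV_loc] by (simp add: mult.commute)

lemma continuous_loc [continuous_intros]: "continuous_on A (loc e)"
  by (meson DERIV_continuous_on DERIV_loc has_field_derivative_at_within)

lemma continuous_loc_compose:
  "continuous_on UNIV h \<Longrightarrow> continuous_on A (\<lambda>x. h (loc e x))"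
  by (rule continuous_on_compose2[OF _ continuous_loc]) auto

lemma not_tail_imp_edge: "e \<in> incident \<Longrightarrow> tail G e \<noteq> v \<Longrightarrow> e \<in> edges G \<and> head G e = v"
  by (auto simp: incident_def)

lemma loc_integral:
  fixes h :: "real \<Rightarrow> real"
  assumes e: "e \<in> incident"
  shows "(\<integral>x. indicator (edge_interval G e) x * h (loc e x) \<partial>lborel) =
      (\<integral>x. indicator (edge_interval G e) x * h x \<partial>lborel)"
proof (cases "tail G e = v")
  case False
  then have E: "edge_interval G e = {0..len G e}" using not_tail_imp_edge[OF e]
      by (simp add: edge_interval_def)
  have "(\<integral>x. indicator {0..len G e} x * h x \<partial>lborel) =
     (\<integral>x. indicator {0..len G e} (len G e + (-1) * x) * h (len G e + (-1) * x) \<partial>lborel)"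
    by (subst lborel_integral_real_affine[of "-1" _ "len G e"]) auto
  also have "\<dots> = (\<integral>x. indicator {0..len G e} x * h (loc e x) \<partial>lborel)"
    using False by (intro Bochner_Integration.integral_cong) (auto simp: loc_def indicator_def)
  finally show ?thesis by (simp add: E)
qed (simp add: loc_def)

lemma interval_r: "{0..r} \<subseteq> edge_interval G e"
  using r_less[of e] by (auto simp: edge_interval_def)

lemma loc_integral_r:
  fixes h :: "real \<Rightarrow> real"
  assumes e: "e \<in> incident" and h: "\<And>s. r \<le> s \<Longrightarrow> h s = 0"
  shows "(\<integral>x. indicator (edge_interval G e) x * h (loc e x) \<partial>lborel) =
      (\<integral>s. indicator {0..r} s * h s \<partial>lborel)"
  unfolding loc_integral[OF e]
proof (rule Bochner_Integration.integral_cong[OF refl])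
  fix s show "indicator (edge_interval G e) s * h s = indicator {0..r} s * h s"
    using interval_r[of e] h[of s] by (cases "s \<le>
        r") (auto simp: indicator_def edge_interval_def split: if_splits)
qed

text \<open>The compact initial segment \<open>{0..reach e}\<close> of the coordinate interval contains all points where
  profiles do not vanish; its ends are boundary points of the leg, or a point where they vanish.\<close>

definition reach :: "'e \<Rightarrow> real" where
  "reach e = (if e \<in> edges G then len G e else r)"

lemma reach: "0 < reach e" "{0..reach e} \<subseteq> edge_interval G e" "r \<le> reach e"
  using r_pos r_less[of e] by (auto simp: reach_def edge_interval_def)

lemma beyond_reach:
  assumes "e \<in> incident" "x \<in> edge_interval G e" "x \<notin> {0..reach e}"
  shows "r \<le> loc e x"
  using assms r_pos by (auto simp: incident_def loc_def reach_def edge_interval_def split: if_splits)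

lemma profile_indicator:
  assumes e: "e \<in> incident" and h: "\<And>s. r \<le> s \<Longrightarrow> h s = (0::real)"
  shows "indicator (edge_interval G e) x * (h (loc e x) * k x) =
      indicator {0..reach e} x * (h (loc e x) * (k x :: real))"
  using reach(2)[of e] beyond_reach[OF e, of x] h[of "loc e x"]
      by (cases "x \<in> {0..reach e}") (auto simp: indicator_def)

lemma star_leg_L2:
  assumes cont: "\<And>e. e \<in> incident \<Longrightarrow> continuous_on UNIV (U e)"
    and van: "\<And>e s. e \<in> incident \<Longrightarrow> r \<le> s \<Longrightarrow> U e s = 0"
  shows "(\<lambda>x. star U (e, x)) \<in> L2 (leg_measure e)"
proof (cases "e \<in> incident")
  case True
  have "(\<lambda>x. indicator (edge_interval G e) x * U e (loc e x)) =
      (\<lambda>x. indicator {0..reach e} x * U e (loc e x))"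
    using profile_indicator[OF True, where h="U e" and k="\<lambda>_. 1"] van[OF True] by auto
  moreover have "(\<lambda>x. indicator (edge_interval G e) x * (U e (loc e x))\<^sup>2) =
      (\<lambda>x. indicator {0..reach e} x * (U e (loc e x))\<^sup>2)"
    using profile_indicator[OF True, where h="U e" and k="\<lambda>x. U e (loc e x)"] van[OF True]
    by (auto simp: power2_eq_square)
  moreover have "integrable lborel (\<lambda>x. indicator {0..reach e} x * U e (loc e x))"
    by (intro continuous_integrable_Icc continuous_loc_compose cont True)
  moreover have "integrable lborel (\<lambda>x. indicator {0..reach e} x * (U e (loc e x))\<^sup>2)"
    by (intro continuous_integrable_Icc continuous_intros continuous_loc_compose cont True)
  ultimately show ?thesis
    using True by (auto simp: L2_def restrict_lborel_measurable restrict_lborel_integrable)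
qed (auto simp: L2_def)

lemma star_L2:
  assumes "\<And>e. e \<in> incident \<Longrightarrow> continuous_on UNIV (U e)"
    and "\<And>e s. e \<in> incident \<Longrightarrow> r \<le> s \<Longrightarrow> U e s = 0"
  shows "star U \<in> L2 (graph_measure G)"
  unfolding graph_L2 using star_leg_L2[OF assms] by auto

lemma star_pairing:
  assumes U: "star U \<in> L2 (graph_measure G)" and w: "w \<in> L2 (graph_measure G)"
  shows "(\<integral>p. star U p * w p \<partial>graph_measure G) =
      (\<Sum>e\<in>incident. \<integral>x. U e (loc e x) * w (e, x) \<partial>leg_measure e)"
proof -
  have "(\<integral>p. star U p * w p \<partial>graph_measure G) = (\<Sum>e\<in>legs. \<integral>x. star U (e, x) * w (e, x) \<partial>leg_measure e)"
    by (rule graph_integral[OF L2_integrable_mult[OF U w]])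
  also have "\<dots> = (\<Sum>e\<in>incident. \<integral>x. star U (e, x) * w (e, x) \<partial>leg_measure e)"
    using incident_legs by (intro sum.mono_neutral_right) auto
  finally show ?thesis by simp
qed

lemma star_star_pairing:
  assumes U: "star U \<in> L2 (graph_measure G)" and V: "star V \<in> L2 (graph_measure G)"
    and van: "\<And>e s. e \<in> incident \<Longrightarrow> r \<le> s \<Longrightarrow> U e s = 0"
  shows "(\<integral>p. star U p * star V p \<partial>graph_measure G) =
      (\<Sum>e\<in>incident. \<integral>s. indicator {0..r} s * (U e s * V e s) \<partial>lborel)"
  unfolding star_pairing[OF U V]
proof (rule sum.cong[OF refl])
  fix e assume e: "e \<in> incident"
  show "(\<integral>x. U e (loc e x) * star V (e, x) \<partial>leg_measure e) =
      (\<integral>s. indicator {0..r} s * (U e s * V e s) \<partial>lborel)"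
    using loc_integral_r[OF e, of "\<lambda>s. U e s * V e s"] van[OF e] e
        by (simp add: restrict_lborel_integral)
qed

lemma star_norm_le:
  assumes cont: "\<And>e. e \<in> incident \<Longrightarrow> continuous_on UNIV (U e)"
    and van: "\<And>e s. e \<in> incident \<Longrightarrow> r \<le> s \<Longrightarrow> U e s = 0"
    and le: "\<And>e s. e \<in> incident \<Longrightarrow> 0 \<le> s \<Longrightarrow> s \<le> r \<Longrightarrow> \<bar>U e s\<bar> \<le> m" and m: "0 \<le> m"
  shows "L2_norm (graph_measure G) (star U) \<le> m * sqrt (real (degree G v) * r)"
proof -
  note U = star_L2[OF cont van]
  have "(L2_norm (graph_measure G) (star U))\<^sup>2 =
      (\<Sum>e\<in>incident. \<integral>s. indicator {0..r} s * (U e s * U e s) \<partial>lborel)"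
    using star_star_pairing[OF U U van] unfolding L2_norm_square by (simp add: power2_eq_square)
  also have "\<dots> \<le> (\<Sum>e\<in>incident. m\<^sup>2 * r)"
  proof (rule sum_mono)
    fix e assume e: "e \<in> incident"
    have "(\<integral>s. indicator {0..r} s * (U e s * U e s) \<partial>lborel) \<le> (\<integral>s. indicator {0..r} s * m\<^sup>2 \<partial>lborel)"
    proof (rule integral_mono)
      show "integrable lborel (\<lambda>s. indicator {0..r} s * (U e s * U e s))"
        by (intro continuous_integrable_Icc continuous_intros continuous_on_subset[OF cont[OF e]]) auto
      fix s show "indicator {0..r} s * (U e s * U e s) \<le> indicator {0..r} s * m\<^sup>2"
        using power_mono[OF le[OF e, of s], of 2] by (auto simp: indicator_def power2_eq_square)
    qed (intro continuous_integrable_Icc continuous_intros)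
    then show "(\<integral>s. indicator {0..r} s * (U e s * U e s) \<partial>lborel) \<le> m\<^sup>2 * r" using r_pos
        by (simp add: mult.commute)
  qed
  also have "\<dots> = (m * sqrt (real (degree G v) * r))\<^sup>2"
    using r_pos by (simp add: card_incident power_mult_distrib)
  finally show ?thesis by (rule power2_le_imp_le) (use m r_pos in auto)
qed

lemma star_leg_deriv:
  assumes U: "\<And>e s. e \<in> incident \<Longrightarrow> (U e has_real_derivative U1 e s) (at s)"
  shows "((\<lambda>x. star U (e, x)) has_real_derivative orient e * star U1 (e, x)) (at x)"
  using DERIV_loc_compose[OF U] by (cases "e \<in> incident") simp_all

lemma star_weak_derivative:
  assumes U: "\<And>e s. e \<in> incident \<Longrightarrow> (U e has_real_derivative U1 e s) (at s)"
    and cont: "\<And>e. e \<in> incident \<Longrightarrow> continuous_on UNIV (U1 e)"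
  shows "weak_derivative (edge_interval G e) (\<lambda>x. star U (e, x)) (\<lambda>x. orient e * star U1 (e, x))"
proof (rule weak_derivative_C1[OF edge_interval_borel star_leg_deriv[OF U]])
  show "continuous_on UNIV (\<lambda>x. orient e * star U1 (e, x))"
    by (cases "e \<in> incident") (auto intro!: continuous_intros continuous_loc_compose cont)
qed

lemma star_form_domain:
  assumes U: "\<And>e s. e \<in> incident \<Longrightarrow> (U e has_real_derivative U1 e s) (at s)"
    and cont: "\<And>e. e \<in> incident \<Longrightarrow> continuous_on UNIV (U1 e)"
    and van: "\<And>e s. e \<in> incident \<Longrightarrow> r \<le> s \<Longrightarrow> U e s = 0"
    and van1: "\<And>e s. e \<in> incident \<Longrightarrow> r \<le> s \<Longrightarrow> U1 e s = 0"
    and c: "\<And>e. e \<in> incident \<Longrightarrow> U e 0 = c"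
  shows "star U \<in> form_domain G"
proof -
  have contU: "continuous_on UNIV (U e)" if "e \<in> incident" for e
    by (meson DERIV_continuous_on U has_field_derivative_at_within that)
  have "continuous_at_vertices G (star U)"
    unfolding continuous_at_vertices_def
  proof (intro exI conjI ballI)
    fix e assume e: "e \<in> edges G \<union> rays G"
    show "continuous_on (edge_interval G e) (\<lambda>x. star U (e, x))"
      by (cases "e \<in> incident") (auto intro!: continuous_loc_compose contU)
    show "AE x in leg_measure e. star U (e, x) = star U (e, x)" by simp
    show "star U (e, 0) = (if tail G e = v then c else 0)"
    proof (cases "e \<in> incident")
      case True
      then show ?thesis
        using c[OF True] van[OF True, of "len G e"] not_tail_imp_edge[OF True] r_less[of e]
            by (auto simp: loc_def)
    next
      case False
      then show ?thesis using e by (auto simp: incident_def)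
    qed
  next
    fix e assume e: "e \<in> edges G"
    show "star U (e, len G e) = (if head G e = v then c else 0)"
    proof (cases "e \<in> incident")
      case True
      then show ?thesis
        using c[OF True] van[OF True, of "len G e"] not_tail_imp_edge[OF True] r_less[of e]
            no_tadpoles[OF e] e by (auto simp: loc_def)
    next
      case False
      then show ?thesis using e by (auto simp: incident_def)
    qed
  qed
  moreover have "(\<lambda>x. star U (e, x)) \<in> H1 (edge_interval G e)" for e
  proof -
    have "(\<lambda>x. star U (e, x)) \<in> L2 (leg_measure e)" by (rule star_leg_L2[OF contU van])
    moreover have "(\<lambda>x. orient e * star U1 (e, x)) \<in> L2 (leg_measure e)"
      by (rule L2_scale[OF star_leg_L2[OF cont van1]])
    moreover have "weak_derivative (edge_interval G e) (\<lambda>x. star U (e, x)) (\<lambda>x. orient e * star U1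
        (e, x))"
      by (rule star_weak_derivative[OF U cont])
    ultimately show ?thesis unfolding H1_def by blast
  qed
  moreover have "star U \<in> L2 (graph_measure G)" by (rule star_L2[OF contU van])
  ultimately show ?thesis by (auto simp: form_domain_def)
qed

lemma graph_deriv_spec:
  assumes "h \<in> form_domain G" "e \<in> legs"
  shows "(\<lambda>x. graph_deriv G h (e, x)) \<in> L2 (leg_measure e)"
    "weak_derivative (edge_interval G e) (\<lambda>x. h (e, x)) (\<lambda>x. graph_deriv G h (e, x))"
proof -
  have "\<exists>g. g \<in> L2 (leg_measure e) \<and> weak_derivative (edge_interval G e) (\<lambda>y. h (e, y)) g"
    using assms by (auto simp: form_domain_def legs_def H1_def)
  from someI_ex[OF this] show "(\<lambda>x. graph_deriv G h (e, x)) \<in> L2 (leg_measure e)"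
    "weak_derivative (edge_interval G e) (\<lambda>x. h (e, x)) (\<lambda>x. graph_deriv G h (e, x))"
    by (simp_all add: graph_deriv_def)
qed

lemma graph_deriv_L2: "h \<in> form_domain G \<Longrightarrow> graph_deriv G h \<in> L2 (graph_measure G)"
  unfolding graph_L2 using graph_deriv_spec(1) by auto

lemma graph_deriv_star:
  assumes U: "\<And>e s. e \<in> incident \<Longrightarrow> (U e has_real_derivative U1 e s) (at s)"
    and cont: "\<And>e. e \<in> incident \<Longrightarrow> continuous_on UNIV (U1 e)"
    and dom: "star U \<in> form_domain G" and e: "e \<in> legs"
  shows "AE x in leg_measure e. graph_deriv G (star U) (e, x) = orient e * star U1 (e, x)"
proof -
  have L: "(\<lambda>x. star U (e, x)) \<in> L2 (leg_measure e)"
    using dom e by (auto simp: form_domain_def graph_L2)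
  have c: "continuous_on UNIV (\<lambda>x. orient e * star U1 (e, x))"
    by (cases "e \<in> incident") (auto intro!: continuous_intros continuous_loc_compose cont)
  note uniq = weak_derivative_unique_C1[OF _ _ edge_interval_borel L graph_deriv_spec[OF dom e]
      star_leg_deriv[OF U] c]
  \<comment> \<open>Countably many compact intervals exhaust the leg, which matters for rays only.\<close>
  have "AE x in lborel. \<forall>n::nat. x \<in> {0..min (real (Suc n)) (if e \<in> edges G then len G e else real
      (Suc n))} \<longrightarrow>
      graph_deriv G (star U) (e, x) = orient e * star U1 (e, x)"
    unfolding AE_all_countable
    by (intro allI uniq) (use len_pos in \<open>auto simp: edge_interval_def\<close>)
  then have "AE x in lborel. x \<in> edge_interval G e \<longrightarrow> graph_deriv G (star U) (e, x) =
      orient e * star U1 (e, x)"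
  proof eventually_elim
    case (elim x)
    show ?case
    proof
      assume x: "x \<in> edge_interval G e"
      obtain n where "x \<le> real n" using real_arch_simple by blast
      then show "graph_deriv G (star U) (e, x) = orient e * star U1 (e, x)"
        using x elim by (intro elim[rule_format, of n]) (auto simp: edge_interval_def split: if_splits)
    qed
  qed
  then show ?thesis by (simp add: restrict_lborel_AE)
qed

text \<open>A profile of class \<open>C\<^sup>2\<close> that is continuous at \<open>v\<close> and satisfies the Kirchhoff condition there
  belongs to the domain of the Laplacian.\<close>

lemma star_laplacian:
  assumes U: "\<And>e s. e \<in> incident \<Longrightarrow> (U e has_real_derivative U1 e s) (at s)"
    and U1: "\<And>e s. e \<in> incident \<Longrightarrow> (U1 e has_real_derivative U2 e s) (at s)"
    and cont: "\<And>e. e \<in> incident \<Longrightarrow> continuous_on UNIV (U2 e)"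
    and van: "\<And>e s. e \<in> incident \<Longrightarrow> r \<le> s \<Longrightarrow> U e s = 0"
    and van1: "\<And>e s. e \<in> incident \<Longrightarrow> r \<le> s \<Longrightarrow> U1 e s = 0"
    and van2: "\<And>e s. e \<in> incident \<Longrightarrow> r \<le> s \<Longrightarrow> U2 e s = 0"
    and c: "\<And>e. e \<in> incident \<Longrightarrow> U e 0 = c"
    and kirchhoff: "(\<Sum>e\<in>incident. U1 e 0) = 0"
  shows "is_laplacian G (star U) (star U2)"
  unfolding is_laplacian_def
proof (intro conjI ballI)
  have cont1: "continuous_on UNIV (U1 e)" if "e \<in> incident" for e
    by (meson DERIV_continuous_on U1 has_field_derivative_at_within that)
  show dom: "star U \<in> form_domain G" by (rule star_form_domain[OF U cont1 van van1 c])
  show L2U2: "star U2 \<in> L2 (graph_measure G)" by (rule star_L2[OF cont van2])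
  fix h assume h: "h \<in> form_domain G"
  then have hL: "h \<in> L2 (graph_measure G)" by (simp add: form_domain_def)
  obtain F cv where F: "\<And>e. e \<in> legs \<Longrightarrow> continuous_on (edge_interval G e) (F e)"
    "\<And>e. e \<in> legs \<Longrightarrow> AE x in leg_measure e. h (e, x) = F e x"
    "\<And>e. e \<in> legs \<Longrightarrow> F e 0 = cv (tail G e)" "\<And>e. e \<in> edges G \<Longrightarrow> F e (len G e) = cv (head G e)"
    using h unfolding form_domain_def continuous_at_vertices_def legs_def by blast
  let ?D = "\<lambda>e x. graph_deriv G h (e, x)"
  have leg: "(\<integral>x. graph_deriv G (star U) (e, x) * ?D e x \<partial>leg_measure e) =
      - (\<integral>x. U2 e (loc e x) * h (e, x) \<partial>leg_measure e) - cv v * U1 e 0" if e: "e \<in> incident" for e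
  proof -
    have eL: "e \<in> legs" using e incident_legs by auto
    let ?\<phi> = "\<lambda>x. orient e * U1 e (loc e x)" and ?\<phi>' = "\<lambda>x. U2 e (loc e x)"
    have \<phi>: "(?\<phi> has_real_derivative ?\<phi>' x) (at x)" for x
      using DERIV_cmult[OF DERIV_loc_compose[OF U1[OF e], where e=e], of "orient e"] by simp
    have "AE x in lborel. x \<in> edge_interval G e \<longrightarrow> h (e, x) = F e x"
      using F(2)[OF eL] by (simp add: restrict_lborel_AE)
    then have FAE: "AE x in lborel. x \<in> {0..reach e} \<longrightarrow> h (e, x) = F e x"
      by eventually_elim (use reach(2)[of e] in auto)
    have hLe: "(\<lambda>x. h (e, x)) \<in> L2 (leg_measure e)" using hL eL by (simp add: graph_L2)
    have mD: "(\<lambda>x. ?D e x) \<in> borel_measurable (leg_measure e)"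
      and mU: "(\<lambda>x. graph_deriv G (star U) (e, x)) \<in> borel_measurable (leg_measure e)"
      and ms: "(\<lambda>x. star U1 (e, x)) \<in> borel_measurable (leg_measure e)"
      by (intro L2_D(1) graph_deriv_spec(1) h dom eL star_leg_L2 cont1 van1; assumption)+
    have "(\<integral>x. graph_deriv G (star U) (e, x) * ?D e x \<partial>leg_measure e) =
        (\<integral>x. ?D e x * ?\<phi> x \<partial>leg_measure e)"
    proof (rule integral_cong_AE)
      show "AE x in leg_measure e. graph_deriv G (star U) (e, x) * ?D e x = ?D e x * ?\<phi> x"
      proof -
        have "AE x in leg_measure e. graph_deriv G (star U) (e, x) = orient e * star U1 (e, x)"
          by (rule graph_deriv_star[OF U cont1 dom eL])
        then show ?thesis by eventually_elim (use e in simp)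
      qed
      show "(\<lambda>x. ?D e x * ?\<phi> x) \<in> borel_measurable (leg_measure e)"
        using mD ms e by simp
    qed (use mU mD in simp)
    also have "\<dots> = (\<integral>x. indicator {0..reach e} x * (?D e x * ?\<phi> x) \<partial>lborel)"
      unfolding restrict_lborel_integral[OF edge_interval_borel]
      using profile_indicator[OF e, where h="U1 e" and k="\<lambda>x. orient e * ?D e x"] van1[OF e]
      by (intro Bochner_Integration.integral_cong refl) (simp add: mult_ac)
    also have "\<dots> = F e (reach e) * ?\<phi> (reach e) - F e 0 * ?\<phi> 0 - (\<integral>x. indicator {0..reach e} x * (F
        e x * ?\<phi>' x) \<partial>lborel)"
      by (rule weak_derivative_by_parts[OF reach(1,2) edge_interval_borel hLe graph_deriv_spec[OF h eL]
            continuous_on_subset[OF F(1)[OF eL] reach(2)] FAE \<phi>])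
        (intro continuous_loc_compose cont e)
    also have "(\<integral>x. indicator {0..reach e} x * (F e x * ?\<phi>' x) \<partial>lborel) =
        (\<integral>x. U2 e (loc e x) * h (e, x) \<partial>leg_measure e)"
    proof -
      have eq: "(\<lambda>x. indicator (edge_interval G e) x * (?\<phi>' x * h (e, x))) =
          (\<lambda>x. indicator {0..reach e} x * (h (e, x) * ?\<phi>' x))"
        using profile_indicator[OF e, where h="U2 e" and k="\<lambda>x. h (e, x)"] van2[OF e]
            by (auto simp: mult_ac)
      have c2: "continuous_on A ?\<phi>'" for A by (intro continuous_loc_compose cont e)
      show ?thesis
        unfolding restrict_lborel_integral[OF edge_interval_borel] eq
      proof (rule integral_cong_AE)
        show "(\<lambda>x. indicator {0..reach e} x * (F e x * ?\<phi>' x)) \<in> borel_measurable lborel"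
          using continuous_integrable_Icc[OF continuous_on_mult[OF continuous_on_subset[OF F(1)[OF
              eL] reach(2)] c2]] by simp
        show "(\<lambda>x. indicator {0..reach e} x * (h (e, x) * ?\<phi>' x)) \<in> borel_measurable lborel"
          using L2_restrict_integrable_mult[OF edge_interval_borel hLe reach(2) c2] by simp
        show "AE x in lborel. indicator {0..reach e} x * (F e x * ?\<phi>' x) =
            indicator {0..reach e} x * (h (e, x) * ?\<phi>' x)"
          using FAE by eventually_elim (simp add: indicator_def)
      qed
    qed
    also have "F e (reach e) * ?\<phi> (reach e) - F e 0 * ?\<phi> 0 = - cv v * U1 e 0"
    proof (cases "tail G e = v")
      case True
      then show ?thesis using F(3)[OF eL] van1[OF e reach(3)] by (simp add: loc_def orient_def)
    next
      case False
      then have "e \<in> edges G" "head G e = v" using not_tail_imp_edge[OF e] by auto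
      then show ?thesis using False F(4)[of e] van1[OF e, of "len G e"] r_less[of e]
        by (simp add: loc_def orient_def reach_def)
    qed
    finally show ?thesis by simp
  qed
  have "dirichlet_form G (star U) h =
      (\<Sum>e\<in>legs. \<integral>x. graph_deriv G (star U) (e, x) * ?D e x \<partial>leg_measure e)"
    unfolding dirichlet_form_def carre_du_champ_def
    by (rule graph_integral[OF L2_integrable_mult[OF graph_deriv_L2[OF dom] graph_deriv_L2[OF h]]])
  also have "\<dots> = (\<Sum>e\<in>incident. \<integral>x. graph_deriv G (star U) (e, x) * ?D e x \<partial>leg_measure e)"
  proof (rule sum.mono_neutral_right)
    show "\<forall>e\<in>legs - incident. (\<integral>x. graph_deriv G (star U) (e, x) * ?D e x \<partial>leg_measure e) = 0"
    proof
      fix e assume e: "e \<in> legs - incident"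
      have "AE x in leg_measure e. graph_deriv G (star U) (e, x) = orient e * star U1 (e, x)"
        using e by (intro graph_deriv_star[OF U cont1 dom]) auto
      then have "AE x in leg_measure e. graph_deriv G (star U) (e, x) * ?D e x = 0"
        by eventually_elim (use e in simp)
      then show "(\<integral>x. graph_deriv G (star U) (e, x) * ?D e x \<partial>leg_measure e) = 0"
          by (rule integral_eq_zero_AE)
    qed
  qed (use incident_legs in auto)
  also have "\<dots> = - (\<Sum>e\<in>incident. \<integral>x. U2 e (loc e x) * h (e, x) \<partial>leg_measure e) - cv v *
      (\<Sum>e\<in>incident. U1 e 0)"
    by (simp add: leg sum_subtractf sum_negf sum_distrib_left)
  also have "\<dots> = - (\<integral>p. star U2 p * h p \<partial>graph_measure G)"
    using kirchhoff by (simp add: star_pairing[OF L2U2 hL])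
  finally show "dirichlet_form G (star U) h = - (\<integral>p. h p * star U2 p \<partial>graph_measure G)"
    by (simp add: mult.commute)
qed

end

section \<open>The gradient estimate in tested and Laplace transformed form\<close>

context metric_star
begin

text \<open>The family of profiles that is \<open>V\<close> on the leg \<open>e0\<close> and zero on all others.\<close>

definition on_leg :: "'e \<Rightarrow> (real \<Rightarrow> real) \<Rightarrow> 'e \<Rightarrow> real \<Rightarrow> real" where
  "on_leg e0 V = (\<lambda>e. if e = e0 then V else (\<lambda>_. 0))"

lemma on_leg_same [simp]: "on_leg e V e = V"
  by (simp add: on_leg_def)

lemma on_leg_other [simp]: "e \<noteq> e0 \<Longrightarrow> on_leg e0 V e = (\<lambda>_. 0)"
  by (simp add: on_leg_def)

lemma star_on_leg_L2:
  assumes "continuous_on UNIV V" "\<And>s. r \<le> s \<Longrightarrow> V s = 0"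
  shows "star (on_leg e0 V) \<in> L2 (graph_measure G)"
  by (rule star_L2) (use assms in \<open>auto simp: on_leg_def\<close>)

lemma star_on_leg_pairing:
  assumes e0: "e0 \<in> incident" and V: "continuous_on UNIV V" "\<And>s. r \<le> s \<Longrightarrow> V s = 0"
    and w: "w \<in> L2 (graph_measure G)"
  shows "(\<integral>p. star (on_leg e0 V) p * w p \<partial>graph_measure G) =
      (\<integral>x. V (loc e0 x) * w (e0, x) \<partial>leg_measure e0)"
proof -
  have L: "star (on_leg e0 V) \<in> L2 (graph_measure G)" by (rule star_on_leg_L2[OF V])
  have "(\<integral>p. star (on_leg e0 V) p * w p \<partial>graph_measure G) =
      (\<Sum>e\<in>incident. \<integral>x. on_leg e0 V e (loc e x) * w (e, x) \<partial>leg_measure e)"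
    by (rule star_pairing[OF L w])
  also have "\<dots> = (\<Sum>e\<in>incident. if e = e0 then \<integral>x. V (loc e0 x) * w (e0, x) \<partial>leg_measure e0 else 0)"
    by (intro sum.cong refl) auto
  finally show ?thesis using e0 by simp
qed

lemma loc_test_function:
  assumes e0: "e0 \<in> incident" and \<psi>: "\<And>s. (\<psi> has_real_derivative \<psi>' s) (at s)" "continuous_on UNIV \<psi>'"
    and supp: "0 < \<alpha>" "\<beta> < r" "\<And>s. s \<notin> {\<alpha>..\<beta>} \<Longrightarrow> \<psi> s = 0"
  shows "(\<lambda>x. \<psi> (loc e0 x)) \<in> test_functions (edge_interval G e0)"
proof (cases "tail G e0 = v")
  case True
  show ?thesis
  proof (rule test_functionsI[OF DERIV_loc_compose[OF \<psi>(1)]])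
    show "continuous_on UNIV (\<lambda>x. orient e0 * \<psi>' (loc e0 x))"
      by (intro continuous_intros continuous_loc_compose \<psi>)
    have "{\<alpha>..\<beta>} \<subseteq> {0<..<r}" using supp by auto
    also have "\<dots> \<subseteq> interior (edge_interval G e0)"
      using interval_r[of e0] by (intro interior_maximal) auto
    finally show "{\<alpha>..\<beta>} \<subseteq> interior (edge_interval G e0)" .
  qed (use True supp(3) in \<open>auto simp: loc_def\<close>)
next
  case False
  then have e: "e0 \<in> edges G" using not_tail_imp_edge[OF e0] by auto
  show ?thesis
  proof (rule test_functionsI[OF DERIV_loc_compose[OF \<psi>(1)]])
    show "continuous_on UNIV (\<lambda>x. orient e0 * \<psi>' (loc e0 x))"
      by (intro continuous_intros continuous_loc_compose \<psi>)
    show "{len G e0 - \<beta>..len G e0 - \<alpha>} \<subseteq> interior (edge_interval G e0)"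
      using e supp r_less[OF e] by (auto simp: edge_interval_def interior_atLeastAtMost_real)
  qed (use False supp(3) in \<open>auto simp: loc_def\<close>)
qed

text \<open>The gradient estimate for a function \<open>f\<close> supported on one leg, tested against a
  nonnegative function \<open>\<psi>\<close> on the same leg. The derivative of \<open>P t f\<close> has been moved to \<open>\<psi>\<close>.\<close>

lemma tested_gradient_estimate:
  fixes P :: "real \<Rightarrow> ('e \<times> real \<Rightarrow> real) \<Rightarrow> 'e \<times> real \<Rightarrow> real"
  assumes heat: "heat_semigroup G P" and grad: "gradient_estimate G P \<tau> C"
    and t: "0 \<le> t" "t \<le> \<tau>" and e0: "e0 \<in> incident"
    and f: "\<And>s. (f has_real_derivative f' s) (at s)" "continuous_on UNIV f'"
    and van: "\<And>s. r \<le> s \<Longrightarrow> f' s = 0"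
    and lap: "is_laplacian G (star (on_leg e0 f)) w"
    and \<psi>: "\<And>s. (\<psi> has_real_derivative \<psi>' s) (at s)" "continuous_on UNIV \<psi>'"
    and \<psi>0: "\<And>s. 0 \<le> \<psi> s"
    and supp: "0 < \<alpha>" "\<beta> < r" "\<And>s. s \<notin> {\<alpha>..\<beta>} \<Longrightarrow> \<psi> s = 0" "\<And>s. s \<notin> {\<alpha>..\<beta>} \<Longrightarrow> \<psi>' s = 0"
  shows "- (\<integral>p. star (on_leg e0 \<psi>') p * P t (star (on_leg e0 f)) p \<partial>graph_measure G) \<le>
    C * (\<integral>p. star (on_leg e0 \<psi>) p * P t (star (on_leg e0 (\<lambda>s. \<bar>f' s\<bar>))) p \<partial>graph_measure G)"
proof -
  interpret L2_semigroup "graph_measure G" P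
    using heat by unfold_locales (simp add: heat_semigroup_def)
  let ?M = "graph_measure G" and ?f = "star (on_leg e0 f)" and ?g = "star (on_leg e0 (\<lambda>s. \<bar>f' s\<bar>))"
  have e0L: "e0 \<in> legs" using e0 incident_legs by auto
  have gen: "infinitesimal_generator ?M P ?f w" using heat lap by (simp add: heat_semigroup_def)
  have fdom: "?f \<in> form_domain G" using lap by (simp add: is_laplacian_def)
  have hdom: "P t ?f \<in> form_domain G"
    using generator_P[OF t(1) gen] heat by (auto simp: heat_semigroup_def is_laplacian_def)
  have hL: "P t ?f \<in> L2 ?M" using hdom by (simp add: form_domain_def)
  have gL: "?g \<in> L2 ?M" by (rule star_on_leg_L2) (use f van in \<open>auto intro!: continuous_intros\<close>)
  have c\<psi>: "continuous_on UNIV \<psi>" by (meson DERIV_continuous_on \<psi>(1) has_field_derivative_at_within)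
  have van\<psi>: "\<psi> s = 0" "\<psi>' s = 0" if "r \<le> s" for s using supp that by auto
  have dL: "(\<lambda>q. sqrt (Gamma G ?f q)) \<in> L2 ?M"
    using graph_deriv_L2[OF fdom] by (auto simp: L2_def carre_du_champ_def power2_eq_square[symmetric])
  have "AE p in ?M. sqrt (Gamma G ?f p) = ?g p"
  proof (rule graph_AE)
    fix e assume e: "e \<in> legs"
    have "AE x in leg_measure e. graph_deriv G ?f (e, x) = orient e * star (on_leg e0 f') (e, x)"
      by (rule graph_deriv_star[OF _ _ fdom e]) (use f in \<open>auto simp: on_leg_def\<close>)
    then show "AE x in leg_measure e. sqrt (Gamma G ?f (e, x)) = ?g (e, x)"
    proof eventually_elim
      case (elim x)
      then show ?case by (cases "e \<in> incident"; cases "e = e0") (auto simp: carre_du_champ_def abs_mult)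
    qed
  qed
  then have "AE p in ?M. P t (\<lambda>q. sqrt (Gamma G ?f q)) p = P t ?g p"
    by (rule P_cong_AE[OF t(1) dL gL])
  moreover have "AE p in ?M. sqrt (Gamma G (P t ?f) p) \<le> C * P t (\<lambda>q. sqrt (Gamma G ?f q)) p"
    using grad fdom t by (auto simp: gradient_estimate_def)
  ultimately have "AE p in ?M. \<bar>graph_deriv G (P t ?f) p\<bar> \<le> C * P t ?g p"
    by eventually_elim (simp add: carre_du_champ_def)
  from graph_AE_leg[OF this e0L] have est: "AE x in leg_measure e0. \<bar>graph_deriv G (P t ?f) (e0, x)\<bar>
      \<le> C * P t ?g (e0, x)" .
  let ?D = "\<lambda>x. graph_deriv G (P t ?f) (e0, x)" and ?\<phi> = "\<lambda>x. \<psi> (loc e0 x)"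
  have \<phi>L: "?\<phi> \<in> L2 (leg_measure e0)"
    using star_leg_L2[of "on_leg e0 \<psi>" e0] c\<psi> van\<psi> e0 by (auto simp: on_leg_def)
  have DL: "?D \<in> L2 (leg_measure e0)" by (rule graph_deriv_spec(1)[OF hdom e0L])
  have PgL: "P t ?g \<in> L2 ?M" by (rule P_L2[OF t(1) gL])
  have PgLe: "(\<lambda>x. P t ?g (e0, x)) \<in> L2 (leg_measure e0)" using PgL e0L by (simp add: graph_L2)
  note i1 = L2_integrable_mult[OF DL \<phi>L] and i2 = L2_integrable_mult[OF PgLe \<phi>L]
  have dphi: "deriv ?\<phi> = (\<lambda>x. orient e0 * \<psi>' (loc e0 x))"
    using DERIV_loc_compose[OF \<psi>(1)] by (auto intro: DERIV_imp_deriv)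
  have "(\<integral>x. P t ?f (e0, x) * deriv ?\<phi> x \<partial>leg_measure e0) = - (\<integral>x. ?D x * ?\<phi> x \<partial>leg_measure e0)"
    using graph_deriv_spec(2)[OF hdom e0L] loc_test_function[OF e0 \<psi> supp(1-3)]
    unfolding weak_derivative_def by auto
  moreover have "(\<integral>x. P t ?f (e0, x) * deriv ?\<phi> x \<partial>leg_measure e0) =
      orient e0 * (\<integral>x. \<psi>' (loc e0 x) * P t ?f (e0, x) \<partial>leg_measure e0)"
    unfolding dphi integral_mult_right_zero[symmetric]
    by (rule Bochner_Integration.integral_cong) (auto simp: mult_ac)
  moreover have "(\<integral>p. star (on_leg e0 \<psi>') p * P t ?f p \<partial>?M) =
      (\<integral>x. \<psi>' (loc e0 x) * P t ?f (e0, x) \<partial>leg_measure e0)"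
    by (rule star_on_leg_pairing[OF e0 \<psi>(2) van\<psi>(2) hL])
  ultimately have "orient e0 * (\<integral>p. star (on_leg e0 \<psi>') p * P t ?f p \<partial>?M) =
      - (\<integral>x. ?D x * ?\<phi> x \<partial>leg_measure e0)"
    by simp
  from arg_cong[OF this, of "\<lambda>y. - (orient e0 * y)"]
  have "- (\<integral>p. star (on_leg e0 \<psi>') p * P t ?f p \<partial>?M) = orient e0 * (\<integral>x. ?D x * ?\<phi> x \<partial>leg_measure e0)"
    unfolding orient_square by simp
  also have "\<dots> \<le> \<bar>\<integral>x. ?D x * ?\<phi> x \<partial>leg_measure e0\<bar>"
    by (auto simp: orient_def)
  also have "\<dots> \<le> (\<integral>x. C * (P t ?g (e0, x) * ?\<phi> x) \<partial>leg_measure e0)"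
  proof (rule order_trans[OF integral_abs_bound], rule integral_mono_AE)
    show "AE x in leg_measure e0. \<bar>?D x * ?\<phi> x\<bar> \<le> C * (P t ?g (e0, x) * ?\<phi> x)"
      using est
    proof eventually_elim
      case (elim x)
      then have "\<bar>?D x\<bar> * ?\<phi> x \<le> (C * P t ?g (e0, x)) * ?\<phi> x" using \<psi>0 by (intro mult_right_mono) auto
      then show ?case using \<psi>0 by (simp add: abs_mult mult_ac)
    qed
  qed (use i1 i2 in auto)
  also have "\<dots> = C * (\<integral>p. star (on_leg e0 \<psi>) p * P t ?g p \<partial>?M)"
    by (subst star_on_leg_pairing) (use e0 c\<psi> van\<psi>(1) PgL in \<open>auto simp: mult.commute\<close>)
  finally show ?thesis .
qed

end

context metric_graph
begin

text \<open>The tested gradient estimates for \<open>0 \<le> t \<le> \<tau>\<close>, integrated against \<open>e\<^sup>-\<^sup>k\<^sup>t\<close>. Here \<open>u\<close> and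
  \<open>w\<close> solve the resolvent equations with right-hand sides \<open>c * \<psi>\<close> and \<open>c * \<psi>'\<close> up to the errors
  \<open>\<epsilon>\<close> and \<open>\<epsilon>'\<close>.\<close>

lemma laplace_transformed_estimate:
  fixes P :: "real \<Rightarrow> ('e \<times> real \<Rightarrow> real) \<Rightarrow> 'e \<times> real \<Rightarrow> real"
  assumes heat: "heat_semigroup G P" and \<tau>: "0 \<le> \<tau>" and k: "0 \<le> k" and c: "0 < c" and C: "0 \<le> C"
    and K: "\<And>t f. 0 \<le> t \<Longrightarrow> t \<le> \<tau> \<Longrightarrow> f \<in> L2 (graph_measure G) \<Longrightarrow>
      L2_norm (graph_measure G) (P t f) \<le> K * L2_norm (graph_measure G) f"
    and K0: "0 \<le> K"
    and f: "is_laplacian G f f2" and g: "is_laplacian G g g2"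
    and u: "is_laplacian G u u2" and w: "is_laplacian G w w2"
    and \<psi>: "\<psi> \<in> L2 (graph_measure G)" "\<psi>' \<in> L2 (graph_measure G)"
    and \<epsilon>: "\<epsilon> \<in> L2 (graph_measure G)" "\<epsilon>' \<in> L2 (graph_measure G)"
    and res: "\<And>p. k * u p - u2 p = c * \<psi> p + \<epsilon> p" "\<And>p. k * w p - w2 p = c * \<psi>' p + \<epsilon>' p"
    and test: "\<And>t. 0 \<le> t \<Longrightarrow> t \<le> \<tau> \<Longrightarrow>
      - (\<integral>p. \<psi>' p * P t f p \<partial>graph_measure G) \<le> C * (\<integral>p. \<psi> p * P t g p \<partial>graph_measure G)"
  shows "- (\<integral>p. w p * f p \<partial>graph_measure G) \<le> C * (\<integral>p. u p * g p \<partial>graph_measure G)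
    + exp (- k * \<tau>) * K * (L2_norm (graph_measure G) w * L2_norm (graph_measure G) f
        + C * (L2_norm (graph_measure G) u * L2_norm (graph_measure G) g))
    + \<tau> * K * (L2_norm (graph_measure G) \<epsilon>' * L2_norm (graph_measure G) f
        + C * (L2_norm (graph_measure G) \<epsilon> * L2_norm (graph_measure G) g))"
proof -
  interpret L2_semigroup "graph_measure G" P
    using heat by unfold_locales (simp add: heat_semigroup_def)
  let ?M = "graph_measure G" and ?n = "L2_norm (graph_measure G)"
  have L: "f \<in> L2 ?M" "g \<in> L2 ?M" "u \<in> L2 ?M" "w \<in> L2 ?M" "u2 \<in> L2 ?M" "w2 \<in> L2 ?M"
    using f g u w by (auto simp: is_laplacian_def form_domain_def)
  have gen: "infinitesimal_generator ?M P z h \<longleftrightarrow> is_laplacian G z h" for z h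
    using heat by (simp add: heat_semigroup_def)
  have sym: "(\<integral>x. a x * P t h x \<partial>?M) = (\<integral>x. a2 x * P t z x \<partial>?M)"
    if a: "is_laplacian G a a2" and z: "is_laplacian G z h" and t: "0 \<le> t" for a a2 z h t
  proof -
    have Pz: "is_laplacian G (P t z) (P t h)" using generator_P[OF t, of z h] z by (simp add: gen)
    have "dirichlet_form G a (P t z) = dirichlet_form G (P t z) a"
      by (simp add: dirichlet_form_def carre_du_champ_def mult.commute)
    then show ?thesis using a Pz by (simp add: is_laplacian_def mult.commute)
  qed
  have bound: "\<bar>\<integral>p. a p * P t z p \<partial>?M\<bar> \<le> K * (?n a * ?n z)"
    if "a \<in> L2 ?M" "z \<in> L2 ?M" "0 \<le> t" "t \<le> \<tau>" for a z t
  proof -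
    have "\<bar>\<integral>p. a p * P t z p \<partial>?M\<bar> \<le> ?n a * ?n (P t z)" by (intro L2_Cauchy_Schwarz P_L2 that)
    also have "\<dots> \<le> ?n a * (K * ?n z)" by (intro mult_left_mono K that) simp
    finally show ?thesis by (simp add: mult_ac)
  qed
  define E where "E = K * (?n \<epsilon>' * ?n f + C * (?n \<epsilon> * ?n g))"
  have E0: "0 \<le> E" using K0 C by (simp add: E_def)
  have pt: "- (exp (- k * t) * (\<integral>x. (k * w x - w2 x) * P t f x \<partial>?M)) \<le>
      C * (exp (- k * t) * (\<integral>x. (k * u x - u2 x) * P t g x \<partial>?M)) + E" if t: "t \<in> {0..\<tau>}" for t
  proof -
    have t': "0 \<le> t" "t \<le> \<tau>" using t by auto
    have split: "(\<integral>x. (k * a x - a2 x) * P t z x \<partial>?M) = c * (\<integral>x. b x * P t z x \<partial>?M) +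
        (\<integral>x. d x * P t z x \<partial>?M)"
      if "\<And>p. k * a p - a2 p = c * b p + d p" "b \<in> L2 ?M" "d \<in> L2 ?M" "z \<in> L2 ?M" for a a2 b d z
      using L2_integrable_mult[OF that(2) P_L2[OF t'(1) that(4)]] L2_integrable_mult[OF that(3)
          P_L2[OF t'(1) that(4)]]
      by (simp add: that(1) distrib_right mult.assoc)
    have "- (\<integral>x. (k * w x - w2 x) * P t f x \<partial>?M) \<le> c * (- (\<integral>p. \<psi>' p * P t f p \<partial>?M)) + K * (?n \<epsilon>' * ?n f)"
      using bound[OF \<epsilon>(2) L(1) t'] split[OF res(2) \<psi>(2) \<epsilon>(2) L(1)] by simp
    also have "\<dots> \<le> c * (C * (\<integral>p. \<psi> p * P t g p \<partial>?M)) + K * (?n \<epsilon>' * ?n f)"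
      using c by (intro add_right_mono mult_left_mono test t') auto
    also have "\<dots> = C * ((\<integral>x. (k * u x - u2 x) * P t g x \<partial>?M) - (\<integral>p. \<epsilon> p * P t g p \<partial>?M)) +
        K * (?n \<epsilon>' * ?n f)"
      using split[OF res(1) \<psi>(1) \<epsilon>(1) L(2)] by simp
    also have "\<dots> \<le> C * ((\<integral>x. (k * u x - u2 x) * P t g x \<partial>?M) + K * (?n \<epsilon> * ?n g)) + K * (?n \<epsilon>' * ?n f)"
      using bound[OF \<epsilon>(1) L(2) t'] C by (intro add_right_mono mult_left_mono) auto
    also have "\<dots> = C * (\<integral>x. (k * u x - u2 x) * P t g x \<partial>?M) + E"
      by (simp add: E_def algebra_simps)
    finally have "exp (- k * t) * - (\<integral>x. (k * w x - w2 x) * P t f x \<partial>?M) \<le>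
        exp (- k * t) * (C * (\<integral>x. (k * u x - u2 x) * P t g x \<partial>?M) + E)"
      by (rule mult_left_mono) simp
    moreover have "exp (- k * t) * E \<le> 1 * E" using k t' E0 by (intro mult_right_mono) auto
    ultimately show ?thesis by (simp add: algebra_simps)
  qed
  have I1: "((\<lambda>t. exp (- k * t) * (\<integral>x. (k * w x - w2 x) * P t f x \<partial>?M)) has_integral
      (\<integral>x. w x * f x \<partial>?M) - exp (- k * \<tau>) * (\<integral>x. w x * P \<tau> f x \<partial>?M)) {0..\<tau>}"
    by (rule truncated_resolvent[OF L(4,6) _ sym[OF w f] \<tau>]) (use gen f in auto)
  have I2: "((\<lambda>t. exp (- k * t) * (\<integral>x. (k * u x - u2 x) * P t g x \<partial>?M)) has_integral
      (\<integral>x. u x * g x \<partial>?M) - exp (- k * \<tau>) * (\<integral>x. u x * P \<tau> g x \<partial>?M)) {0..\<tau>}"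
    by (rule truncated_resolvent[OF L(3,5) _ sym[OF u g] \<tau>]) (use gen g in auto)
  have I3: "((\<lambda>t. E) has_integral \<tau> * E) {0..\<tau>}" using has_integral_const_real[of E 0 \<tau>] \<tau> by simp
  have "- ((\<integral>x. w x * f x \<partial>?M) - exp (- k * \<tau>) * (\<integral>x. w x * P \<tau> f x \<partial>?M)) \<le>
      C * ((\<integral>x. u x * g x \<partial>?M) - exp (- k * \<tau>) * (\<integral>x. u x * P \<tau> g x \<partial>?M)) + \<tau> * E"
    by (rule has_integral_le[OF has_integral_neg[OF I1] has_integral_add[OF
        has_integral_mult_right[OF I2] I3] pt])
  moreover have "exp (- k * \<tau>) * - (\<integral>x. w x * P \<tau> f x \<partial>?M) \<le> exp (- k * \<tau>) * (K * (?n w * ?n f))"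
    using bound[OF L(4,1) \<tau> order_refl] by (intro mult_left_mono) auto
  moreover have "exp (- k * \<tau>) * (C * - (\<integral>x. u x * P \<tau> g x \<partial>?M)) \<le>
      exp (- k * \<tau>) * (C * (K * (?n u * ?n g)))"
    using bound[OF L(3,2) \<tau> order_refl] C by (intro mult_left_mono) auto
  ultimately show ?thesis by (simp add: E_def algebra_simps)
qed

end

section \<open>Profiles on a half-line\<close>

lemma DERIV_step_scaled:
  "((\<lambda>s. step (m * s - c)) has_real_derivative m * step1 (m * s - c)) (at s)"
  "((\<lambda>s. step1 (m * s - c)) has_real_derivative m * step2 (m * s - c)) (at s)"
  "((\<lambda>s. step2 (m * s - c)) has_real_derivative m * step3 (m * s - c)) (at s)"
proof -
  have d: "((\<lambda>s. m * s - c) has_real_derivative m) (at s)" by (auto intro!: derivative_eq_intros)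
  show "((\<lambda>s. step (m * s - c)) has_real_derivative m * step1 (m * s - c)) (at s)"
    "((\<lambda>s. step1 (m * s - c)) has_real_derivative m * step2 (m * s - c)) (at s)"
    "((\<lambda>s. step2 (m * s - c)) has_real_derivative m * step3 (m * s - c)) (at s)"
    using DERIV_chain2[OF DERIV_step d] DERIV_chain2[OF DERIV_step1 d] DERIV_chain2[OF DERIV_step2 d]
    by (simp_all add: mult.commute)
qed

lemma continuous_step_scaled:
  "continuous_on A (\<lambda>s. step (m * s - c))" "continuous_on A (\<lambda>s. step1 (m * s - c))"
  "continuous_on A (\<lambda>s. step2 (m * s - c))" "continuous_on A (\<lambda>s. step3 (m * s - c))"
  by (rule continuous_on_compose2[OF continuous_on_step[of UNIV]]
        continuous_on_compose2[OF continuous_on_step1[of UNIV]]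
        continuous_on_compose2[OF continuous_on_step2[of UNIV]]
        continuous_on_compose2[OF continuous_on_step3[of UNIV]]; auto intro!: continuous_intros)+

lemma step_derivs_bounded:
  obtains c where "0 < c" "\<And>x. \<bar>step1 x\<bar> \<le> c" "\<And>x. \<bar>step2 x\<bar> \<le> c"
proof -
  have "compact (step1 ` {0..1})" "compact (step2 ` {0..1})"
    by (intro compact_continuous_image continuous_on_step1 continuous_on_step2 compact_Icc)+
  then obtain c1 c2 where c: "\<And>x. x \<in> {0..1} \<Longrightarrow> \<bar>step1 x\<bar> \<le> c1" "0 < c1"
    "\<And>x. x \<in> {0..1} \<Longrightarrow> \<bar>step2 x\<bar> \<le> c2" "0 < c2"
    by (fastforce dest!: compact_imp_bounded simp: bounded_pos)
  have "\<bar>step1 x\<bar> \<le> c1 + c2 \<and> \<bar>step2 x\<bar> \<le> c1 + c2" for x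
  proof (cases "x \<in> {0..1}")
    case True
    then show ?thesis using c(1,3)[OF True] c(2,4) by linarith
  next
    case False
    then show ?thesis using c(2,4) step_derivs_outside[of x] by auto
  qed
  then show ?thesis using c(2,4) by (intro that[of "c1 + c2"]) auto
qed

text \<open>Profiles on a half-line at the two scales \<open>1/k\<^sup>2\<close> and \<open>l\<close>. The bump \<open>psi\<close> of mass one lives on
  \<open>{l..2 * l}\<close>; \<open>lump\<close> and \<open>tail_lump\<close>, also of mass one, live on \<open>{1/k\<^sup>2..2/k\<^sup>2}\<close> and
  \<open>{5 * l..6 * l}\<close>; the cutoff \<open>chi\<close> equals one up to \<open>6 * l\<close> and vanishes from \<open>7 * l\<close> on.\<close>

locale half_line_profiles =
  fixes l k :: real
  assumes l_pos: "0 < l" and k_ge_1: "1 \<le> k" and k_large: "2 / k\<^sup>2 \<le> l"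
begin

lemma k_pos: "0 < k" using k_ge_1 by simp

text \<open>The nonnegative test function, and its derivative.\<close>

definition psi :: "real \<Rightarrow> real" where "psi s = 1/l * step1 (1/l * s - 1)"
definition psi1 :: "real \<Rightarrow> real" where "psi1 s = 1/l * (1/l * step2 (1/l * s - 1))"

lemma DERIV_psi: "(psi has_real_derivative psi1 s) (at s)"
  unfolding psi_def[abs_def] psi1_def by (intro DERIV_cmult DERIV_step_scaled)

lemma continuous_psi: "continuous_on A psi" "continuous_on A psi1"
  unfolding psi_def[abs_def] psi1_def[abs_def] by (intro continuous_intros continuous_step_scaled)+

lemma psi_nonneg: "0 \<le> psi s"
  unfolding psi_def using l_pos step1_nonneg by simp

lemma psi_outside:
  assumes "s \<le> l \<or> 2 * l \<le> s" shows "psi s = 0" "psi1 s = 0"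
proof -
  have "1/l * s - 1 \<le> 0 \<or> 1 \<le> 1/l * s - 1" using assms l_pos by (auto simp: field_simps)
  then show "psi s = 0" "psi1 s = 0" by (auto simp: psi_def psi1_def step_derivs_outside)
qed

text \<open>The antiderivative of \<open>psi\<close>.\<close>

definition psi_step :: "real \<Rightarrow> real" where "psi_step s = step (1/l * s - 1)"

lemma DERIV_psi_step: "(psi_step has_real_derivative psi s) (at s)"
  unfolding psi_step_def[abs_def] psi_def by (rule DERIV_step_scaled)

lemma psi_step_bounds: "0 \<le> psi_step s" "psi_step s \<le> 1"
  by (auto simp: psi_step_def step_nonneg step_le_1)

lemma psi_step_ends: "s \<le> l \<Longrightarrow> psi_step s = 0" "2 * l \<le> s \<Longrightarrow> psi_step s = 1"
proof -
  assume "s \<le> l" then have "1/l * s - 1 \<le> 0" using l_pos by (simp add: field_simps)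
  then show "psi_step s = 0" by (simp add: psi_step_def step_le_0)
next
  assume "2 * l \<le> s" then have "1 \<le> 1/l * s - 1" using l_pos by (simp add: field_simps)
  then show "psi_step s = 1" by (simp add: psi_step_def step_ge_1)
qed

text \<open>The two halves of \<open>\<integral> e\<^sup>-\<^sup>k\<^sup>|\<^sup>s\<^sup>-\<^sup>z\<^sup>| psi z dz\<close>: the integrals of \<open>e\<^sup>k\<^sup>z psi z\<close> up to \<open>s\<close> and of
  \<open>e\<^sup>-\<^sup>k\<^sup>z psi z\<close> from \<open>s\<close> on.\<close>

definition inner_int :: "real \<Rightarrow> real" where
  "inner_int s = (SOME F. \<forall>x. (F has_real_derivative exp (k * x) * psi x) (at x)) s
     - (SOME F. \<forall>x. (F has_real_derivative exp (k * x) * psi x) (at x)) 0"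

definition outer_int :: "real \<Rightarrow> real" where
  "outer_int s = (SOME F. \<forall>x. (F has_real_derivative - (exp (- (k * x)) * psi x)) (at x)) s
     - (SOME F. \<forall>x. (F has_real_derivative - (exp (- (k * x)) * psi x)) (at x)) (2 * l)"

lemma DERIV_inner_int: "(inner_int has_real_derivative exp (k * s) * psi s) (at s)"
proof -
  have "continuous_on UNIV (\<lambda>x. exp (k * x) * psi x)" by (intro continuous_intros continuous_psi)
  from someI_ex[OF exists_antiderivative[OF this]] show ?thesis
    unfolding inner_int_def[abs_def] by (auto intro!: derivative_eq_intros)
qed

lemma DERIV_outer_int: "(outer_int has_real_derivative - (exp (- (k * s)) * psi s)) (at s)"
proof -
  have "continuous_on UNIV (\<lambda>x. - (exp (- (k * x)) * psi x))" by (intro continuous_intros continuous_psi)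
  from someI_ex[OF exists_antiderivative[OF this]] show ?thesis
    unfolding outer_int_def[abs_def] by (auto intro!: derivative_eq_intros)
qed

lemma constant_off_psi:
  assumes F: "\<And>x. (F has_real_derivative h x * psi x) (at x)"
    and st: "s \<le> t" "t \<le> l \<or> 2 * l \<le> s"
  shows "F s = F t"
proof (rule antisym)
  have z: "(F has_real_derivative 0) (at x)" if "s \<le> x" "x \<le> t" for x
    using F[of x] psi_outside[of x] that st by auto
  show "F s \<le> F t" by (rule DERIV_nonneg_imp_nondecreasing[OF st(1)]) (use z in force)
  show "F t \<le> F s" by (rule DERIV_nonpos_imp_nonincreasing[OF st(1)]) (use z in force)
qed

text \<open>The amplitude \<open>\<integral> e\<^sup>-\<^sup>k\<^sup>z psi z dz\<close> of the incoming wave \<open>amp * exp (k * s)\<close> on \<open>s \<le> l\<close>.\<close>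

definition amp :: real where "amp = outer_int l"

lemma inner_int_0: "s \<le> l \<Longrightarrow> inner_int s = 0"
  using constant_off_psi[OF DERIV_inner_int, of s l] constant_off_psi[OF DERIV_inner_int, of 0 l] l_pos
  by (simp add: inner_int_def)

lemma outer_int_0: "2 * l \<le> s \<Longrightarrow> outer_int s = 0"
  using constant_off_psi[of outer_int "\<lambda>x. - exp (- (k * x))", of "2 * l" s] DERIV_outer_int
  by (simp add: outer_int_def)

lemma outer_int_amp: "s \<le> l \<Longrightarrow> outer_int s = amp"
  using constant_off_psi[of outer_int "\<lambda>x. - exp (- (k * x))", of s l] DERIV_outer_int
  by (simp add: amp_def)

lemma inner_int_end: "2 * l \<le> s \<Longrightarrow> inner_int s = inner_int (2 * l)"
  using constant_off_psi[OF DERIV_inner_int, of "2 * l" s] by simp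

lemma inner_int_nonneg: "0 \<le> inner_int s"
proof (cases "s \<le> l")
  case False
  have "inner_int l \<le> inner_int s"
  proof (rule DERIV_nonneg_imp_nondecreasing[where f="inner_int"])
    fix x
    have "0 \<le> exp (k * x) * psi x" using psi_nonneg[of x] by simp
    then show "\<exists>y. (inner_int has_real_derivative y) (at x) \<and> 0 \<le> y" using DERIV_inner_int by blast
  qed (use False in simp)
  then show ?thesis by (simp add: inner_int_0)
qed (simp add: inner_int_0)

lemma outer_int_nonneg: "0 \<le> outer_int s"
proof (cases "2 * l \<le> s")
  case False
  have "outer_int (2 * l) \<le> outer_int s"
  proof (rule DERIV_nonpos_imp_nonincreasing[where f="outer_int"])
    fix x
    have "- (exp (- (k * x)) * psi x) \<le> 0" using psi_nonneg[of x] by simp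
    then show "\<exists>y. (outer_int has_real_derivative y) (at x) \<and> y \<le> 0" using DERIV_outer_int by blast
  qed (use False in simp)
  then show ?thesis by (simp add: outer_int_0)
qed (simp add: outer_int_0)

lemma inner_int_le: "inner_int s \<le> exp (k * s)"
proof (cases "s \<le> l")
  case False
  have "exp (k * l) * psi_step l - inner_int l \<le> exp (k * s) * psi_step s - inner_int s"
  proof (rule DERIV_nonneg_imp_nondecreasing[where f="\<lambda>s. exp (k * s) * psi_step s - inner_int s"])
    fix x
    have "((\<lambda>s. exp (k * s) * psi_step s - inner_int s) has_real_derivative k * exp (k * x) *
        psi_step x) (at x)"
      by (auto intro!: derivative_eq_intros DERIV_psi_step DERIV_inner_int)
    moreover have "0 \<le> k * exp (k * x) * psi_step x" using k_pos psi_step_bounds by simp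
    ultimately show "\<exists>y. ((\<lambda>s. exp (k * s) * psi_step s - inner_int s) has_real_derivative y) (at x)
        \<and> 0 \<le> y" by blast
  qed (use False in simp)
  then have "inner_int s \<le> exp (k * s) * psi_step s" by (simp add: inner_int_0 psi_step_ends)
  also have "\<dots> \<le> exp (k * s) * 1" by (intro mult_left_mono psi_step_bounds) simp
  finally show ?thesis by simp
qed (simp add: inner_int_0)

lemma outer_int_le: "outer_int s \<le> exp (- (k * s))"
proof (cases "2 * l \<le> s")
  case False
  have "exp (- (k * (2 * l))) * (1 - psi_step (2 * l)) - outer_int (2 * l) \<le>
      exp (- (k * s)) * (1 - psi_step s) - outer_int s"
  proof (rule DERIV_nonpos_imp_nonincreasing[where f="\<lambda>s. exp (- (k * s)) * (1 - psi_step s) -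
      outer_int s"])
    fix x
    have "((\<lambda>s. exp (- (k * s)) * (1 - psi_step s) - outer_int s) has_real_derivative - (k * exp (-
        (k * x)) * (1 - psi_step x))) (at x)"
      by (auto intro!: derivative_eq_intros DERIV_psi_step DERIV_outer_int simp: algebra_simps)
    moreover have "- (k * exp (- (k * x)) * (1 - psi_step x)) \<le> 0" using k_pos psi_step_bounds[of x]
        by simp
    ultimately show "\<exists>y. ((\<lambda>s. exp (- (k * s)) * (1 - psi_step s) - outer_int s) has_real_derivative
        y) (at x) \<and> y \<le> 0" by blast
  qed (use False in simp)
  then have "outer_int s \<le> exp (- (k * s)) * (1 - psi_step s)" by (simp add: outer_int_0 psi_step_ends)
  also have "\<dots> \<le> exp (- (k * s)) * 1" using psi_step_bounds[of s] by (intro mult_left_mono) auto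
  finally show ?thesis by simp
qed (simp add: outer_int_0)

lemma amp_ge: "exp (- (2 * k * l)) \<le> amp"
proof -
  have "outer_int (2 * l) + exp (- (2 * k * l)) * psi_step (2 * l) \<le> outer_int l +
      exp (- (2 * k * l)) * psi_step l"
  proof (rule DERIV_nonpos_imp_nonincreasing[where f="\<lambda>s. outer_int s +
      exp (- (2 * k * l)) * psi_step s"])
    fix x assume x: "l \<le> x" "x \<le> 2 * l"
    have "((\<lambda>s. outer_int s + exp (- (2 * k * l)) * psi_step s) has_real_derivative
        (exp (- (2 * k * l)) - exp (- (k * x))) * psi x) (at x)"
      by (auto intro!: derivative_eq_intros DERIV_psi_step DERIV_outer_int simp: algebra_simps)
    moreover have "(exp (- (2 * k * l)) - exp (- (k * x))) * psi x \<le> 0"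
      using x k_pos psi_nonneg by (intro mult_nonpos_nonneg) (auto simp: mult.commute mult.left_commute)
    ultimately show "\<exists>y. ((\<lambda>s. outer_int s +
        exp (- (2 * k * l)) * psi_step s) has_real_derivative y) (at x) \<and> y \<le> 0" by blast
  qed (use l_pos in simp)
  then show ?thesis by (simp add: psi_step_ends outer_int_0 amp_def)
qed

lemma amp_pos: "0 < amp" using amp_ge less_le_trans exp_gt_zero by blast

lemma amp_le_1: "amp \<le> 1"
  using outer_int_le[of 0] l_pos by (simp add: outer_int_amp)

text \<open>The solution \<open>res\<close> of \<open>res'' = k\<^sup>2 res - 2 k psi\<close> on the line that decays at infinity, and its
  derivative.\<close>

definition res :: "real \<Rightarrow> real" where
  "res s = exp (- (k * s)) * inner_int s + exp (k * s) * outer_int s"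

definition res1 :: "real \<Rightarrow> real" where
  "res1 s = k * (exp (k * s) * outer_int s - exp (- (k * s)) * inner_int s)"

lemma DERIV_exp_scaled:
  "((\<lambda>s. exp (- (k * s))) has_real_derivative - k * exp (- (k * s))) (at s)"
  "((\<lambda>s. exp (k * s)) has_real_derivative k * exp (k * s)) (at s)"
  by (auto intro!: derivative_eq_intros)

lemma DERIV_res: "(res has_real_derivative res1 s) (at s)"
  unfolding res_def[abs_def] res1_def
  by (rule DERIV_cong[OF DERIV_add[OF DERIV_mult[OF DERIV_exp_scaled(1) DERIV_inner_int]
        DERIV_mult[OF DERIV_exp_scaled(2) DERIV_outer_int]]])
    (simp add: exp_minus field_simps)

lemma DERIV_res1: "(res1 has_real_derivative k\<^sup>2 * res s - 2 * k * psi s) (at s)"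
  unfolding res_def res1_def[abs_def]
  by (rule DERIV_cong[OF DERIV_cmult[OF DERIV_diff[OF DERIV_mult[OF DERIV_exp_scaled(2) DERIV_outer_int]
        DERIV_mult[OF DERIV_exp_scaled(1) DERIV_inner_int]]]])
    (simp add: exp_minus field_simps power2_eq_square)

lemma res_near: "s \<le> l \<Longrightarrow> res s = amp * exp (k * s)" "s \<le> l \<Longrightarrow> res1 s = k * amp * exp (k * s)"
  by (simp_all add: res_def res1_def inner_int_0 outer_int_amp)

lemma res_parts: "0 \<le> exp (- (k * s)) * inner_int s" "exp (- (k * s)) * inner_int s \<le> 1"
  "0 \<le> exp (k * s) * outer_int s" "exp (k * s) * outer_int s \<le> 1"
  using inner_int_nonneg[of s] outer_int_nonneg[of s]
    mult_left_mono[OF inner_int_le[of s], of "exp (- (k * s))"] mult_left_mono[OF outer_int_le[of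
        s], of "exp (k * s)"]
  by (simp_all flip: exp_add)

lemma res_nonneg: "0 \<le> res s" and res_le: "res s \<le> 2" and res1_le: "\<bar>res1 s\<bar> \<le> 2 * k"
proof -
  show "0 \<le> res s" "res s \<le> 2" using res_parts[of s] by (simp_all add: res_def)
  have "\<bar>exp (k * s) * outer_int s - exp (- (k * s)) * inner_int s\<bar> \<le> 2" using res_parts[of s]
      by linarith
  then have "k * \<bar>exp (k * s) * outer_int s - exp (- (k * s)) * inner_int s\<bar> \<le> k * 2"
    using k_pos by (intro mult_left_mono) auto
  then show "\<bar>res1 s\<bar> \<le> 2 * k" using k_pos by (simp add: res1_def abs_mult)
qed

lemma res_far: assumes "5 * l \<le> s" shows "res s \<le> exp (- (3 * k * l))" "res1 s = - (k * res s)"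
proof -
  have s: "2 * l \<le> s" using assms l_pos by simp
  have "k * (5 * l) \<le> k * s" using assms k_pos by simp
  then have "exp (- (k * s)) \<le> exp (- (k * (5 * l)))" by simp
  moreover have "inner_int s \<le> exp (k * (2 * l))" using inner_int_end[OF s] inner_int_le[of "2 * l"]
      by simp
  ultimately have "exp (- (k * s)) * inner_int s \<le> exp (- (k * (5 * l))) * exp (k * (2 * l))"
    using inner_int_nonneg by (intro mult_mono) auto
  also have "\<dots> = exp (- (3 * k * l))" by (simp flip: exp_add)
  finally show "res s \<le> exp (- (3 * k * l))" using outer_int_0[OF s] by (simp add: res_def)
  show "res1 s = - (k * res s)" using outer_int_0[OF s] by (simp add: res_def res1_def)
qed

text \<open>The cutoff, and its first two derivatives.\<close>

definition chi :: "real \<Rightarrow> real" where "chi s = 1 - step (1/l * s - 6)"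
definition chi1 :: "real \<Rightarrow> real" where "chi1 s = - (1/l * step1 (1/l * s - 6))"
definition chi2 :: "real \<Rightarrow> real" where "chi2 s = - (1/l * (1/l * step2 (1/l * s - 6)))"

lemma DERIV_chi: "(chi has_real_derivative chi1 s) (at s)"
  unfolding chi_def[abs_def] chi1_def using DERIV_step_scaled(1)[of "1/l" 6 s]
  by (auto intro!: derivative_eq_intros)

lemma DERIV_chi1: "(chi1 has_real_derivative chi2 s) (at s)"
  unfolding chi1_def[abs_def] chi2_def by (intro DERIV_minus DERIV_cmult DERIV_step_scaled)

lemma continuous_chi: "continuous_on A chi" "continuous_on A chi1" "continuous_on A chi2"
  unfolding chi_def[abs_def] chi1_def[abs_def] chi2_def[abs_def]
  by (intro continuous_intros continuous_step_scaled)+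

lemma chi_near: assumes "s \<le> 6 * l" shows "chi s = 1" "chi1 s = 0" "chi2 s = 0"
proof -
  have "1/l * s - 6 \<le> 0" using assms l_pos by (simp add: field_simps)
  then show "chi s = 1" "chi1 s = 0" "chi2 s = 0"
    by (auto simp: chi_def chi1_def chi2_def step_le_0 step_derivs_outside)
qed

lemma chi_far: assumes "7 * l \<le> s" shows "chi s = 0" "chi1 s = 0" "chi2 s = 0"
proof -
  have "1 \<le> 1/l * s - 6" using assms l_pos by (simp add: field_simps)
  then show "chi s = 0" "chi1 s = 0" "chi2 s = 0"
    by (auto simp: chi_def chi1_def chi2_def step_ge_1 step_derivs_outside)
qed

lemma chi_bounds: "0 \<le> chi s" "chi s \<le> 1"
  using step_nonneg[of "1/l * s - 6"] step_le_1[of "1/l * s - 6"] by (simp_all add: chi_def)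

text \<open>The function \<open>f\<close> of the gradient estimate has profile \<open>plateau\<close>, with derivative
  \<open>lump - tail_lump\<close>. The lumps are disjoint, so \<open>\<bar>f'\<bar>\<close> is the smooth function
  \<open>lump + tail_lump\<close>.\<close>

definition lump :: "real \<Rightarrow> real" where "lump s = k\<^sup>2 * step1 (k\<^sup>2 * s - 1)"
definition lump1 :: "real \<Rightarrow> real" where "lump1 s = k\<^sup>2 * (k\<^sup>2 * step2 (k\<^sup>2 * s - 1))"
definition lump2 :: "real \<Rightarrow> real" where "lump2 s = k\<^sup>2 * (k\<^sup>2 * (k\<^sup>2 * step3 (k\<^sup>2 * s - 1)))"
definition tail_lump :: "real \<Rightarrow> real" where "tail_lump s = 1/l * step1 (1/l * s - 5)"
definition tail_lump1 :: "real \<Rightarrow> real" where "tail_lump1 s = 1/l * (1/l * step2 (1/l * s - 5))"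
definition tail_lump2 :: "real \<Rightarrow> real" where "tail_lump2 s = 1/l * (1/l * (1/l * step3 (1/l * s - 5)))"
definition plateau :: "real \<Rightarrow> real" where "plateau s = step (k\<^sup>2 * s - 1) - step (1/l * s - 5)"

lemma DERIV_plateau: "(plateau has_real_derivative lump s - tail_lump s) (at s)"
  unfolding plateau_def[abs_def] lump_def tail_lump_def by (intro DERIV_diff DERIV_step_scaled)

lemma DERIV_lump: "(lump has_real_derivative lump1 s) (at s)" "(lump1 has_real_derivative lump2 s)
    (at s)"
  "(tail_lump has_real_derivative tail_lump1 s) (at s)" "(tail_lump1 has_real_derivative tail_lump2
      s) (at s)"
  unfolding lump_def[abs_def] lump1_def[abs_def] lump2_def tail_lump_def[abs_def]
      tail_lump1_def[abs_def] tail_lump2_def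
  by (intro DERIV_cmult DERIV_step_scaled)+

lemma continuous_lump: "continuous_on A lump" "continuous_on A lump1" "continuous_on A lump2"
  "continuous_on A tail_lump" "continuous_on A tail_lump1" "continuous_on A tail_lump2"
      "continuous_on A plateau"
  unfolding lump_def[abs_def] lump1_def[abs_def] lump2_def[abs_def]
    tail_lump_def[abs_def] tail_lump1_def[abs_def] tail_lump2_def[abs_def] plateau_def[abs_def]
  by (intro continuous_intros continuous_step_scaled)+

lemma lump_nonneg: "0 \<le> lump s" "0 \<le> tail_lump s"
  using step1_nonneg l_pos by (simp_all add: lump_def tail_lump_def)

lemma lump_outside:
  assumes "s \<le> 0 \<or> 2 / k\<^sup>2 \<le> s" shows "lump s = 0" "lump1 s = 0" "lump2 s = 0"
proof -
  have k2: "0 < k\<^sup>2" using k_pos by simp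
  have "k\<^sup>2 * s - 1 \<le> 0 \<or> 1 \<le> k\<^sup>2 * s - 1"
  proof (cases "s \<le> 0")
    case True
    then show ?thesis using mult_nonneg_nonpos[of "k\<^sup>2" s] k2 by simp
  next
    case False
    then have "2 \<le> k\<^sup>2 * s" using assms k2 by (simp add: divide_le_eq mult.commute)
    then show ?thesis by simp
  qed
  then show "lump s = 0" "lump1 s = 0" "lump2 s = 0"
    by (auto simp: lump_def lump1_def lump2_def step_derivs_outside)
qed

lemma tail_lump_outside:
  assumes "s \<le> 5 * l \<or> 6 * l \<le> s" shows "tail_lump s = 0" "tail_lump1 s = 0" "tail_lump2 s = 0"
proof -
  have "1/l * s - 5 \<le> 0 \<or> 1 \<le> 1/l * s - 5" using assms l_pos by (auto simp: field_simps)
  then show "tail_lump s = 0" "tail_lump1 s = 0" "tail_lump2 s = 0"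
    by (auto simp: tail_lump_def tail_lump1_def tail_lump2_def step_derivs_outside)
qed

lemma plateau_0: "plateau 0 = 0" by (simp add: plateau_def step_le_0)

lemma k2l: "2 \<le> k\<^sup>2 * l"
  using k_large k_pos by (simp add: divide_le_eq mult.commute)

lemma plateau_far: assumes "6 * l \<le> s" shows "plateau s = 0"
proof -
  have "1 \<le> 1/l * s - 5" using assms l_pos by (simp add: field_simps)
  moreover have "k\<^sup>2 * l \<le> k\<^sup>2 * s" using assms l_pos by (intro mult_left_mono) auto
  then have "1 \<le> k\<^sup>2 * s - 1" using k2l by linarith
  ultimately show ?thesis by (simp add: plateau_def step_ge_1)
qed

lemma plateau_le: "\<bar>plateau s\<bar> \<le> 1"
  using step_nonneg[of "k\<^sup>2 * s - 1"] step_le_1[of "k\<^sup>2 * s - 1"]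
    step_nonneg[of "1/l * s - 5"] step_le_1[of "1/l * s - 5"]
  unfolding plateau_def by linarith

lemma abs_lump_diff: "\<bar>lump s - tail_lump s\<bar> = lump s + tail_lump s"
proof (cases "s \<le> 5 * l")
  case True
  then show ?thesis using lump_nonneg[of s] tail_lump_outside[of s] by simp
next
  case False
  then show ?thesis using lump_nonneg[of s] lump_outside[of s] k_large l_pos by simp
qed

lemma lump_mass:
  "(\<integral>s. indicator {0..7 * l} s * lump s \<partial>lborel) = 1"
  "(\<integral>s. indicator {0..7 * l} s * tail_lump s \<partial>lborel) = 1"
proof -
  have "(\<integral>s. indicator {0..7 * l} s * lump s \<partial>lborel) = step (k\<^sup>2 * (7 * l) - 1) - step (k\<^sup>2 * 0 - 1)"
    unfolding lump_def[abs_def] using l_pos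
    by (intro FTC_Icc[where F="\<lambda>s. step (k\<^sup>2 * s - 1)"] DERIV_step_scaled continuous_intros
        continuous_step_scaled) auto
  then show "(\<integral>s. indicator {0..7 * l} s * lump s \<partial>lborel) = 1"
    using k2l by (simp add: step_le_0 step_ge_1)
  have "(\<integral>s. indicator {0..7 * l} s * tail_lump s \<partial>lborel) =
      step (1/l * (7 * l) - 5) - step (1/l * 0 - 5)"
    unfolding tail_lump_def[abs_def] using l_pos
    by (intro FTC_Icc[where F="\<lambda>s. step (1/l * s - 5)"] DERIV_step_scaled continuous_intros
        continuous_step_scaled) auto
  then show "(\<integral>s. indicator {0..7 * l} s * tail_lump s \<partial>lborel) = 1"
    using l_pos by (simp add: step_le_0 step_ge_1)
qed

end

section \<open>Approximate resolvents on the star\<close>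

locale star_profiles = metric_star G v "7 * l" + half_line_profiles l k
  for G :: "('v, 'e) mgraph" and v :: 'v and l k :: real +
  fixes e0 :: 'e
  assumes e0: "e0 \<in> incident" and degree_ge_2: "2 \<le> degree G v"
begin

text \<open>The transmission coefficient of the vertex.\<close>

definition q :: real where "q = 2 / real (degree G v)"

definition at_e0 :: "'e \<Rightarrow> real" where "at_e0 e = (if e = e0 then 1 else 0)"

text \<open>The outgoing wave, normalized by the incoming amplitude.\<close>

definition decay :: "real \<Rightarrow> real" where "decay s = amp * exp (- (k * s))"

lemma q_bounds: "0 < q" "q \<le> 1"
  using degree_ge_2 by (auto simp: q_def)

lemma at_e0_e0 [simp]: "at_e0 e0 = 1" by (simp add: at_e0_def)

lemma abs_q_minus: "\<bar>q - at_e0 e\<bar> \<le> 1" "\<bar>at_e0 e\<bar> \<le> 1"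
  using q_bounds by (auto simp: at_e0_def)

lemma sum_at_e0: "(\<Sum>e\<in>incident. 2 * at_e0 e - q) = 0"
proof -
  have "(\<Sum>e\<in>incident. at_e0 e) = 1" unfolding at_e0_def using e0 by simp
  moreover have "real (degree G v) * q = 2" using degree_ge_2 by (simp add: q_def)
  ultimately show ?thesis by (simp add: sum_subtractf sum_distrib_left[symmetric] card_incident)
qed

lemma DERIV_decay: "(decay has_real_derivative - k * decay s) (at s)"
  unfolding decay_def[abs_def] using DERIV_cmult[OF DERIV_exp_scaled(1), of amp s] by (simp add: mult_ac)

lemma decay_bounds: "0 < decay s" "0 \<le> s \<Longrightarrow> decay s \<le> 1"
proof -
  show "0 < decay s" using amp_pos by (simp add: decay_def)
  assume "0 \<le> s"
  then have "amp * exp (- (k * s)) \<le> 1 * 1" using amp_le_1 k_pos by (intro mult_mono) auto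
  then show "decay s \<le> 1" by (simp add: decay_def)
qed

lemma decay_far: assumes "5 * l \<le> s" shows "decay s \<le> exp (- (3 * k * l))"
proof -
  have "3 * l \<le> s" using assms l_pos by simp
  then have "k * (3 * l) \<le> k * s" using k_pos by simp
  then have "amp * exp (- (k * s)) \<le> 1 * exp (- (3 * k * l))" using amp_le_1 by (intro mult_mono) auto
  then show ?thesis by (simp add: decay_def)
qed

text \<open>On the star at \<open>v\<close>, the profiles \<open>wave\<close> and \<open>dwave\<close> solve the resolvent equation with
  right-hand sides \<open>2 k psi\<close> and \<open>2 k psi1\<close> on the leg \<open>e0\<close>, together with the vertex conditions.
  The reflected waves \<open>decay\<close> have coefficients \<open>q - 1\<close> on \<open>e0\<close> and \<open>q\<close> elsewhere for \<open>wave\<close>;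
  for \<open>dwave\<close> these are multiplied by \<open>k\<close>.\<close>

definition wave :: "'e \<Rightarrow> real \<Rightarrow> real" where
  "wave e s = at_e0 e * res s + (q - at_e0 e) * decay s"
definition wave1 :: "'e \<Rightarrow> real \<Rightarrow> real" where
  "wave1 e s = at_e0 e * res1 s - k * (q - at_e0 e) * decay s"
definition dwave :: "'e \<Rightarrow> real \<Rightarrow> real" where
  "dwave e s = at_e0 e * res1 s + k * (q - at_e0 e) * decay s"
definition dwave1 :: "'e \<Rightarrow> real \<Rightarrow> real" where
  "dwave1 e s = at_e0 e * (k\<^sup>2 * res s - 2 * k * psi s) - k\<^sup>2 * (q - at_e0 e) * decay s"

lemma DERIV_wave: "(wave e has_real_derivative wave1 e s) (at s)"
  unfolding wave_def[abs_def] wave1_def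
  by (rule DERIV_cong[OF DERIV_add[OF DERIV_cmult[OF DERIV_res] DERIV_cmult[OF DERIV_decay]]]) (simp
      add: algebra_simps)

lemma DERIV_wave1: "(wave1 e has_real_derivative k\<^sup>2 * wave e s - 2 * k * (at_e0 e * psi s)) (at s)"
  unfolding wave_def wave1_def[abs_def]
  by (rule DERIV_cong[OF DERIV_diff[OF DERIV_cmult[OF DERIV_res1] DERIV_cmult[OF DERIV_decay]]])
    (simp add: algebra_simps power2_eq_square)

lemma DERIV_dwave: "(dwave e has_real_derivative dwave1 e s) (at s)"
  unfolding dwave_def[abs_def] dwave1_def
  by (rule DERIV_cong[OF DERIV_add[OF DERIV_cmult[OF DERIV_res1] DERIV_cmult[OF DERIV_decay]]])
    (simp add: algebra_simps power2_eq_square)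

lemma DERIV_dwave1: "(dwave1 e has_real_derivative k\<^sup>2 * dwave e s - 2 * k * (at_e0 e * psi1 s)) (at s)"
  unfolding dwave_def dwave1_def[abs_def]
  by (rule DERIV_cong[OF DERIV_diff[OF DERIV_cmult[OF DERIV_diff[OF DERIV_cmult[OF DERIV_res]
      DERIV_cmult[OF DERIV_psi]]]
        DERIV_cmult[OF DERIV_decay]]])
    (simp add: algebra_simps power2_eq_square)

lemma continuous_profiles: "continuous_on A (wave e)" "continuous_on A (wave1 e)" "continuous_on A
    (dwave e)" "continuous_on A (dwave1 e)"
  by (meson DERIV_continuous_on has_field_derivative_at_within DERIV_wave DERIV_wave1 DERIV_dwave
      DERIV_dwave1)+

lemma vertex_conditions:
  "wave e 0 = q * amp" "wave1 e 0 = k * amp * (2 * at_e0 e - q)"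
  "dwave e 0 = k * q * amp" "dwave1 e 0 = k\<^sup>2 * amp * (2 * at_e0 e - q)"
  using res_near[of 0] psi_outside[of 0] l_pos
  by (simp_all add: wave_def wave1_def dwave_def dwave1_def decay_def algebra_simps)

lemma profile_bounds:
  assumes "0 \<le> s" shows "\<bar>wave e s\<bar> \<le> 3 * k" "\<bar>dwave e s\<bar> \<le> 3 * k"
proof -
  have d: "\<bar>(q - at_e0 e) * decay s\<bar> \<le> 1 * 1"
    unfolding abs_mult using abs_q_minus[of e] decay_bounds[of s] assms by (intro mult_mono) auto
  have "\<bar>at_e0 e * res s\<bar> \<le> 1 * 2"
    unfolding abs_mult using abs_q_minus[of e] res_nonneg[of s] res_le[of s] by (intro mult_mono) auto
  then show "\<bar>wave e s\<bar> \<le> 3 * k" using d k_ge_1 unfolding wave_def by linarith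
  have "\<bar>at_e0 e * res1 s\<bar> \<le> 1 * (2 * k)"
    unfolding abs_mult using abs_q_minus[of e] res1_le[of s] by (intro mult_mono) auto
  moreover have "\<bar>k * ((q - at_e0 e) * decay s)\<bar> \<le> k * 1"
    unfolding abs_mult[of k] using d k_pos by (intro mult_mono) auto
  ultimately show "\<bar>dwave e s\<bar> \<le> 3 * k" unfolding dwave_def mult.assoc by linarith
qed

lemma profile_bounds_far:
  assumes s: "5 * l \<le> s"
  shows "\<bar>wave e s\<bar> \<le> 2 * exp (- (3 * k * l))" "\<bar>wave1 e s\<bar> \<le> 2 * k * exp (- (3 * k * l))"
    "\<bar>dwave e s\<bar> \<le> 2 * k * exp (- (3 * k * l))" "\<bar>dwave1 e s\<bar> \<le> 2 * k\<^sup>2 * exp (- (3 * k * l))"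
proof -
  let ?E = "exp (- (3 * k * l))"
  have d: "\<bar>(q - at_e0 e) * decay s\<bar> \<le> 1 * ?E"
    unfolding abs_mult using abs_q_minus[of e] decay_bounds(1)[of s] decay_far[OF s]
        by (intro mult_mono) auto
  have r: "\<bar>at_e0 e * res s\<bar> \<le> 1 * ?E"
    unfolding abs_mult using abs_q_minus[of e] res_nonneg[of s] res_far[OF s] by (intro mult_mono) auto
  have dr: "\<bar>at_e0 e * res s + (q - at_e0 e) * decay s\<bar> \<le> 2 * ?E" "\<bar>- (at_e0 e * res s) +
      (q - at_e0 e) * decay s\<bar> \<le> 2 * ?E"
    "\<bar>at_e0 e * res s - (q - at_e0 e) * decay s\<bar> \<le> 2 * ?E"
    using d r by linarith+
  show "\<bar>wave e s\<bar> \<le> 2 * ?E" using dr by (simp add: wave_def)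
  have e1: "wave1 e s = - k * (at_e0 e * res s + (q - at_e0 e) * decay s)"
    using res_far(2)[OF s] by (simp add: wave1_def algebra_simps)
  have o: "dwave e s = k * (- (at_e0 e * res s) + (q - at_e0 e) * decay s)"
    using res_far(2)[OF s] by (simp add: dwave_def algebra_simps)
  have o1: "dwave1 e s = k\<^sup>2 * (at_e0 e * res s - (q - at_e0 e) * decay s)"
    using psi_outside[of s] s l_pos by (simp add: dwave1_def algebra_simps)
  have "\<bar>wave1 e s\<bar> \<le> k * (2 * ?E)" unfolding e1 abs_mult using dr k_pos by (intro mult_mono) auto
  then show "\<bar>wave1 e s\<bar> \<le> 2 * k * ?E" by simp
  have "\<bar>dwave e s\<bar> \<le> k * (2 * ?E)" unfolding o abs_mult using dr k_pos by (intro mult_mono) auto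
  then show "\<bar>dwave e s\<bar> \<le> 2 * k * ?E" by simp
  have "\<bar>dwave1 e s\<bar> \<le> k\<^sup>2 * (2 * ?E)" unfolding o1 abs_mult using dr by (intro mult_mono) auto
  then show "\<bar>dwave1 e s\<bar> \<le> 2 * k\<^sup>2 * ?E" by simp
qed

text \<open>Multiplying such a profile by the cutoff \<open>chi\<close> gives a function in the domain of the
  Laplacian, at the price of an error supported where \<open>chi\<close> varies.\<close>

definition cut_error :: "('e \<Rightarrow> real \<Rightarrow> real) \<Rightarrow> ('e \<Rightarrow> real \<Rightarrow> real) \<Rightarrow> 'e \<Rightarrow> real \<Rightarrow> real" where
  "cut_error h h1 e s = - (2 * h1 e s * chi1 s + h e s * chi2 s)"

definition cut_laplacian :: "('e \<Rightarrow> real \<Rightarrow> real) \<Rightarrow> ('e \<Rightarrow> real \<Rightarrow> real) \<Rightarrow> ('e \<Rightarrow> real \<Rightarrow> real) \<Rightarrow> 'e \<Rightarrow>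
    real \<Rightarrow> real" where
  "cut_laplacian h h1 h2 e s = h2 e s * chi s + 2 * h1 e s * chi1 s + h e s * chi2 s"

lemma cut_is_laplacian:
  assumes h: "\<And>e s. (h e has_real_derivative h1 e s) (at s)"
    and h1: "\<And>e s. (h1 e has_real_derivative h2 e s) (at s)"
    and cont: "\<And>e. continuous_on UNIV (h2 e)"
    and c: "\<And>e. h e 0 = c" and kirchhoff: "(\<Sum>e\<in>incident. h1 e 0) = 0"
  shows "is_laplacian G (star (\<lambda>e s. h e s * chi s)) (star (cut_laplacian h h1 h2))"
proof (rule star_laplacian[where ?U1.0 = "\<lambda>e s. h1 e s * chi s + h e s * chi1 s"])
  have ch: "continuous_on UNIV (h e)" "continuous_on UNIV (h1 e)" for e
    by (meson DERIV_continuous_on has_field_derivative_at_within h h1)+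
  show "((\<lambda>s. h e s * chi s) has_real_derivative h1 e s * chi s + h e s * chi1 s) (at s)" for e s
    by (rule DERIV_cong[OF DERIV_mult[OF h DERIV_chi]]) simp
  show "((\<lambda>s. h1 e s * chi s +
      h e s * chi1 s) has_real_derivative cut_laplacian h h1 h2 e s) (at s)" for e s
    unfolding cut_laplacian_def
    by (rule DERIV_cong[OF DERIV_add[OF DERIV_mult[OF h1 DERIV_chi] DERIV_mult[OF h DERIV_chi1]]]) simp
  show "continuous_on UNIV (cut_laplacian h h1 h2 e)" for e
    unfolding cut_laplacian_def[abs_def] by (intro continuous_intros ch cont continuous_chi)
  show "(\<Sum>e\<in>incident. h1 e 0 * chi 0 + h e 0 * chi1 0) = 0"
    using kirchhoff chi_near[of 0] l_pos by simp
  show "h e 0 * chi 0 = c" for e using c chi_near[of 0] l_pos by simp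
qed (simp_all add: chi_far cut_laplacian_def)

lemma cut_resolvent:
  assumes h2: "\<And>e s. h2 e s = k\<^sup>2 * h e s - 2 * k * (at_e0 e * \<rho> s)"
    and \<rho>: "\<And>s. 2 * l \<le> s \<Longrightarrow> \<rho> s = 0"
  shows "k\<^sup>2 * star (\<lambda>e s. h e s * chi s) p - star (cut_laplacian h h1 h2) p =
    2 * k * star (on_leg e0 \<rho>) p + star (cut_error h h1) p"
proof (cases p)
  case (Pair e x)
  have "\<rho> s * chi s = \<rho> s" for s using \<rho>[of s] chi_near[of s] l_pos by (cases "2 * l \<le> s") auto
  then have *: "\<rho> s * (chi s * y) = \<rho> s * y" for s y by (simp flip: mult.assoc)
  show ?thesis unfolding Pair
    by (cases "e \<in> incident"; cases "e = e0")
      (simp_all add: cut_laplacian_def cut_error_def h2 at_e0_def algebra_simps \<open>\<And>s. \<rho> s * chi s =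
          \<rho> s\<close> *)
qed

lemma cut_error_props:
  assumes "continuous_on UNIV (h e)" "continuous_on UNIV (h1 e)"
  shows "continuous_on UNIV (cut_error h h1 e)" "7 * l \<le> s \<Longrightarrow> cut_error h h1 e s = 0"
  unfolding cut_error_def[abs_def] using assms
      by (auto intro!: continuous_intros continuous_chi simp: chi_far)

lemma cut_error_le:
  assumes b: "\<And>s. 6 * l \<le> s \<Longrightarrow> \<bar>h e s\<bar> \<le> b" "\<And>s. 6 * l \<le> s \<Longrightarrow> \<bar>h1 e s\<bar> \<le> b1"
    and c: "\<And>s. \<bar>chi1 s\<bar> \<le> c" "\<And>s. \<bar>chi2 s\<bar> \<le> c"
  shows "\<bar>cut_error h h1 e s\<bar> \<le> (2 * b1 + b) * c"
proof (cases "6 * l \<le> s")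
  case True
  have "\<bar>h1 e s * chi1 s\<bar> \<le> b1 * c" "\<bar>h e s * chi2 s\<bar> \<le> b * c"
    unfolding abs_mult using b[OF True] c by (auto intro!: mult_mono intro: order_trans[OF abs_ge_zero])
  then show ?thesis unfolding cut_error_def by (simp add: algebra_simps)
next
  case False
  have "0 \<le> b" "0 \<le> b1" "0 \<le> c" using b[of "6 * l"] c(1)[of 0] by auto
  then show ?thesis using False chi_near[of s] by (simp add: cut_error_def)
qed

lemma on_leg_laplacian:
  assumes V: "\<And>s. (V has_real_derivative V1 s) (at s)" "\<And>s. (V1 has_real_derivative V2 s) (at s)"
    "continuous_on UNIV V2"
    and van: "\<And>s. s \<le> 0 \<or> 6 * l \<le> s \<Longrightarrow> V s = 0" "\<And>s. s \<le> 0 \<or> 6 * l \<le> s \<Longrightarrow> V1 s = 0"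
      "\<And>s. s \<le> 0 \<or> 6 * l \<le> s \<Longrightarrow> V2 s = 0"
  shows "is_laplacian G (star (on_leg e0 V)) (star (on_leg e0 V2))"
  by (rule star_laplacian[where ?U1.0 = "on_leg e0 V1" and c=0])
    (use V van l_pos in \<open>auto simp: on_leg_def intro!: sum.neutral\<close>)

lemma star_on_leg_star_pairing:
  assumes U: "star U \<in> L2 (graph_measure G)" and V: "continuous_on UNIV V" "\<And>s. 7 * l \<le> s \<Longrightarrow> V s = 0"
  shows "(\<integral>p. star U p * star (on_leg e0 V) p \<partial>graph_measure G) =
      (\<integral>s. indicator {0..7 * l} s * (U e0 s * V s) \<partial>lborel)"
proof -
  have L: "star (on_leg e0 V) \<in> L2 (graph_measure G)" by (rule star_on_leg_L2[OF V])
  have "(\<integral>p. star (on_leg e0 V) p * star U p \<partial>graph_measure G) =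
      (\<Sum>e\<in>incident. \<integral>s. indicator {0..7 * l} s * (on_leg e0 V e s * U e s) \<partial>lborel)"
    by (rule star_star_pairing[OF L U]) (use V in \<open>auto simp: on_leg_def\<close>)
  also have "\<dots> = (\<Sum>e\<in>incident. if e =
      e0 then \<integral>s. indicator {0..7 * l} s * (V s * U e0 s) \<partial>lborel else 0)"
    by (intro sum.cong refl) auto
  finally show ?thesis using e0 by (simp add: mult_ac)
qed

lemma lump_average_le:
  assumes "continuous_on UNIV h"
    and near: "\<And>s. 0 \<le> s \<Longrightarrow> s \<le> 2 / k\<^sup>2 \<Longrightarrow> h s \<le> a" and far: "\<And>s. 5 * l \<le> s \<Longrightarrow> s \<le> 6 * l \<Longrightarrow> h s \<le> b"
  shows "(\<integral>s. indicator {0..7 * l} s * (h s * (lump s + tail_lump s)) \<partial>lborel) \<le> a + b"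
proof -
  note i = continuous_integrable_Icc[OF continuous_lump(1), of 0 "7 * l"]
    continuous_integrable_Icc[OF continuous_lump(4), of 0 "7 * l"]
  have "(\<integral>s. indicator {0..7 * l} s * (h s * (lump s + tail_lump s)) \<partial>lborel) \<le>
      (\<integral>s. a * (indicator {0..7 * l} s * lump s) + b * (indicator {0..7 * l} s * tail_lump s) \<partial>lborel)"
  proof (rule integral_mono)
    show "integrable lborel (\<lambda>s. indicator {0..7 * l} s * (h s * (lump s + tail_lump s)))"
      by (intro continuous_integrable_Icc continuous_intros continuous_lump continuous_on_subset[OF
          assms(1)]) auto
    fix s
    have 1: "h s * lump s \<le> a * lump s" if "0 \<le> s"
    proof (cases "s \<le> 2 / k\<^sup>2")
      case True
      then show ?thesis using near[OF that] lump_nonneg by (intro mult_right_mono) auto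
    qed (simp add: lump_outside)
    have 2: "h s * tail_lump s \<le> b * tail_lump s"
    proof (cases "5 * l \<le> s \<and> s \<le> 6 * l")
      case True
      then show ?thesis using far lump_nonneg by (intro mult_right_mono) auto
    qed (auto simp: tail_lump_outside)
    show "indicator {0..7 * l} s * (h s * (lump s + tail_lump s)) \<le>
        a * (indicator {0..7 * l} s * lump s) + b * (indicator {0..7 * l} s * tail_lump s)"
      using 1 2 by (auto simp: indicator_def algebra_simps)
  qed (use i in auto)
  also have "\<dots> = a + b" using i lump_mass by simp
  finally show ?thesis .
qed

text \<open>Both pairings concentrate at the vertex. The first is rewritten by means of the
  antiderivative of \<open>dwave e0\<close>, whose reflected wave has the opposite sign to that of \<open>wave e0\<close>: this
  is where \<open>2 - q\<close> and \<open>q\<close> come from.\<close>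

lemma dwave_pairing:
  "amp * (2 - q) * exp (- (2 / k)) - 2 * exp (- (3 * k * l)) \<le>
    - (\<integral>s. indicator {0..7 * l} s * (dwave e0 s * chi s * plateau s) \<partial>lborel)"
proof -
  define Y where "Y s = res s + (1 - q) * decay s" for s
  have Y: "(Y has_real_derivative dwave e0 s) (at s)" for s
    unfolding Y_def[abs_def] dwave_def
    by (rule DERIV_cong[OF DERIV_add[OF DERIV_res DERIV_cmult[OF DERIV_decay]]]) (simp add:
        algebra_simps)
  have cY: "continuous_on A Y" for A by (meson DERIV_continuous_on has_field_derivative_at_within Y)
  have "(\<integral>s. indicator {0..7 * l} s * (dwave e0 s * plateau s + Y s * (lump s - tail_lump s)) \<partial>lborel) =
      Y (7 * l) * plateau (7 * l) - Y 0 * plateau 0"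
  proof (rule FTC_Icc[where F="\<lambda>s. Y s * plateau s"])
    show "((\<lambda>s. Y s * plateau s) has_real_derivative dwave e0 s * plateau s +
        Y s * (lump s - tail_lump s)) (at s)" for s
      by (rule DERIV_cong[OF DERIV_mult[OF Y DERIV_plateau]]) simp
  qed (use l_pos in \<open>auto intro!: continuous_intros continuous_profiles continuous_lump cY\<close>)
  also have "\<dots> = 0" using plateau_0 plateau_far[of "7 * l"] l_pos by simp
  finally have "(\<integral>s. indicator {0..7 * l} s * (dwave e0 s * plateau s) \<partial>lborel) +
      (\<integral>s. indicator {0..7 * l} s * (Y s * (lump s - tail_lump s)) \<partial>lborel) = 0"
    unfolding distrib_left
    by (subst (asm) Bochner_Integration.integral_add)
      (auto intro!: continuous_integrable_Icc continuous_intros continuous_profiles continuous_lump cY)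
  moreover have "dwave e0 s * chi s * plateau s = dwave e0 s * plateau s" for s
    using plateau_far[of s] chi_near[of s] by (cases "6 * l \<le> s") auto
  then have "(\<integral>s. indicator {0..7 * l} s * (dwave e0 s * chi s * plateau s) \<partial>lborel) =
      (\<integral>s. indicator {0..7 * l} s * (dwave e0 s * plateau s) \<partial>lborel)"
    by (simp only:)
  moreover have "- (\<integral>s. indicator {0..7 * l} s * (Y s * (lump s - tail_lump s)) \<partial>lborel) \<le>
      - (amp * (2 - q) * exp (- (2 / k))) + 2 * exp (- (3 * k * l))"
  proof -
    \<comment> \<open>The sign of the far part is absorbed into the weight, which is \<open>- Y\<close> on
      \<open>s \<le> 3 l\<close> and \<open>Y\<close> on \<open>s \<ge> 4 l\<close>.\<close>
    define Z where "Z s = - Y s * chi (s + 3 * l) + Y s * (1 - chi (s + 3 * l))" for s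
    have "Z s * (lump s + tail_lump s) = - (Y s * (lump s - tail_lump s))" for s
    proof -
      consider "s \<le> 3 * l" | "3 * l < s" "s < 5 * l" | "5 * l \<le> s" by linarith
      then show ?thesis
      proof cases
        case 1
        then show ?thesis using chi_near[of "s + 3 * l"] tail_lump_outside[of s] l_pos
            by (simp add: Z_def)
      next
        case 2
        then show ?thesis using lump_outside[of s] tail_lump_outside[of s] k_large l_pos by simp
      next
        case 3
        then show ?thesis using chi_far[of "s + 3 * l"] lump_outside[of s] k_large l_pos
            by (simp add: Z_def)
      qed
    qed
    then have "- (\<integral>s. indicator {0..7 * l} s * (Y s * (lump s - tail_lump s)) \<partial>lborel) =
        (\<integral>s. indicator {0..7 * l} s * (Z s * (lump s + tail_lump s)) \<partial>lborel)"
      by simp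
    also have "\<dots> \<le> - (amp * (2 - q) * exp (- (2 / k))) + 2 * exp (- (3 * k * l))"
    proof (rule lump_average_le)
      show "continuous_on UNIV Z" unfolding Z_def[abs_def]
        by (intro continuous_intros cY continuous_on_compose2[OF continuous_chi(1)[of UNIV]]) auto
      fix s
      show "Z s \<le> - (amp * (2 - q) * exp (- (2 / k)))" if s: "0 \<le> s" "s \<le> 2 / k\<^sup>2"
      proof -
        have sl: "s \<le> l" using s k_large by simp
        have "k * s \<le> k * (2 / k\<^sup>2)" using s k_pos by (intro mult_left_mono) auto
        also have "\<dots> = 2 / k" using k_pos by (simp add: power2_eq_square)
        finally have e: "exp (- (2 / k)) \<le> exp (- (k * s))" by simp
        have "- (2 / k) \<le> 0" "0 \<le> k * s" using s k_pos by simp_all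
        then have "exp (- (2 / k)) \<le> exp (k * s)" unfolding exp_le_cancel_iff by (rule order_trans)
        moreover have "(1 - q) * exp (- (2 / k)) \<le> (1 - q) * exp (- (k * s))"
          using e q_bounds by (intro mult_left_mono) auto
        ultimately have "exp (- (2 / k)) + (1 - q) * exp (- (2 / k)) \<le> exp (k * s) +
            (1 - q) * exp (- (k * s))"
          by (rule add_mono)
        moreover have "(2 - q) * exp (- (2 / k)) = exp (- (2 / k)) + (1 - q) * exp (- (2 / k))"
          by (simp add: algebra_simps)
        ultimately have "(2 - q) * exp (- (2 / k)) \<le> exp (k * s) + (1 - q) * exp (- (k * s))" by simp
        then have "amp * ((2 - q) * exp (- (2 / k))) \<le> amp * (exp (k * s) + (1 - q) * exp (- (k * s)))"
          using amp_pos by simp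
        also have "\<dots> = Y s" using res_near[OF sl] by (simp add: Y_def decay_def algebra_simps)
        finally show ?thesis using chi_near[of "s + 3 * l"] sl l_pos by (simp add: Z_def mult.assoc)
      qed
      show "Z s \<le> 2 * exp (- (3 * k * l))" if s: "5 * l \<le> s" "s \<le> 6 * l"
      proof -
        have "(1 - q) * decay s \<le> 1 * exp (- (3 * k * l))"
          using q_bounds decay_far[OF s(1)] decay_bounds(1)[of s] by (intro mult_mono) auto
        then have "Y s \<le> 2 * exp (- (3 * k * l))" using res_far(1)[OF s(1)] by (simp add: Y_def)
        then show ?thesis using chi_far[of "s + 3 * l"] s l_pos by (simp add: Z_def)
      qed
    qed
    finally show ?thesis .
  qed
  ultimately show ?thesis by simp
qed

lemma wave_pairing:
  "(\<integral>s. indicator {0..7 * l} s * (wave e0 s * chi s * (lump s + tail_lump s)) \<partial>lborel) \<le>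
    amp * (exp (2 / k) - (1 - q) * exp (- (2 / k))) + 2 * exp (- (3 * k * l))"
proof (rule lump_average_le)
  show "continuous_on UNIV (\<lambda>s. wave e0 s * chi s)"
      by (intro continuous_intros continuous_profiles continuous_chi)
  fix s
  show "wave e0 s * chi s \<le> amp * (exp (2 / k) - (1 - q) * exp (- (2 / k)))" if s: "0 \<le> s" "s \<le> 2 / k\<^sup>2"
  proof -
    have sl: "s \<le> l" using s k_large by simp
    have "k * s \<le> k * (2 / k\<^sup>2)" using s k_pos by (intro mult_left_mono) auto
    also have "\<dots> = 2 / k" using k_pos by (simp add: power2_eq_square)
    finally have e: "exp (- (2 / k)) \<le> exp (- (k * s))" "exp (k * s) \<le> exp (2 / k)" by simp_all
    have "(1 - q) * exp (- (2 / k)) \<le> (1 - q) * exp (- (k * s))"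
      using e q_bounds by (intro mult_left_mono) auto
    from diff_mono[OF e(2) this]
    have "amp * (exp (k * s) - (1 - q) * exp (- (k * s))) \<le>
        amp * (exp (2 / k) - (1 - q) * exp (- (2 / k)))"
      using amp_pos by (intro mult_left_mono) auto
    moreover have "wave e0 s = amp * (exp (k * s) - (1 - q) * exp (- (k * s)))"
      using res_near[OF sl] by (simp add: wave_def decay_def algebra_simps)
    ultimately show ?thesis using chi_near[of s] sl l_pos by simp
  qed
  show "wave e0 s * chi s \<le> 2 * exp (- (3 * k * l))" if s: "5 * l \<le> s" "s \<le> 6 * l"
    using profile_bounds_far(1)[OF s(1), of e0] chi_near[of s] s by simp
qed

end

section \<open>The estimate as \<open>k \<rightarrow> \<infinity>\<close>\<close>

context star_profiles
begin

text \<open>The estimate at scale \<open>k\<close>, divided by \<open>amp\<close>. As \<open>amp \<ge> exp (- 2 k l)\<close>, the division costs a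
  factor \<open>exp (2 k l)\<close> at most, and the errors of order \<open>exp (- 3 k l)\<close> and \<open>exp (- k\<^sup>2 \<tau>)\<close>, up to
  powers of \<open>k\<close>, remain negligible. The constant \<open>N\<close> does not depend on \<open>k\<close>.\<close>

lemma estimate_at_scale:
  fixes P :: "real \<Rightarrow> ('e \<times> real \<Rightarrow> real) \<Rightarrow> 'e \<times> real \<Rightarrow> real"
  assumes heat: "heat_semigroup G P" and grad: "gradient_estimate G P \<tau> C" and \<tau>: "0 \<le> \<tau>" and C: "0 \<le> C"
    and K: "\<And>t f. 0 \<le> t \<Longrightarrow> t \<le> \<tau> \<Longrightarrow> f \<in> L2 (graph_measure G) \<Longrightarrow>
      L2_norm (graph_measure G) (P t f) \<le> K * L2_norm (graph_measure G) f"
    and K0: "0 \<le> K"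
    and c0: "0 < c" and c: "\<And>x. \<bar>step1 x\<bar> \<le> c" "\<And>x. \<bar>step2 x\<bar> \<le> c"
    and c1: "c1 = c / l + c / l\<^sup>2" and c2: "c2 = c + c / l" and D: "D = real (degree G v) * (7 * l)"
    and N: "N = 2 * (1 + C) + K * D * (3 + 3 * C * c2) + \<tau> * K * D * (6 * c1 + 6 * C * c1 * c2)"
  shows "(2 - q) * exp (- (2 / k)) \<le> C * (exp (2 / k) - (1 - q) * exp (- (2 / k)))
    + exp (2 * k * l) * (N * k ^ 4 * (exp (- (k\<^sup>2 * \<tau>)) + exp (- (3 * k * l))))"
proof -
  let ?M = "graph_measure G" and ?n = "L2_norm (graph_measure G)" and ?E = "exp (- (3 * k * l))"
  let ?T = "exp (- (k\<^sup>2 * \<tau>))"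
  define f where "f = star (on_leg e0 plateau)"
  define g where "g = star (on_leg e0 (\<lambda>s. lump s + tail_lump s))"
  define u where "u = star (\<lambda>e s. wave e s * chi s)"
  define w where "w = star (\<lambda>e s. dwave e s * chi s)"
  define \<epsilon> where "\<epsilon> = star (cut_error wave wave1)"
  define \<epsilon>' where "\<epsilon>' = star (cut_error dwave dwave1)"
  let ?e2 = "\<lambda>e s. k\<^sup>2 * wave e s - 2 * k * (at_e0 e * psi s)"
  let ?o2 = "\<lambda>e s. k\<^sup>2 * dwave e s - 2 * k * (at_e0 e * psi1 s)"
  have "plateau s = 0" if "s \<le> 0" for s
  proof -
    have "k\<^sup>2 * s \<le> 0" "1 / l * s \<le> 0" using that l_pos
        by (simp_all add: mult_nonneg_nonpos divide_nonpos_pos)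
    then show ?thesis unfolding plateau_def by (simp add: step_le_0)
  qed
  then have van_f: "plateau s = 0" "lump s = 0" "tail_lump s = 0" "lump1 s = 0" "tail_lump1 s =
      0" "lump2 s = 0" "tail_lump2 s = 0"
    if "s \<le> 0 \<or> 6 * l \<le> s" for s
    using that lump_outside[of s] tail_lump_outside[of s] plateau_far[of s] k_large l_pos
    by auto
  have lap_f: "is_laplacian G f (star (on_leg e0 (\<lambda>s. lump1 s - tail_lump1 s)))"
    unfolding f_def
    by (rule on_leg_laplacian[OF DERIV_plateau DERIV_diff[OF DERIV_lump(1,3)]])
      (use van_f in \<open>auto intro!: continuous_intros continuous_lump\<close>)
  have lap_g: "is_laplacian G g (star (on_leg e0 (\<lambda>s. lump2 s + tail_lump2 s)))"
    unfolding g_def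
    by (rule on_leg_laplacian[OF DERIV_add[OF DERIV_lump(1,3)] DERIV_add[OF DERIV_lump(2,4)]])
      (use van_f in \<open>auto intro!: continuous_intros continuous_lump\<close>)
  have lap_u: "is_laplacian G u (star (cut_laplacian wave wave1 ?e2))"
    unfolding u_def
    by (rule cut_is_laplacian[OF DERIV_wave DERIV_wave1 _ vertex_conditions(1)])
      (use sum_at_e0 in \<open>auto intro!: continuous_intros continuous_profiles continuous_psi
        simp: vertex_conditions(2) sum_distrib_left[symmetric]\<close>)
  have lap_w: "is_laplacian G w (star (cut_laplacian dwave dwave1 ?o2))"
    unfolding w_def
    by (rule cut_is_laplacian[OF DERIV_dwave DERIV_dwave1 _ vertex_conditions(3)])
      (use sum_at_e0 in \<open>auto intro!: continuous_intros continuous_profiles continuous_psi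
        simp: vertex_conditions(4) sum_distrib_left[symmetric]\<close>)
  have \<psi>L: "star (on_leg e0 psi) \<in> L2 ?M" "star (on_leg e0 psi1) \<in> L2 ?M"
    using psi_outside l_pos by (auto intro!: star_on_leg_L2 continuous_psi)
  have \<epsilon>L: "\<epsilon> \<in> L2 ?M" "\<epsilon>' \<in> L2 ?M"
    unfolding \<epsilon>_def \<epsilon>'_def by (intro star_L2 cut_error_props continuous_profiles; assumption)+
  have test: "- (\<integral>p. star (on_leg e0 psi1) p * P t f p \<partial>?M) \<le>
      C * (\<integral>p. star (on_leg e0 psi) p * P t g p \<partial>?M)"
    if t: "0 \<le> t" "t \<le> \<tau>" for t
  proof -
    have "- (\<integral>p. star (on_leg e0 psi1) p * P t (star (on_leg e0 plateau)) p \<partial>?M) \<le>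
        C * (\<integral>p. star (on_leg e0 psi) p * P t (star (on_leg e0 (\<lambda>s. \<bar>lump s - tail_lump s\<bar>))) p \<partial>?M)"
    proof (rule tested_gradient_estimate[OF heat grad t e0 DERIV_plateau _ _ lap_f[unfolded f_def]
        DERIV_psi
          continuous_psi(2) psi_nonneg])
      show "continuous_on UNIV (\<lambda>s. lump s - tail_lump s)" by (intro continuous_intros continuous_lump)
      show "0 < l" "2 * l < 7 * l" using l_pos by simp_all
      show "lump s - tail_lump s = 0" if "7 * l \<le> s" for s using van_f[of s] that l_pos by simp
      show "psi s = 0" "psi1 s = 0" if "s \<notin> {l..2 * l}" for s using psi_outside[of s] that by auto
    qed
    then show ?thesis unfolding abs_lump_diff f_def g_def .
  qed
  have main: "- (\<integral>p. w p * f p \<partial>?M) \<le> C * (\<integral>p. u p * g p \<partial>?M)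
    + exp (- k\<^sup>2 * \<tau>) * K * (?n w * ?n f + C * (?n u * ?n g)) + \<tau> * K * (?n \<epsilon>' * ?n f +
        C * (?n \<epsilon> * ?n g))"
  proof (rule laplace_transformed_estimate[OF heat \<tau> _ _ C K K0 lap_f lap_g lap_u lap_w \<psi>L \<epsilon>L _ _ test])
    show "k\<^sup>2 * u p - star (cut_laplacian wave wave1 ?e2) p = 2 * k * star (on_leg e0 psi) p + \<epsilon> p" for p
      unfolding u_def \<epsilon>_def by (rule cut_resolvent) (use psi_outside in auto)
    show "k\<^sup>2 * w p - star (cut_laplacian dwave dwave1 ?o2) p = 2 * k * star (on_leg e0 psi1) p +
        \<epsilon>' p" for p
      unfolding w_def \<epsilon>'_def by (rule cut_resolvent) (use psi_outside in auto)
  qed (use k_pos in auto)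
  have uL: "u \<in> L2 ?M" "w \<in> L2 ?M" using lap_u lap_w by (auto simp: is_laplacian_def form_domain_def)
  have lower: "amp * (2 - q) * exp (- (2 / k)) - 2 * ?E \<le> - (\<integral>p. w p * f p \<partial>?M)"
    using dwave_pairing l_pos unfolding w_def f_def
    by (subst star_on_leg_star_pairing[OF uL(2)[unfolded w_def] continuous_lump(7)]) (auto simp:
        plateau_far)
  have upper: "(\<integral>p. u p * g p \<partial>?M) \<le> amp * (exp (2 / k) - (1 - q) * exp (- (2 / k))) + 2 * ?E"
    using wave_pairing unfolding u_def g_def
    by (subst star_on_leg_star_pairing[OF uL(1)[unfolded u_def] continuous_on_add[OF
        continuous_lump(1,4)]])
      (use van_f l_pos in auto)
  have Dp: "0 \<le> D" using l_pos by (simp add: D)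
  have c1p: "0 < c1" and c2p: "0 < c2" using c0 l_pos by (auto simp: c1 c2 add_pos_pos)
  have chi_c: "\<bar>chi1 s\<bar> \<le> c1" "\<bar>chi2 s\<bar> \<le> c1" for s
  proof -
    have "\<bar>chi1 s\<bar> \<le> c / l" "\<bar>chi2 s\<bar> \<le> c / l\<^sup>2"
      using c l_pos by (simp_all add: chi1_def chi2_def abs_mult divide_right_mono power2_eq_square)
    moreover have "0 < c / l" "0 < c / l\<^sup>2" using c0 l_pos by simp_all
    ultimately show "\<bar>chi1 s\<bar> \<le> c1" "\<bar>chi2 s\<bar> \<le> c1" unfolding c1 by linarith+
  qed
  have norm_le: "?n (star U) \<le> m * sqrt D"
    if "\<And>e. continuous_on UNIV (U e)" "\<And>e s. 7 * l \<le> s \<Longrightarrow> U e s = 0"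
      "\<And>e s. 0 \<le> s \<Longrightarrow> \<bar>U e s\<bar> \<le> m" for U m
    unfolding D using that(3)[of 0 e0] by (intro star_norm_le that) auto
  have pow: "1 \<le> k ^ 4" "k \<le> k ^ 4" "k\<^sup>2 \<le> k ^ 4" "k ^ 3 \<le> k ^ 4"
    using k_ge_1 power_increasing[of 0 4 k] power_increasing[of 1 4 k] power_increasing[of 2 4 k]
        power_increasing[of 3 4 k] by auto
  have kk: "1 \<le> k\<^sup>2" "k \<le> k\<^sup>2" using k_ge_1 power_increasing[of 0 2 k] power_increasing[of 1 2 k] by auto
  have nu: "?n u \<le> 3 * k * sqrt D" "?n w \<le> 3 * k * sqrt D"
  proof -
    have mult_chi: "\<bar>a * chi s\<bar> \<le> 3 * k" if "\<bar>a\<bar> \<le> 3 * k" for a s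
      using mult_mono[OF that, of "\<bar>chi s\<bar>" 1] chi_bounds[of s] k_pos by (simp add: abs_mult)
    show "?n u \<le> 3 * k * sqrt D" "?n w \<le> 3 * k * sqrt D"
      unfolding u_def w_def
      by (rule norm_le; auto intro!: continuous_intros continuous_profiles continuous_chi mult_chi
          profile_bounds simp: chi_far)+
  qed
  have ne: "?n \<epsilon> \<le> 6 * k\<^sup>2 * c1 * ?E * sqrt D" "?n \<epsilon>' \<le> 6 * k\<^sup>2 * c1 * ?E * sqrt D"
  proof -
    have "\<bar>cut_error wave wave1 e s\<bar> \<le> (2 * (2 * k * ?E) + 2 * ?E) * c1" for e s
      by (rule cut_error_le) (use profile_bounds_far chi_c l_pos in auto)
    moreover have "(2 * (2 * k * ?E) + 2 * ?E) * c1 \<le> 6 * k\<^sup>2 * c1 * ?E"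
    proof -
      have "(4 * k + 2) * (?E * c1) \<le> (6 * k\<^sup>2) * (?E * c1)" using kk c1p by (intro mult_right_mono) auto
      then show ?thesis by (simp add: algebra_simps)
    qed
    ultimately have 1: "\<bar>cut_error wave wave1 e s\<bar> \<le> 6 * k\<^sup>2 * c1 * ?E" for e s by (meson order_trans)
    have "\<bar>cut_error dwave dwave1 e s\<bar> \<le> (2 * (2 * k\<^sup>2 * ?E) + 2 * k * ?E) * c1" for e s
      by (rule cut_error_le) (use profile_bounds_far chi_c l_pos in auto)
    moreover have "(2 * (2 * k\<^sup>2 * ?E) + 2 * k * ?E) * c1 \<le> 6 * k\<^sup>2 * c1 * ?E"
    proof -
      have "(4 * k\<^sup>2 + 2 * k) * (?E * c1) \<le> (6 * k\<^sup>2) * (?E * c1)" using kk c1p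
          by (intro mult_right_mono) auto
      then show ?thesis by (simp add: algebra_simps)
    qed
    ultimately have 2: "\<bar>cut_error dwave dwave1 e s\<bar> \<le> 6 * k\<^sup>2 * c1 * ?E" for e s by (meson order_trans)
    show "?n \<epsilon> \<le> 6 * k\<^sup>2 * c1 * ?E * sqrt D" "?n \<epsilon>' \<le> 6 * k\<^sup>2 * c1 * ?E * sqrt D"
      unfolding \<epsilon>_def \<epsilon>'_def
      by (rule norm_le; (rule cut_error_props continuous_profiles 1 2 | assumption)+)+
  qed
  have nf: "?n f \<le> 1 * sqrt D" unfolding f_def
    by (rule norm_le) (use van_f l_pos plateau_le in \<open>auto simp: on_leg_def continuous_lump\<close>)
  have ng: "?n g \<le> c2 * k\<^sup>2 * sqrt D" unfolding g_def
  proof (rule norm_le)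
    fix e s
    have "\<bar>lump s + tail_lump s\<bar> \<le> c2 * k\<^sup>2"
    proof -
      have "lump s \<le> k\<^sup>2 * c" "tail_lump s \<le> 1/l * c"
        unfolding lump_def tail_lump_def using c(1) l_pos
            by (auto intro!: mult_left_mono divide_right_mono intro: order_trans[OF abs_ge_self])
      moreover have "1/l * c * 1 \<le> 1/l * c * k\<^sup>2" using kk c0 l_pos by (intro mult_left_mono) auto
      ultimately show ?thesis using lump_nonneg[of s] by (simp add: c2 algebra_simps)
    qed
    then show "\<bar>on_leg e0 (\<lambda>s. lump s + tail_lump s) e s\<bar> \<le> c2 * k\<^sup>2"
      using c2p by (auto simp: on_leg_def)
  qed (use van_f l_pos in \<open>auto simp: on_leg_def intro!: continuous_intros continuous_lump\<close>)
  have sD: "sqrt D * sqrt D = D" using Dp by simp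
  have p1: "?n w * ?n f \<le> 3 * k * D" "?n \<epsilon>' * ?n f \<le> 6 * k\<^sup>2 * c1 * ?E * D"
    "?n u * ?n g \<le> 3 * k * (c2 * k\<^sup>2) * D" "?n \<epsilon> * ?n g \<le> 6 * k\<^sup>2 * c1 * ?E * (c2 * k\<^sup>2) * D"
    using mult_mono[OF nu(2) nf] mult_mono[OF ne(2) nf] mult_mono[OF nu(1) ng] mult_mono[OF ne(1)
        ng] sD Dp k_pos c1p c2p
    by (simp_all add: mult.assoc mult.left_commute[of "sqrt D"])
  have b1: "exp (- k\<^sup>2 * \<tau>) * K * (?n w * ?n f + C * (?n u * ?n g)) \<le> ?T * (K * D * (3 +
      3 * C * c2) * k ^ 4)"
  proof -
    have "?n w * ?n f + C * (?n u * ?n g) \<le> 3 * k * D + C * (3 * k * (c2 * k\<^sup>2) * D)"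
      using C p1 by (intro add_mono mult_left_mono) auto
    also have "\<dots> = D * (3 * k) + D * (3 * C * c2) * k ^ 3"
        by (simp add: power2_eq_square power3_eq_cube algebra_simps)
    also have "\<dots> \<le> D * (3 * k ^ 4) + D * (3 * C * c2) * k ^ 4"
      using pow Dp C c2p by (intro add_mono mult_left_mono) auto
    finally have "?T * K * (?n w * ?n f + C * (?n u * ?n g)) \<le> ?T * K * (D * (3 * k ^ 4) +
        D * (3 * C * c2) * k ^ 4)"
      using K0 by (intro mult_left_mono) auto
    then show ?thesis by (simp add: algebra_simps)
  qed
  have b2: "\<tau> * K * (?n \<epsilon>' * ?n f + C * (?n \<epsilon> * ?n g)) \<le> ?E * (\<tau> * K * D * (6 * c1 +
      6 * C * c1 * c2) * k ^ 4)"
  proof -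
    have "?n \<epsilon>' * ?n f + C * (?n \<epsilon> * ?n g) \<le> 6 * k\<^sup>2 * c1 * ?E * D +
        C * (6 * k\<^sup>2 * c1 * ?E * (c2 * k\<^sup>2) * D)"
      using C p1 by (intro add_mono mult_left_mono) auto
    also have "\<dots> = (6 * c1 * ?E * D) * k\<^sup>2 + (6 * C * c1 * c2 * ?E * D) * k ^ 4"
        by (simp add: power2_eq_square eval_nat_numeral algebra_simps)
    also have "\<dots> \<le> (6 * c1 * ?E * D) * k ^ 4 + (6 * C * c1 * c2 * ?E * D) * k ^ 4"
      using pow Dp C c1p c2p by (intro add_mono mult_left_mono) auto
    finally have "\<tau> * K * (?n \<epsilon>' * ?n f + C * (?n \<epsilon> * ?n g)) \<le>
        \<tau> * K * ((6 * c1 * ?E * D) * k ^ 4 + (6 * C * c1 * c2 * ?E * D) * k ^ 4)"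
      using K0 \<tau> by (intro mult_left_mono) auto
    then show ?thesis by (simp add: algebra_simps)
  qed
  define Z where "Z = (2 - q) * exp (- (2 / k)) - C * (exp (2 / k) - (1 - q) * exp (- (2 / k)))"
  define N1 N2 N3 where "N1 = K * D * (3 + 3 * C * c2)" and "N2 = \<tau> * K * D * (6 * c1 +
      6 * C * c1 * c2)" and "N3 = 2 * (1 + C)"
  have Np: "0 \<le> N1" "0 \<le> N2" "0 \<le> N3" "N = N1 + N2 + N3"
    using K0 Dp C c1p c2p \<tau> by (auto simp: N1_def N2_def N3_def N)
  have "C * (\<integral>p. u p * g p \<partial>?M) \<le> C * (amp * (exp (2 / k) - (1 - q) * exp (- (2 / k))) + 2 * ?E)"
    using upper C by (rule mult_left_mono)
  then have "amp * Z \<le> N3 * ?E + ?T * (N1 * k ^ 4) + ?E * (N2 * k ^ 4)"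
    using main lower b1 b2 unfolding Z_def N3_def N1_def N2_def by (simp add: algebra_simps)
  also have "\<dots> \<le> (N3 * k ^ 4) * ?E + ?T * (N1 * k ^ 4) + ?E * (N2 * k ^ 4)"
    using mult_left_mono[OF pow(1) Np(3)] by (intro add_right_mono mult_right_mono) auto
  also have "\<dots> \<le> N * k ^ 4 * (?T + ?E)"
  proof -
    have "0 \<le> N3 * k ^ 4 * ?T + N2 * k ^ 4 * ?T + N1 * k ^ 4 * ?E" using Np by simp
    then show ?thesis unfolding Np(4) by (simp add: algebra_simps)
  qed
  finally have R: "amp * Z \<le> N * k ^ 4 * (?T + ?E)" .
  have R0: "0 \<le> N * k ^ 4 * (?T + ?E)" using Np by simp
  have "Z \<le> exp (2 * k * l) * (N * k ^ 4 * (?T + ?E))"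
  proof (cases "Z \<le> 0")
    case True
    then show ?thesis using R0 by (meson exp_ge_zero mult_nonneg_nonneg order_trans)
  next
    case False
    then have "exp (- (2 * k * l)) * Z \<le> amp * Z" using amp_ge by (intro mult_right_mono) auto
    then have "exp (2 * k * l) * (exp (- (2 * k * l)) * Z) \<le> exp (2 * k * l) * (N * k ^ 4 * (?T + ?E))"
      using R by (intro mult_left_mono) auto
    moreover have "exp (2 * k * l) * (exp (- (2 * k * l)) * Z) = Z" by (simp flip: mult.assoc exp_add)
    ultimately show ?thesis by simp
  qed
  then show ?thesis by (simp add: Z_def)
qed

end

context metric_graph
begin

lemma degree_bound:
  fixes P :: "real \<Rightarrow> ('e \<times> real \<Rightarrow> real) \<Rightarrow> 'e \<times> real \<Rightarrow> real"
  assumes heat: "heat_semigroup G P" and grad: "gradient_estimate G P \<tau> C" and \<tau>: "0 < \<tau>" and C: "0 \<le> C"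
  shows "real (degree G v) - 1 \<le> C"
proof (cases "2 \<le> degree G v")
  case False
  then show ?thesis using C by simp
next
  case True
  \<comment> \<open>All profiles live within distance \<open>7 l\<close> of \<open>v\<close>.\<close>
  define l where "l = (if edges G = {} then 1 else Min (len G ` edges G) / 8)"
  have l: "0 < l" "\<And>e. e \<in> edges G \<Longrightarrow> 7 * l < len G e"
  proof -
    have m: "0 < Min (len G ` edges G)" if "edges G \<noteq> {}" using that finite_edges len_pos by simp
    then show "0 < l" by (simp add: l_def)
    fix e assume e: "e \<in> edges G"
    then have "Min (len G ` edges G) \<le> len G e" using finite_edges by simp
    moreover have "edges G \<noteq> {}" using e by auto
    ultimately show "7 * l < len G e" using m by (simp add: l_def)
  qed
  interpret metric_star G v "7 * l" by unfold_locales (use l in auto)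
  have "card incident \<noteq> 0" using True by (simp add: card_incident)
  then obtain e0 where e0: "e0 \<in> incident" by fastforce
  interpret L2_semigroup "graph_measure G" P using heat by unfold_locales (simp add: heat_semigroup_def)
  obtain K where K: "1 \<le> K" "\<And>t f. 0 \<le> t \<Longrightarrow> t \<le> \<tau> \<Longrightarrow> f \<in> L2 (graph_measure G) \<Longrightarrow>
      L2_norm (graph_measure G) (P t f) \<le> K * L2_norm (graph_measure G) f"
    using P_bounded_on[of \<tau>] by blast
  obtain c where c: "0 < c" "\<And>x. \<bar>step1 x\<bar> \<le> c" "\<And>x. \<bar>step2 x\<bar> \<le> c" using step_derivs_bounded by blast
  define q where "q = 2 / real (degree G v)"
  define N where "N = 2 * (1 + C) + K * (real (degree G v) * (7 * l)) * (3 + 3 * C * (c + c / l))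
    + \<tau> * K * (real (degree G v) * (7 * l)) * (6 * (c / l + c / l\<^sup>2) + 6 * C * (c / l +
        c / l\<^sup>2) * (c + c / l))"
  have ev: "\<forall>\<^sub>F k in at_top. (2 - q) * exp (- (2 / k)) \<le> C * (exp (2 / k) - (1 - q) * exp (- (2 / k)))
    + exp (2 * k * l) * (N * k ^ 4 * (exp (- (k\<^sup>2 * \<tau>)) + exp (- (3 * k * l))))"
  proof -
    have "((\<lambda>k::real. 2 / k\<^sup>2) \<longlongrightarrow> 0) at_top" by real_asymp
    then have "\<forall>\<^sub>F k in at_top. 2 / k\<^sup>2 < l" using l(1) by (rule order_tendstoD(2))
    then show ?thesis using eventually_ge_at_top[of 1]
    proof eventually_elim
      case (elim k)
      have sp: "star_profiles G v l k e0" by unfold_locales (use elim l e0 True in auto)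
      show ?case
        using star_profiles.estimate_at_scale[OF sp heat grad less_imp_le[OF \<tau>] C K(2) _ c refl refl
            refl N_def] K(1)
        unfolding star_profiles.q_def[OF sp] q_def[symmetric] by linarith
    qed
  qed
  have lim1: "((\<lambda>k. (2 - q) * exp (- (2 / k))) \<longlongrightarrow> 2 - q) at_top" by real_asymp
  have lim2: "((\<lambda>k. C * (exp (2 / k) - (1 - q) * exp (- (2 / k)))
    + exp (2 * k * l) * (N * k ^ 4 * (exp (- (k\<^sup>2 * \<tau>)) +
        exp (- (3 * k * l))))) \<longlongrightarrow> C * (1 - (1 - q) * 1) + N * 0) at_top"
  proof (rule tendsto_add)
    show "((\<lambda>k. C * (exp (2 / k) - (1 - q) * exp (- (2 / k)))) \<longlongrightarrow> C * (1 - (1 - q) * 1)) at_top"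
      by (intro tendsto_intros) real_asymp+
    have "((\<lambda>k. k ^ 4 * exp (2 * k * l) * (exp (- (k\<^sup>2 * \<tau>)) + exp (- (3 * k * l)))) \<longlongrightarrow> 0) at_top"
      using l(1) \<tau> by real_asymp
    from tendsto_mult_left[OF this, of N]
    show "((\<lambda>k. exp (2 * k * l) * (N * k ^ 4 * (exp (- (k\<^sup>2 * \<tau>)) +
        exp (- (3 * k * l))))) \<longlongrightarrow> N * 0) at_top"
      by (simp add: mult_ac)
  qed
  have "2 - q \<le> C * q" using tendsto_le[OF _ lim2 lim1 ev] by simp
  then have "(2 - q) * real (degree G v) \<le> C * q * real (degree G v)" by (rule mult_right_mono) simp
  moreover have "q * real (degree G v) = 2" using True by (simp add: q_def)
  ultimately show ?thesis by (simp add: left_diff_distrib mult.assoc)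
qed

end

theorem theorem5p5:
  fixes G :: "('v, 'e) mgraph"
    and P :: "real \<Rightarrow> ('e \<times> real \<Rightarrow> real) \<Rightarrow> 'e \<times> real \<Rightarrow> real"
    and \<tau> :: real
  assumes "metric_graph G"
    and "verts G \<noteq> {}"
    and "heat_semigroup G P"
    and "0 < \<tau>"
  shows "ereal (Max ((\<lambda>v. real (degree G v) - 1) ` verts G)) \<le> optimal_constant G P \<tau>"
proof -
  interpret metric_graph G by (rule assms)
  \<comment> \<open>There may be infinitely many vertices, but all degrees are bounded.\<close>
  have "degree G v \<le> card (edges G) + card (rays G)" for v
    unfolding degree_def by (intro add_mono card_mono finite_edges finite_rays) auto
  then have "(\<lambda>v. real (degree G v) - 1) ` verts G \<subseteq> (\<lambda>n. real n - 1) ` {..card (edges G) + card (rays G)}"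
    by auto
  then have fin: "finite ((\<lambda>v. real (degree G v) - 1) ` verts G)" by (rule finite_subset) simp
  show ?thesis
    unfolding optimal_constant_def
  proof (rule Inf_greatest)
    fix x assume "x \<in> {ereal C |C. 0 \<le> C \<and> gradient_estimate G P \<tau> C}"
    then obtain C where C: "x = ereal C" "0 \<le> C" "gradient_estimate G P \<tau> C" by blast
    have "Max ((\<lambda>v. real (degree G v) - 1) ` verts G) \<le> C"
      using degree_bound[OF assms(3) C(3) assms(4) C(2)] fin assms(2) by (subst Max_le_iff) auto
    then show "ereal (Max ((\<lambda>v. real (degree G v) - 1) ` verts G)) \<le> x" by (simp add: C(1))
  qed
qed

end
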